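(* Let $\{\alpha_m\}_{m\in\mathbb N_0}$ be a sequence of real numbers for which $\sum_{m=0}^\infty\alpha_m$ converges absolutely. For each $m\in\mathbb N_0$ let $\sigma_m:[0,1]\to\{-1,+1\}$ be a function that is constant on each interval $[(k-1)2^{-m},k2^{-m})$, $k=1,\dots,2^m$, and let $$f(t):=\sum_{m=0}^\infty\alpha_m\sigma_m(t)\varphi(2^mt),\quad t\in[0,1],\qquad s_n^2:=\sum_{m=0}^{n-1}\alpha_m^24^m,\quad n\in\mathbb N.$$ Suppose that there exist $q\in[0,1)$ and a regularly varying function $g$, with index $\varrho\in\mathbb R$, such that $$\lim_{n\uparrow\infty}\frac{s_n^2}{2^{2qn}g(n)}=1.$$ Let $p:=1/(1-q)$, let $\{Y_m\}_{m\in\mathbb N}$ be an i.i.d. sequence of symmetric $\{-1,+1\}$-valued Bernoulli random variables, and let $\Phi_q:[0,1)\to[0,\infty)$ be given by $\Phi_q(0):=0$ and $\Phi_q(x):=x^{\frac1{1-q}}g\big(\frac{-\log_2x}{1-q}\big)^{-\frac1{2(1-q)}}$ for $0<x<1$. Then the following hold: (1) The function $f$ is of bounded variation if and only if $\lim_ns_n^2<\infty$, and, in this case, the total variation of $f$ equals $\mathbb E[|\widetilde Z|]$, where $\widetilde Z:=\sum_{m=0}^\infty\alpha_m2^mY_{m+1}$. (2) If $s_n^2\to\infty$ and $q=0$, then $\langle f\rangle_t^{\Phi_0}=\sqrt{\tfrac2\pi}\cdot t$ for all $t\in[0,1]$. (3) If $q>0$, then $\langle f\rangle_t^{\Phi_q}=\mathbb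 E\big[|Z|^{\frac1{1-q}}\big]\cdot t$ for all $t\in[0,1]$, where $Z:=\sqrt{2^{2q}-1}\sum_{m=1}^\infty2^{-qm}Y_m$. (4) The function $f$ has infinite $r$-th variation for $1\le r<p$ and vanishing $r$-th variation for $r>p$. (5) If $\lim_ng(n)=c$ for some $c\in[0,\infty]$, then $\langle f\rangle_t^{(p)}=c^{p/2}\langle f\rangle_t^{\Phi_q}$ for $t\in[0,1]$. (6) If $\varrho<0$, then $f$ has vanishing $p$-th variation; if $\varrho>0$, then $f$ has infinite $p$-th variation.
   Context: $\varphi(t):=\min_{z\in\mathbb Z}|z-t|$ is the tent map. A measurable, strictly positive function $g:[0,\infty)\to(0,\infty)$ is called regularly varying (at infinity) with index $\varrho\in\mathbb R$ if $g(\lambda x)/g(x)\to\lambda^\varrho$ as $x\uparrow\infty$ for every $\lambda>0$. All regularly varying functions are assumed to be defined on $[0,\infty)$ and bounded on compact intervals. For a function $\Phi\ge0$ with $\Phi(0)=0$, the $\Phi$-variation of a continuous function $f:[0,1]\to\mathbb R$ along the dyadic partitions is $$\langle f\rangle^\Phi_t:=\lim_{n\uparrow\infty}\sum_{k=0}^{\lfloor t2^n\rfloor}\Phi\big(|f((k+1)2^{-n})-f(k2^{-n})|\big),\qquad 0\le t\le1,$$ provided the limit exists for all $t\in[0,1]$ (a claimed formula includes existence of the limit); for $t=1$ the term $k=2^n$ is omitted, and only $n$ large enough that all increments have absolute value less than $1$ are considered, so that $\Phi$ need only be defined on $[0,1)$. For $r\ge1$, the $r$-th variation $\langle f\rangle^{(r)}_t$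 is the $\Phi$-variation for $\Phi(x)=x^r$, where the value $+\infty$ of the limit is allowed. "Infinite (respectively vanishing) $r$-th variation" means that $V_n^{(r)}:=\sum_{k=0}^{2^n-1}|f((k+1)2^{-n})-f(k2^{-n})|^r$ converges to $\infty$ (respectively to $0$) as $n\to\infty$. Bounded/total variation is in the usual sense (supremum over all finite partitions of $[0,1]$). A symmetric $\{-1,+1\}$-valued Bernoulli random variable takes each value with probability $\tfrac12$. Conventions: $\infty^{p/2}=\infty$, $\infty\cdot0=0$ (relevant only for $t=0$). The function $f$ is well defined and continuous. *)

theory Defs
  imports "HOL-Probability.Probability"
begin

definition tent_map :: "real \<Rightarrow> real" where
  "tent_map t = (INF z\<in>(UNIV :: int set). \<bar>of_int z - t\<bar>)"

(* Measurability is Lebesgue measurability on the half-line; values of g at negative arguments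
   are irrelevant. Local boundedness, a standing assumption on all regularly varying functions,
   is part of the definition. *)
definition regularly_varying :: "(real \<Rightarrow> real) \<Rightarrow> real \<Rightarrow> bool" where
  "regularly_varying g \<rho> \<longleftrightarrow>
     g \<in> borel_measurable (lebesgue_on {0..}) \<and>
     (\<forall>x\<ge>0. 0 < g x) \<and>
     (\<forall>l>0. ((\<lambda>x. g (l * x) / g x) \<longlongrightarrow> l powr \<rho>) at_top) \<and>
     (\<forall>a b. 0 \<le> a \<longrightarrow> a \<le> b \<longrightarrow> bounded (g ` {a..b}))"

definition total_variation :: "(real \<Rightarrow> real) \<Rightarrow> real \<Rightarrow> real \<Rightarrow> ereal" where
  "total_variation f a b =
     Sup {ereal (\<Sum>i<N. \<bar>f (x (Suc i)) - f (x i)\<bar>) | (x :: nat \<Rightarrow> real) N.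
            x 0 = a \<and> x N = b \<and> (\<forall>i<N. x i < x (Suc i))}"

(* The n-th dyadic sum up to time t. The index 2^n, which is reached only for t = 1, is dropped. *)
definition dyadic_sum :: "(real \<Rightarrow> real) \<Rightarrow> (real \<Rightarrow> real) \<Rightarrow> real \<Rightarrow> nat \<Rightarrow> real" where
  "dyadic_sum \<Phi> f t n =
     (\<Sum>k\<in>{..nat \<lfloor>t * 2 ^ n\<rfloor>} - {2 ^ n}. \<Phi> \<bar>f (real (k + 1) / 2 ^ n) - f (real k / 2 ^ n)\<bar>)"

(* V is the Phi-variation of f on [0,1], existence of all the limits included. For continuous f
   all increments are less than 1 for large n, so only the values of Phi on [0,1) matter. *)
definition has_Phi_variation ::
    "(real \<Rightarrow> real) \<Rightarrow> (real \<Rightarrow> real) \<Rightarrow> (real \<Rightarrow> ereal) \<Rightarrow> bool" where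
  "has_Phi_variation \<Phi> f V \<longleftrightarrow>
     (\<forall>t\<in>{0..1}. (\<lambda>n. ereal (dyadic_sum \<Phi> f t n)) \<longlonglongrightarrow> V t)"

(* The r-th variation. For r > 0, x powr r is 0 at x = 0. *)
abbreviation has_rth_variation :: "real \<Rightarrow> (real \<Rightarrow> real) \<Rightarrow> (real \<Rightarrow> ereal) \<Rightarrow> bool" where
  "has_rth_variation r \<equiv> has_Phi_variation (\<lambda>x. x powr r)"

definition dyadic_V :: "real \<Rightarrow> (real \<Rightarrow> real) \<Rightarrow> nat \<Rightarrow> real" where
  "dyadic_V r f n = (\<Sum>k<2 ^ n. \<bar>f (real (k + 1) / 2 ^ n) - f (real k / 2 ^ n)\<bar> powr r)"

definition infinite_variation :: "real \<Rightarrow> (real \<Rightarrow> real) \<Rightarrow> bool" where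
  "infinite_variation r f \<longleftrightarrow> filterlim (dyadic_V r f) at_top sequentially"

definition vanishing_variation :: "real \<Rightarrow> (real \<Rightarrow> real) \<Rightarrow> bool" where
  "vanishing_variation r f \<longleftrightarrow> dyadic_V r f \<longlonglongrightarrow> 0"

(* The function Phi_q; only its values on [0,1) are meaningful. *)
definition Phi :: "(real \<Rightarrow> real) \<Rightarrow> real \<Rightarrow> real \<Rightarrow> real" where
  "Phi g q x =
     (if x = 0 then 0
      else x powr (1 / (1 - q)) * g (- log 2 x / (1 - q)) powr (- 1 / (2 * (1 - q))))"

(* c^a for c in [0,\<infinity>] and a > 0, with \<infinity>^a = \<infinity>. *)
definition ereal_powr :: "ereal \<Rightarrow> real \<Rightarrow> ereal" where
  "ereal_powr c a = (if c = \<infinity> then \<infinity> else ereal (real_of_ereal c powr a))"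

(* An i.i.d. sequence, indexed from 1, of symmetric {-1,+1}-valued Bernoulli random variables. *)
definition iid_symmetric_bernoulli :: "'w measure \<Rightarrow> (nat \<Rightarrow> 'w \<Rightarrow> real) \<Rightarrow> bool" where
  "iid_symmetric_bernoulli M Y \<longleftrightarrow>
     prob_space M \<and>
     prob_space.indep_vars M (\<lambda>_. borel) Y {1..} \<and>
     (\<forall>m\<ge>1. Y m \<in> space M \<rightarrow> {-1, 1} \<and>
            measure M {\<omega> \<in> space M. Y m \<omega> = 1} = 1 / 2 \<and>
            measure M {\<omega> \<in> space M. Y m \<omega> = -1} = 1 / 2)"

end

(* On level n, the 2^n increments of f over the dyadic intervals of length 2^-n, multiplied by 2^n, are
   exactly the 2^n signed sums of a_m = alpha_m 2^m, m < n: bisecting an interval changes the slope by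
   + a_n on one half and by - a_n on the other. A dyadic variation sum is therefore an expectation over
   S_n = a_0 Y_1 + ... + a_{n-1} Y_n, and restricting it to a dyadic interval amounts to fixing the first signs.
   If s_n tends to infinity, fixed first signs are negligible and S_n / s_n converges in law by Levy's theorem,
   its characteristic function being a product of cosines: to a Gaussian for q = 0, where
   s_(n+1)^2 / s_n^2 tends to 1, and to Z for q > 0, where it tends to 2^(2q) > 1. Sub-Gaussian moment bounds
   give convergence of the p-th moments. Potter bounds for g show that, up to an error that the moments absorb,
   2^n Phi_q(2^-n s_n x) may be replaced by x^p. If s_n stays bounded, then q = 0, p = 1, and everything reduces
   to the total variation, which Kolmogorov's maximal inequality identifies as E|Zt|. *)

theory Submission
  imports Defs
begin

text \<open>The hypothesis controls the growth of s_n, not single coefficients. What it says about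
  them comes from s_(n+1)^2 / s_n^2: for q = 0 it gives a_n^2 / s_n^2 -> 0, a Lyapunov condition;
  for q > 0 it gives a_(n-1-j)^2 / s_n^2 -> (k - 1) / k^(j+1) with k = 2^(2q), so the weights read
  backwards from n become those of Z. The signs sigma_m may vary from interval to interval, but a
  sum over both halves of an interval does not see them. Hence sums over a binary tree carry the
  argument, and random variables enter only to identify limits. In Phi_q the argument of g is y = -p
  log_2 of an increment. For the increment 2^-n s_n x this is n plus a deviation of order ln n + |ln
  x|, so g(y) must be compared with g(n) for multipliers y / n that depend on x and n; pointwise
  regular variation does not give this. The relative error grows with |ln x| and is paid for by a
  moment of order p + 1. Statements (4), (6) and the equivalence in (1) rest on two-sided moment
  bounds uniform in n, so they need no limit law and no case distinction on s_n.\<close>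

section \<open>Uniform convergence for regularly varying functions\<close>

lemma regularly_varying_pos: "regularly_varying g \<rho> \<Longrightarrow> 0 \<le> x \<Longrightarrow> 0 < g x"
  by (simp add: regularly_varying_def)

lemma regularly_varying_log_ratio:
  assumes g: "regularly_varying g \<rho>" and l: "0 < l"
  shows "((\<lambda>x. ln (g (l * x)) - ln (g x) - \<rho> * ln l) \<longlongrightarrow> 0) at_top"
proof -
  have "((\<lambda>x. ln (g (l * x) / g x)) \<longlongrightarrow> ln (l powr \<rho>)) at_top"
    using g l by (intro tendsto_ln) (auto simp: regularly_varying_def)
  moreover have "eventually (\<lambda>x. ln (g (l * x) / g x) = ln (g (l * x)) - ln (g x)) at_top"
    using eventually_ge_at_top[of 0]
  proof eventually_elim
    case (elim x)
    then show ?case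
      using regularly_varying_pos[OF g, of x] regularly_varying_pos[OF g, of "l * x"] l
      by (simp add: ln_div)
  qed
  ultimately have "((\<lambda>x. ln (g (l * x)) - ln (g x)) \<longlongrightarrow> ln (l powr \<rho>)) at_top"
    by (rule Lim_transform_eventually)
  then show ?thesis
    using l by (auto simp: ln_powr dest: LIM_zero)
qed

text \<open>Lebesgue measurability survives a dilation, though not an arbitrary Borel substitution.
  Extending \<open>g\<close> by 0 to the whole line makes the dilation applicable.\<close>

lemma regularly_varying_measurable_scale:
  assumes g: "regularly_varying g \<rho>" and x: "0 < x" and S: "S \<in> sets lebesgue" "S \<subseteq> {0..}"
  shows "(\<lambda>l. ln (g (l * x))) \<in> borel_measurable (lebesgue_on S)"
proof -
  have gm: "(\<lambda>y. if y \<in> {0..} then g y else 0) \<in> borel_measurable lebesgue"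
    using g by (subst borel_measurable_if) (auto simp: regularly_varying_def)
  have "(\<lambda>l. if x *\<^sub>R l \<in> {0..} then g (x *\<^sub>R l) else 0) \<in> borel_measurable lebesgue"
    using measurable_compose[OF lebesgue_measurable_scaling[of x] gm] by simp
  then have "(\<lambda>l. ln (if x *\<^sub>R l \<in> {0..} then g (x *\<^sub>R l) else 0)) \<in> borel_measurable lebesgue"
    by (rule borel_measurable_ln)
  then have "(\<lambda>l. ln (if x *\<^sub>R l \<in> {0..} then g (x *\<^sub>R l) else 0)) \<in> borel_measurable (lebesgue_on S)"
    by (rule measurable_restrict_space1)
  then show ?thesis
    by (rule measurable_cong[THEN iffD1, rotated]) (use S x in \<open>auto simp: mult.commute\<close>)
qed

text \<open>An Egorov argument: the sets on which all later \<open>h m\<close> are small increase to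
  an interval of measure 8, so by continuity from below their measure eventually exceeds 7.\<close>

lemma eventually_measure_uniformly_small:
  fixes h :: "nat \<Rightarrow> real \<Rightarrow> real"
  assumes h: "\<And>n. h n \<in> borel_measurable (lebesgue_on {1..9})"
    and lim: "\<And>l. l \<in> {1..9} \<Longrightarrow> (\<lambda>n. h n l) \<longlonglongrightarrow> 0" and e: "0 < e"
  shows "eventually (\<lambda>n. {l\<in>{1..9}. \<forall>m\<ge>n. \<bar>h m l\<bar> < e} \<in> lmeasurable \<and>
     measure lebesgue {l\<in>{1..9}. \<forall>m\<ge>n. \<bar>h m l\<bar> < e} > 7) sequentially"
proof -
  define U where "U n = {l\<in>{1..9}. \<forall>m\<ge>n. \<bar>h m l\<bar> < e}" for n
  have Us: "U n \<in> sets lebesgue" for n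
  proof -
    have "(\<Inter>m\<in>{n..}. {l\<in>space (lebesgue_on {1..9}). \<bar>h m l\<bar> < e}) \<in> sets (lebesgue_on {1..9})"
    proof (rule sets.countable_INT')
      show "(\<lambda>m. {l\<in>space (lebesgue_on {1..9}). \<bar>h m l\<bar> < e}) ` {n..} \<subseteq> sets (lebesgue_on {1..9})"
        by (rule image_subsetI)
           (rule borel_measurable_less[OF borel_measurable_abs[OF h] borel_measurable_const])
    qed simp_all
    moreover have "(\<Inter>m\<in>{n..}. {l\<in>space (lebesgue_on {1..9}). \<bar>h m l\<bar> < e}) = U n"
      by (auto simp: U_def)
    ultimately have "U n \<in> sets (lebesgue_on {1..9})"
      by metis
    moreover have "{1..9::real} \<inter> space lebesgue \<in> sets lebesgue"
      by simp
    ultimately show ?thesis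
      using sets_restrict_space_iff[of "{1..9::real}" lebesgue "U n"] by metis
  qed
  have lm: "U n \<in> lmeasurable" for n
  proof (rule fmeasurableI2[OF _ _ Us])
    show "U n \<subseteq> {1..9}"
      by (auto simp: U_def)
  qed simp
  have inc: "incseq U"
    by (auto simp: incseq_def U_def)
  have "(\<Union>n. U n) = {1..9}"
  proof (rule antisym)
    show "{1..9} \<subseteq> (\<Union>n. U n)"
    proof
      fix l :: real assume l: "l \<in> {1..9}"
      from LIMSEQ_D[OF lim[OF l] e] l show "l \<in> (\<Union>n. U n)"
        by (auto simp: U_def)
    qed
  qed (auto simp: U_def)
  then have "(\<lambda>n. emeasure lebesgue (U n)) \<longlonglongrightarrow> emeasure lebesgue {1..9::real}"
    using Lim_emeasure_incseq[OF image_subsetI inc, OF Us] by metis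
  then have "eventually (\<lambda>n. emeasure lebesgue (U n) > ennreal 7) sequentially"
    by (rule order_tendstoD) (simp add: ennreal_less_iff)
  then show ?thesis
    unfolding U_def[symmetric]
    by eventually_elim (use lm in \<open>simp add: emeasure_eq_measure2 ennreal_less_iff del: emeasure_completion\<close>)
qed

text \<open>Uniform convergence on \<open>[1, 2]\<close>. If it failed along \<open>x n\<close> and \<open>u n\<close>, the set of good multipliers at \<open>x n\<close>
  and the \<open>u n\<close>-dilate of the set of good multipliers at \<open>u n * x n\<close> would both almost fill subsets of
  \<open>[1, 9 * u n]\<close> that have to overlap.\<close>

lemma regularly_varying_uniform:
  assumes g: "regularly_varying g \<rho>" and e: "0 < e"
  obtains X where "1 \<le> X"
    "\<And>x l. X \<le> x \<Longrightarrow> 1 \<le> l \<Longrightarrow> l \<le> 2 \<Longrightarrow> \<bar>ln (g (l * x)) - ln (g x) - \<rho> * ln l\<bar> \<le> e"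
proof (rule ccontr)
  assume "\<not> thesis"
  then have "\<exists>x l. x \<ge> max 1 (real n) \<and> 1 \<le> l \<and> l \<le> 2 \<and>
      \<bar>ln (g (l * x)) - ln (g x) - \<rho> * ln l\<bar> > e" for n
    using that[of "max 1 (real n)"] by force
  then obtain x u where xu: "\<And>n. x n \<ge> max 1 (real n)" "\<And>n. 1 \<le> u n" "\<And>n. u n \<le> 2"
    and bad: "\<And>n. \<bar>ln (g (u n * x n)) - ln (g (x n)) - \<rho> * ln (u n)\<bar> > e"
    by metis
  define k where "k y l = ln (g (l * y)) - ln (g y) - \<rho> * ln l" for y l
  have x_lim: "filterlim x at_top sequentially"
    by (rule filterlim_at_top_mono[OF filterlim_real_sequentially]) (use xu in force)
  have ux_lim: "filterlim (\<lambda>n. u n * x n) at_top sequentially"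
  proof (rule filterlim_at_top_mono[OF x_lim], rule always_eventually, rule allI)
    fix n show "x n \<le> u n * x n"
      using xu(1)[of n] xu(2)[of n] mult_right_mono[of 1 "u n" "x n"] by simp
  qed
  have meas: "(\<lambda>l. k y l) \<in> borel_measurable (lebesgue_on {1..9})" if "0 < y" for y
    unfolding k_def
    by (intro borel_measurable_diff regularly_varying_measurable_scale[OF g that]
          borel_measurable_const borel_measurable_times)
       (auto intro!: measurable_restrict_space1 borel_measurable_ln measurable_completion)
  have lim0: "(\<lambda>n. k (y n) l) \<longlonglongrightarrow> 0" if "filterlim y at_top sequentially" "l \<in> {1..9}" for y l
    unfolding k_def
    by (rule filterlim_compose[OF regularly_varying_log_ratio[OF g] that(1)]) (use that in auto)
  define U where "U n = {l\<in>{1..9}. \<forall>m\<ge>n. \<bar>k (x m) l\<bar> < e/2}" for n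
  define V where "V n = {l\<in>{1..9}. \<forall>m\<ge>n. \<bar>k (u m * x m) l\<bar> < e/2}" for n
  have xpos': "0 < u n" for n
    using xu(2)[of n] by linarith
  have "0 < x n" for n
    using xu(1)[of n] by linarith
  with xpos' have "0 < x n" "0 < u n * x n" for n
    by simp_all
  note xpos = this
  have "eventually (\<lambda>n. U n \<in> lmeasurable \<and> measure lebesgue (U n) > 7) sequentially"
    unfolding U_def
    by (rule eventually_measure_uniformly_small[OF meas[OF xpos(1)] lim0[OF x_lim]]) (use e in simp_all)
  moreover have "eventually (\<lambda>n. V n \<in> lmeasurable \<and> measure lebesgue (V n) > 7) sequentially"
    unfolding V_def
    by (rule eventually_measure_uniformly_small[OF meas[OF xpos(2)] lim0[OF ux_lim]]) (use e in simp_all)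
  ultimately have "eventually (\<lambda>n. (U n \<in> lmeasurable \<and> measure lebesgue (U n) > 7) \<and>
      (V n \<in> lmeasurable \<and> measure lebesgue (V n) > 7)) sequentially"
    by (rule eventually_conj)
  then obtain n where n: "U n \<in> lmeasurable" "measure lebesgue (U n) > 7"
      "V n \<in> lmeasurable" "measure lebesgue (V n) > 7"
    by (auto simp: eventually_sequentially)
  define W where "W = (\<lambda>l. u n *\<^sub>R l + 0) ` V n"
  have "W = (*\<^sub>R) (1 / u n) -` V n \<inter> space lebesgue"
    using xpos(2)[of n] xu(2)[of n] by (force simp: W_def image_iff)
  also have "\<dots> \<in> sets lebesgue"
    by (rule measurable_sets[OF lebesgue_measurable_scaling fmeasurableD[OF n(3)]])
  finally have Wsets: "W \<in> sets lebesgue" .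
  have We: "emeasure lebesgue W = ennreal \<bar>u n\<bar> ^ DIM(real) * emeasure lebesgue (V n)"
    "measure lebesgue W = \<bar>u n\<bar> ^ DIM(real) * measure lebesgue (V n)"
    unfolding W_def using emeasure_lebesgue_affine[of "u n" 0 "V n"] measure_lebesgue_affine[of "u n" 0 "V n"]
    by simp_all
  have W: "W \<in> lmeasurable" "measure lebesgue W = u n * measure lebesgue (V n)"
  proof -
    have "emeasure lebesgue W < \<infinity>"
      unfolding We(1) using n(3) by (simp add: fmeasurable_def ennreal_mult_less_top del: emeasure_completion)
    with Wsets show "W \<in> lmeasurable"
      by (rule fmeasurableI)
    show "measure lebesgue W = u n * measure lebesgue (V n)"
      using We(2) xu(2)[of n] by simp
  qed
  have "U n \<inter> W \<noteq> {}"
  proof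
    assume disj: "U n \<inter> W = {}"
    have "measure lebesgue (U n) + measure lebesgue W = measure lebesgue (U n \<union> W)"
      using n W disj by (simp add: measure_Un3)
    also have "\<dots> \<le> measure lebesgue {1..9 * u n}"
    proof (rule measure_mono_fmeasurable)
      show "U n \<union> W \<subseteq> {1..9 * u n}"
      proof
        fix w assume "w \<in> U n \<union> W"
        then consider "1 \<le> w" "w \<le> 9" | l where "w = u n * l" "1 \<le> l" "l \<le> 9"
          by (auto simp: U_def V_def W_def)
        then show "w \<in> {1..9 * u n}"
        proof cases
          case 2
          then show ?thesis
            using xu(2)[of n] mult_mono[of 1 "u n" 1 l] mult_left_mono[of l 9 "u n"] by simp
        qed (use xu(2)[of n] in simp)
      qed
    qed (use n W in auto)
    also have "\<dots> = 9 * u n - 1"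
      using xu(2)[of n] by simp
    \<comment> \<open>This would force \<open>u n > 4\<close>, whereas \<open>u n \<le> 2\<close>;
      the interval from 1 to 9 is long enough to leave this room.\<close>
    finally have "7 + u n * 7 < 9 * u n - 1"
      using W(2) n(2) mult_strict_left_mono[OF n(4) xpos'[of n]] by linarith
    with xu(3)[of n] show False
      by simp
  qed
  then obtain w l where l: "w \<in> U n" "l \<in> V n" "w = u n * l"
    by (auto simp: W_def)
  have 1: "\<bar>k (x n) w\<bar> < e/2" "\<bar>k (u n * x n) l\<bar> < e/2"
    using l by (auto simp: U_def V_def)
  \<comment> \<open>With \<open>w = u n * l\<close> both terms contain the same value
    \<open>g (w * x n)\<close>, which cancels and leaves exactly the quantity assumed to exceed
    \<open>e\<close>.\<close>
  have "k (x n) w - k (u n * x n) l = ln (g (u n * x n)) - ln (g (x n)) - \<rho> * ln (u n)"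
    using l xu(2)[of n] by (simp add: k_def ln_mult V_def mult_ac algebra_simps)
  with 1 bad[of n] show False
    by linarith
qed

text \<open>Getting from \<open>x\<close> to \<open>y\<close> takes about log_2 (y / x) doublings,
  each covered by the uniform estimate at a cost \<open>d\<close>. The bound for
  \<open>y < x\<close> follows by exchanging the two points, which only changes signs.\<close>

lemma regularly_varying_Potter:
  assumes g: "regularly_varying g \<rho>" and e: "0 < e"
  obtains X where "1 \<le> X"
    "\<And>x y. X \<le> x \<Longrightarrow> X \<le> y \<Longrightarrow>
       \<bar>ln (g y) - ln (g x) - \<rho> * ln (y / x)\<bar> \<le> e * (1 + \<bar>ln (y / x)\<bar>)"
proof -
  have ln2: "0 < ln (2::real)" "ln (2::real) \<le> 1" using ln_2_less_1 by auto
  \<comment> \<open>The factor turns \<open>d * log 2 (y / x)\<close> into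
    \<open>e * ln (y / x)\<close>; since ln 2 is at most 1, the constant term stays below
    \<open>e\<close>.\<close>
  define d where "d = e * ln 2"
  have d: "0 < d" "d \<le> e" using e ln2 mult_left_mono[of "ln 2" 1 e] by (auto simp: d_def)
  from regularly_varying_uniform[OF g d(1)] obtain X where X: "1 \<le> X"
    "\<And>x l. X \<le> x \<Longrightarrow> 1 \<le> l \<Longrightarrow> l \<le> 2 \<Longrightarrow> \<bar>ln (g (l * x)) - ln (g x) - \<rho> * ln l\<bar> \<le> d"
    by blast
  have it: "\<bar>ln (g y) - ln (g x) - \<rho> * ln (y / x)\<bar> \<le> d * (1 + real n)"
    if "X \<le> x" "x \<le> y" "y \<le> 2 ^ (n + 1) * x" for x y n
    using that
  proof (induction n arbitrary: x)
    case 0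
    then show ?case
      using X(2)[of x "y / x"] X(1) by (simp add: field_simps)
  next
    case (Suc n)
    have x: "0 < x" using Suc.prems X(1) by simp
    show ?case
    proof (cases "y \<le> 2 * x")
      case True
      then have "\<bar>ln (g y) - ln (g x) - \<rho> * ln (y / x)\<bar> \<le> d"
        using X(2)[of x "y / x"] x Suc.prems by (simp add: field_simps)
      also have "\<dots> \<le> d * (1 + real (Suc n))"
        using d by (simp add: algebra_simps)
      finally show ?thesis .
    next
      case False
      have "\<bar>ln (g y) - ln (g (2 * x)) - \<rho> * ln (y / (2 * x))\<bar> \<le> d * (1 + real n)"
        using False Suc.prems x by (intro Suc.IH) auto
      moreover have "\<bar>ln (g (2 * x)) - ln (g x) - \<rho> * ln 2\<bar> \<le> d"
        using X(2)[of x 2] Suc.prems by simp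
      moreover have "ln (y / (2 * x)) = ln (y / x) - ln 2"
        using False x by (simp add: ln_div ln_mult)
      moreover have "\<rho> * ln (y / (2 * x)) = \<rho> * ln (y / x) - \<rho> * ln 2"
        using calculation(3) by (simp add: right_diff_distrib)
      moreover have "d * (1 + real (Suc n)) = d * (1 + real n) + d"
        by (simp add: algebra_simps)
      ultimately show ?thesis
        by linarith
    qed
  qed
  have up: "\<bar>ln (g y) - ln (g x) - \<rho> * ln (y / x)\<bar> \<le> e * (1 + \<bar>ln (y / x)\<bar>)"
    if xy: "X \<le> x" "x \<le> y" for x y
  proof -
    have x: "0 < x" using xy X(1) by simp
    define n where "n = nat \<lfloor>log 2 (y / x)\<rfloor>"
    have ge: "0 \<le> log 2 (y / x)" using xy x by simp
    have le: "real n \<le> log 2 (y / x)" "log 2 (y / x) \<le> real (n + 1)"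
      using ge unfolding n_def by linarith+
    have "y / x = 2 powr log 2 (y / x)"
      using xy x by simp
    also have "\<dots> \<le> 2 powr real (n + 1)"
      using le by (intro powr_mono) auto
    also have "\<dots> = 2 ^ (n + 1)"
      by (subst powr_realpow) auto
    finally have "y \<le> 2 ^ (n + 1) * x"
      using x by (simp add: field_simps)
    from it[OF xy this] have "\<bar>ln (g y) - ln (g x) - \<rho> * ln (y / x)\<bar> \<le> d + d * real n"
      by (simp add: algebra_simps)
    also have "\<dots> \<le> e + d * log 2 (y / x)"
      using d le by (intro add_mono mult_left_mono) auto
    also have "d * log 2 (y / x) = e * ln (y / x)"
      using ln2 by (simp add: d_def log_def)
    finally show ?thesis
      using ge x xy by (simp add: algebra_simps)
  qed
  show ?thesis
  proof (rule that[OF X(1)])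
    fix x y assume xy: "X \<le> x" "X \<le> y"
    show "\<bar>ln (g y) - ln (g x) - \<rho> * ln (y / x)\<bar> \<le> e * (1 + \<bar>ln (y / x)\<bar>)"
    proof (cases "x \<le> y")
      case True
      with xy up show ?thesis by blast
    next
      case False
      have "ln (x / y) = - ln (y / x)"
        using xy X(1) by (simp add: ln_div)
      with up[of y x] xy False show ?thesis
        by (simp add: algebra_simps abs_le_iff)
    qed
  qed
qed

text \<open>Potter's bound with one point fixed at \<open>X\<close>. All later growth statements
  about \<open>g\<close> are drawn from this logarithmic form.\<close>

lemma regularly_varying_ln_over_ln:
  assumes g: "regularly_varying g \<rho>"
  shows "((\<lambda>x. ln (g x) / ln x) \<longlongrightarrow> \<rho>) at_top"
proof (rule tendstoI)
  fix e :: real assume e: "0 < e"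
  then have "0 < e / 2" by simp
  from regularly_varying_Potter[OF g this] obtain X where X: "1 \<le> X"
    "\<And>x y. X \<le> x \<Longrightarrow> X \<le> y \<Longrightarrow>
       \<bar>ln (g y) - ln (g x) - \<rho> * ln (y / x)\<bar> \<le> e / 2 * (1 + \<bar>ln (y / x)\<bar>)"
    by metis
  define C where "C = \<bar>ln (g X) - \<rho> * ln X\<bar> + e / 2 + 1"
  have "((\<lambda>x::real. C / ln x) \<longlongrightarrow> 0) at_top"
    by (rule real_tendsto_divide_at_top[OF tendsto_const ln_at_top])
  then have "eventually (\<lambda>x. C / ln x < e / 2) at_top"
    by (rule order_tendstoD) (use e in simp)
  with eventually_gt_at_top[of X] show "eventually (\<lambda>x. dist (ln (g x) / ln x) \<rho> < e) at_top"
  proof eventually_elim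
    case (elim x)
    have lnx: "0 < ln x" "ln X \<ge> 0" "ln X \<le> ln x" using elim X(1) by auto
    have "ln (x / X) = ln x - ln X" using elim X(1) by (simp add: ln_div)
    with X(2)[of X x] elim(1) lnx have
      "\<bar>ln (g x) - ln (g X) - \<rho> * (ln x - ln X)\<bar> \<le> e / 2 * (1 + (ln x - ln X))"
      by simp
    also have "\<dots> \<le> e / 2 * (1 + ln x)"
      using e lnx by (intro mult_left_mono) auto
    finally have "\<bar>ln (g x) - ln (g X) - (\<rho> * ln x - \<rho> * ln X)\<bar> \<le> e / 2 + e / 2 * ln x"
      unfolding right_diff_distrib distrib_left by simp
    then have "\<bar>ln (g x) - \<rho> * ln x\<bar> < C + e / 2 * ln x"
      unfolding C_def by linarith
    also have "C < e / 2 * ln x"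
      using elim(2) lnx by (simp add: field_simps)
    finally have "\<bar>ln (g x) - \<rho> * ln x\<bar> < e * ln x" by simp
    moreover have "ln (g x) / ln x - \<rho> = (ln (g x) - \<rho> * ln x) / ln x"
      using lnx by (simp add: field_simps)
    ultimately show ?case
      using lnx by (simp add: dist_real_def abs_divide pos_divide_less_eq)
  qed
qed

section \<open>Replacing the rescaled \<open>Phi g q\<close> by a pure power\<close>

text \<open>\<open>exp E\<close> will be the ratio of the rescaled \<open>Phi\<close> to
  \<open>x powr p\<close>. Because \<open>h \<le> 1/2\<close>, both \<open>exp \<bar>E\<bar>\<close>
  and \<open>1 + \<bar>ln x\<bar>\<close> are at most 2 exp(|ln x| / 2). Their product is four times
  the larger of x and 1/x; the factor 1/x near 0 is harmless since \<open>p \<ge> 1\<close>.\<close>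

lemma abs_exp_minus_one_powr_bound:
  fixes x p E h :: real
  assumes x: "0 < x" and p: "1 \<le> p" and h: "h \<le> 1/2" and E: "\<bar>E\<bar> \<le> h * (1 + \<bar>ln x\<bar>)"
  shows "\<bar>exp E - 1\<bar> * x powr p \<le> 4 * h * (1 + x powr (p + 1))"
proof -
  have h0: "0 \<le> h"
    using order_trans[OF abs_ge_zero E] by (auto simp: zero_le_mult_iff)
  have 1: "\<bar>exp E - 1\<bar> \<le> \<bar>E\<bar> * exp \<bar>E\<bar>"
  proof (cases "E \<ge> 0")
    case True
    have "exp E * (1 - E) \<le> exp E * exp (- E)"
      using exp_ge_add_one_self[of "-E"] by (intro mult_left_mono) auto
    then show ?thesis
      using True by (simp add: exp_minus algebra_simps)
  next
    case False
    have "1 - exp E \<le> - E" using exp_ge_add_one_self[of E] by linarith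
    also have "- E * 1 \<le> - E * exp (- E)" using False by (intro mult_left_mono) auto
    finally show ?thesis using False by simp
  qed
  have 2: "exp \<bar>E\<bar> \<le> 2 * exp (\<bar>ln x\<bar> / 2)"
  proof -
    have "\<bar>E\<bar> \<le> 1/2 * (1 + \<bar>ln x\<bar>)"
      using E mult_right_mono[OF h, of "1 + \<bar>ln x\<bar>"] by linarith
    then have "exp \<bar>E\<bar> \<le> exp (1/2 + \<bar>ln x\<bar> / 2)" by simp
    also have "\<dots> = exp (1/2) * exp (\<bar>ln x\<bar> / 2)" by (simp add: exp_add)
    also have "exp (1/2 :: real) \<le> 2"
      using exp_bound_half[of "1/2::real"] by simp
    finally show ?thesis by simp
  qed
  have 3: "1 + \<bar>ln x\<bar> \<le> 2 * exp (\<bar>ln x\<bar> / 2)"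
    using exp_ge_add_one_self[of "\<bar>ln x\<bar> / 2"] by linarith
  have "\<bar>exp E - 1\<bar> \<le> h * (2 * exp (\<bar>ln x\<bar> / 2)) * (2 * exp (\<bar>ln x\<bar> / 2))"
  proof (rule order_trans[OF 1], rule mult_mono[OF _ 2])
    show "\<bar>E\<bar> \<le> h * (2 * exp (\<bar>ln x\<bar> / 2))"
      using E mult_left_mono[OF 3 h0] by linarith
  qed (use h0 in auto)
  also have "\<dots> = 4 * h * exp \<bar>ln x\<bar>"
    by (simp flip: exp_add)
  finally have 4: "\<bar>exp E - 1\<bar> * x powr p \<le> 4 * h * (exp \<bar>ln x\<bar> * x powr p)"
    by (metis mult.assoc mult_right_mono powr_ge_zero)
  have "exp \<bar>ln x\<bar> * x powr p \<le> 1 + x powr (p + 1)"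
  proof (cases "x \<ge> 1")
    case True
    then show ?thesis using x by (simp add: powr_add)
  next
    case False
    then have "\<bar>ln x\<bar> = - ln x" using x by simp
    then have "exp \<bar>ln x\<bar> * x powr p = x powr (p - 1)"
      using x by (simp add: powr_diff exp_minus field_simps)
    also have "\<dots> \<le> 1"
      using False x p by (intro powr_le1) auto
    finally show ?thesis by (smt (verit) powr_ge_zero)
  qed
  then show ?thesis
    using 4 h0 mult_left_mono[of "exp \<bar>ln x\<bar> * x powr p" "1 + x powr (p + 1)" "4 * h"] by linarith
qed

text \<open>Near 1 the logarithm is comparable with the deviation. If \<open>y / N < 1/2\<close> it
  is not, but then \<open>2 * a\<close> exceeds 1 and \<open>y \<ge> 1\<close> limits the logarithm
  to \<open>ln N\<close>; this case causes the factor \<open>1 + ln N\<close>.\<close>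

lemma abs_ln_ratio_bound:
  fixes y N a :: real
  assumes y: "1 \<le> y" and N: "1 \<le> N" and a: "\<bar>y / N - 1\<bar> \<le> a"
  shows "\<bar>ln (y / N)\<bar> \<le> 2 * a * (1 + ln N)"
proof -
  have lnN: "0 \<le> ln N" using N by simp
  have a0: "0 \<le> a" using a by linarith
  have pos: "0 < y / N" using y N by simp
  consider "y / N \<ge> 1" | "1/2 \<le> y / N" "y / N < 1" | "y / N < 1/2" by linarith
  then show ?thesis
  proof cases
    case 1
    have "\<bar>ln (y / N)\<bar> \<le> y / N - 1" using 1 ln_le_minus_one[OF pos] by simp
    also have "\<dots> \<le> 2 * a" using a a0 by linarith
    finally show ?thesis using mult_left_mono[of 1 "1 + ln N" "2 * a"] a0 lnN by linarith
  next
    case 2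
    have "ln (inverse (y / N)) \<le> inverse (y / N) - 1"
      using pos by (intro ln_le_minus_one positive_imp_inverse_positive)
    moreover have "ln (y / N) < 0"
      using 2 pos by simp
    ultimately have "\<bar>ln (y / N)\<bar> \<le> inverse (y / N) - 1"
      unfolding ln_inverse by linarith
    also have "\<dots> = (1 - y / N) / (y / N)" using y N by (simp add: field_simps)
    also have "\<dots> \<le> a / (1/2)" using 2 a a0 by - (rule frac_le; linarith)
    finally have "\<bar>ln (y / N)\<bar> \<le> 2 * a" by simp
    then show ?thesis using mult_left_mono[of 1 "1 + ln N" "2 * a"] a0 lnN by linarith
  next
    case 3
    have "ln (y / N) < 0" using 3 by (intro ln_less_zero[OF pos]) linarith
    then have "\<bar>ln (y / N)\<bar> = ln N - ln y" using y N by (simp add: ln_div)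
    also have "\<dots> \<le> 1 * (1 + ln N)" using ln_ge_zero[OF y] by simp
    also have "\<dots> \<le> 2 * a * (1 + ln N)"
      using 3 a lnN by (intro mult_right_mono) linarith+
    finally show ?thesis .
  qed
qed

text \<open>Since ln g(n) is of order at most ln n, the expression is of order (ln n)^2 / n. It is
  the coefficient that will control ln(y / n), where y is the argument of \<open>g\<close> inside
  \<open>Phi\<close>.\<close>

lemma regularly_varying_ln_small:
  assumes g: "regularly_varying g \<rho>" and r: "r \<longlonglongrightarrow> 0"
  shows "(\<lambda>n. (\<bar>ln (g (real n))\<bar> / 2 + \<bar>r n\<bar> + 1) / real n * (1 + ln (real n))) \<longlonglongrightarrow> 0"
proof -
  have lnn: "(\<lambda>n. ln (real n) / real n) \<longlonglongrightarrow> 0"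
    using lim_ln_over_n .
  have "(\<lambda>n. (ln (real n) / real n powr (1/2)) ^ 2) \<longlonglongrightarrow> 0 ^ 2"
    by (intro tendsto_power lim_ln_over_power) simp
  then have "(\<lambda>n. (ln (real n) / real n powr (1/2)) ^ 2) \<longlonglongrightarrow> 0"
    by (simp only: power_zero_numeral)
  moreover have "eventually (\<lambda>n. (ln (real n) / real n powr (1/2)) ^ 2 = ln (real n) * (ln (real n) / real n)) sequentially"
    using eventually_gt_at_top[of 0]
    by eventually_elim (simp add: power_divide power2_eq_square flip: powr_add)
  ultimately have lnn2: "(\<lambda>n. ln (real n) * (ln (real n) / real n)) \<longlonglongrightarrow> 0"
    by (rule Lim_transform_eventually)
  have G: "(\<lambda>n. ln (g (real n)) / ln (real n)) \<longlonglongrightarrow> \<rho>"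
    by (rule filterlim_compose[OF regularly_varying_ln_over_ln[OF g] filterlim_real_sequentially])
  have "(\<lambda>n. \<bar>ln (g (real n)) / ln (real n)\<bar> / 2 * (ln (real n) / real n + ln (real n) * (ln (real n) / real n))
      + (\<bar>r n\<bar> + 1) * (1 / real n + ln (real n) / real n)) \<longlonglongrightarrow> \<bar>\<rho>\<bar> / 2 * (0 + 0) + (\<bar>0\<bar> + 1) * (0 + 0)"
    by (intro tendsto_intros G lnn lnn2 r lim_1_over_n) simp
  moreover have "eventually (\<lambda>n. \<bar>ln (g (real n)) / ln (real n)\<bar> / 2 * (ln (real n) / real n + ln (real n) * (ln (real n) / real n))
      + (\<bar>r n\<bar> + 1) * (1 / real n + ln (real n) / real n)
      = (\<bar>ln (g (real n))\<bar> / 2 + \<bar>r n\<bar> + 1) / real n * (1 + ln (real n))) sequentially"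
    using eventually_gt_at_top[of 1]
    by eventually_elim (simp add: field_simps abs_divide)
  ultimately show ?thesis
    using Lim_transform_eventually by fastforce
qed

text \<open>In logarithms, 2^n Phi(2^-n s_n x) and x^p differ by a multiple of ln g(n) - ln g(y) and
  a vanishing term. Potter's bound turns this into an error linear in |ln x| with a small factor,
  uniformly in x as long as the increment is at most \<open>d\<close>.\<close>

lemma Phi_rescaled_approx:
  fixes s :: "nat \<Rightarrow> real" and g :: "real \<Rightarrow> real" and q p \<rho> e :: real
  assumes g: "regularly_varying g \<rho>" and q: "0 \<le> q" "q < 1" and p: "p = 1 / (1 - q)"
    and s: "eventually (\<lambda>n. 0 < s n) sequentially"
    and lim: "(\<lambda>n. (s n)\<^sup>2 / (2 powr (2 * q * real n) * g (real n))) \<longlonglongrightarrow> 1"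
    and e: "0 < e"
  obtains d where "0 < d"
    "eventually (\<lambda>n. \<forall>x\<ge>0. s n * x / 2 ^ n \<le> d \<longrightarrow>
       \<bar>2 ^ n * Phi g q (s n * x / 2 ^ n) - x powr p\<bar> \<le> e * (1 + x powr (p + 1))) sequentially"
proof -
  have p1: "1 \<le> p" using q by (simp add: p)
  have pq: "p * (1 - q) = 1" using q by (simp add: p)
  define h where "h = min (1/2) (e / 4)"
  have h: "0 < h" "h \<le> 1/2" "4 * h \<le> e" using e by (auto simp: h_def)
  define e' where "e' = h / p"
  have e': "0 < e'" "p * e' = h" using h p1 by (auto simp: e'_def)
  from regularly_varying_Potter[OF g e'(1)] obtain X where X: "1 \<le> X"
    "\<And>x y. X \<le> x \<Longrightarrow> X \<le> y \<Longrightarrow>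
       \<bar>ln (g y) - ln (g x) - \<rho> * ln (y / x)\<bar> \<le> e' * (1 + \<bar>ln (y / x)\<bar>)"
    by metis
  \<comment> \<open>An increment is at most \<open>d\<close> exactly when its image -p log_2 is at
    least \<open>X\<close>, the range in which Potter's bound applies.\<close>
  define d where "d = 2 powr (- X / p)"
  define L where "L = ln (2::real)"
  have L: "0 < L" by (simp add: L_def)
  \<comment> \<open>The error in the hypothesis on the logarithmic scale, halved because the
    hypothesis concerns the square of \<open>s n\<close>.\<close>
  define r where "r n = ln ((s n)\<^sup>2 / (2 powr (2 * q * real n) * g (real n))) / 2" for n
  have "r \<longlonglongrightarrow> ln 1 / 2"
    unfolding r_def by (intro tendsto_intros lim) simp_all
  then have r: "r \<longlonglongrightarrow> 0" by simp
  \<comment> \<open>Chosen such that |ln(y / n)| will be at most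
    \<open>b n * (1 + \<bar>ln x\<bar>)\<close>; the leading 2 is the constant of
    \<open>abs_ln_ratio_bound\<close>.\<close>
  define b where "b n = 2 * (p / L * ((\<bar>ln (g (real n))\<bar> / 2 + \<bar>r n\<bar> + 1) / real n * (1 + ln (real n))))" for n
  have b: "b \<longlonglongrightarrow> 0"
    unfolding b_def
    by (intro tendsto_mult_right_zero regularly_varying_ln_small[OF g r])
  have "(\<lambda>n. p * \<bar>r n\<bar> + p / 2 * (\<bar>\<rho>\<bar> + e') * b n) \<longlonglongrightarrow> p * \<bar>0\<bar> + p / 2 * (\<bar>\<rho>\<bar> + e') * 0"
    by (intro tendsto_intros r b)
  then have "eventually (\<lambda>n. p * \<bar>r n\<bar> + p / 2 * (\<bar>\<rho>\<bar> + e') * b n < h / 2) sequentially"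
    by (rule order_tendstoD) (use h in simp)
  moreover have "eventually (\<lambda>n. X \<le> real n) sequentially"
    using filterlim_real_sequentially by (simp add: filterlim_at_top)
  ultimately have "eventually (\<lambda>n. \<forall>x\<ge>0. s n * x / 2 ^ n \<le> d \<longrightarrow>
       \<bar>2 ^ n * Phi g q (s n * x / 2 ^ n) - x powr p\<bar> \<le> e * (1 + x powr (p + 1))) sequentially"
    using s
  proof eventually_elim
    case (elim n)
    have n1: "1 \<le> real n" using elim X by linarith
    have gn: "0 < g (real n)" using regularly_varying_pos[OF g] by simp
    show ?case
    proof (intro allI impI)
      fix x :: real assume x0: "0 \<le> x" and xd: "s n * x / 2 ^ n \<le> d"
      show "\<bar>2 ^ n * Phi g q (s n * x / 2 ^ n) - x powr p\<bar> \<le> e * (1 + x powr (p + 1))"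
      proof (cases "x = 0")
        case True
        then show ?thesis using e by (simp add: Phi_def)
      next
        case False
        with x0 have x: "0 < x" by simp
        define i where "i = s n * x / 2 ^ n"
        have i: "0 < i" "i \<le> d" using x elim(3) xd by (auto simp: i_def)
        have ln_s: "ln (s n) = q * real n * L + ln (g (real n)) / 2 + r n"
          using elim(3) gn by (simp add: r_def ln_div ln_mult ln_realpow ln_powr L_def field_simps)
        have ln_i: "ln i = ln (s n) + ln x - real n * L"
          using x elim(3) by (simp add: i_def ln_div ln_mult ln_realpow L_def)
        define y where "y = - log 2 i / (1 - q)"
        have y_eq: "y = - p * ln i / L"
          by (simp add: y_def log_def L_def p field_simps)
        have "log 2 i \<le> log 2 d" using i by (intro log_mono) auto
        also have "log 2 d = - X / p" by (simp add: d_def)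
        finally have "X \<le> - p * log 2 i" using p1 by (simp add: field_simps)
        also have "\<dots> = y" by (simp add: y_def p)
        finally have yX: "X \<le> y" .
        have y1: "1 \<le> y" using X yX by linarith
        have gy: "0 < g y" using regularly_varying_pos[OF g, of y] y1 by simp
        have "y * L = - p * ln i" using L by (simp add: y_eq)
        also have "\<dots> = (p * (1 - q)) * (real n * L) - p * (ln (g (real n)) / 2 + r n + ln x)"
          by (simp add: ln_i ln_s algebra_simps)
        \<comment> \<open>The choice of \<open>p\<close> makes n the exact main term of
          \<open>y\<close>, leaving only logarithmic terms in \<open>y - real n\<close>.\<close>
        also have "(p * (1 - q)) * (real n * L) = real n * L"
          unfolding pq by simp
        finally have yL: "(y - real n) * L = - p * (ln (g (real n)) / 2 + r n + ln x)"
          by (simp add: algebra_simps)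
        have "y / real n - 1 = (y - real n) * L / (L * real n)"
          using n1 L by (simp add: field_simps)
        then have "\<bar>y / real n - 1\<bar> = \<bar>(y - real n) * L\<bar> / (L * real n)"
          using n1 L by (simp only: abs_divide) simp
        also have "\<dots> = p * \<bar>ln (g (real n)) / 2 + r n + ln x\<bar> / (L * real n)"
          unfolding yL using p1 by (simp add: abs_mult)
        also have "\<dots> \<le> p * ((\<bar>ln (g (real n))\<bar> / 2 + \<bar>r n\<bar> + 1) * (1 + \<bar>ln x\<bar>)) / (L * real n)"
        proof (intro divide_right_mono mult_left_mono)
          have "\<bar>ln (g (real n)) / 2 + r n + ln x\<bar> \<le> (\<bar>ln (g (real n))\<bar> / 2 + \<bar>r n\<bar>) * 1 + \<bar>ln x\<bar>"
            using abs_triangle_ineq[of "ln (g (real n)) / 2 + r n" "ln x"] abs_triangle_ineq[of "ln (g (real n)) / 2" "r n"]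
            by (simp add: abs_divide)
          also have "\<dots> \<le> (\<bar>ln (g (real n))\<bar> / 2 + \<bar>r n\<bar>) * (1 + \<bar>ln x\<bar>) + (1 + \<bar>ln x\<bar>)"
            by (intro add_mono mult_left_mono) auto
          finally show "\<bar>ln (g (real n)) / 2 + r n + ln x\<bar> \<le> (\<bar>ln (g (real n))\<bar> / 2 + \<bar>r n\<bar> + 1) * (1 + \<bar>ln x\<bar>)"
            by (simp add: algebra_simps)
        qed (use p1 L n1 in auto)
        finally have "\<bar>ln (y / real n)\<bar>
            \<le> 2 * (p * ((\<bar>ln (g (real n))\<bar> / 2 + \<bar>r n\<bar> + 1) * (1 + \<bar>ln x\<bar>)) / (L * real n)) * (1 + ln (real n))"
          by (rule abs_ln_ratio_bound[OF y1 n1])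
        also have "\<dots> = b n * (1 + \<bar>ln x\<bar>)"
          by (simp add: b_def mult_ac)
        finally have lny: "\<bar>ln (y / real n)\<bar> \<le> b n * (1 + \<bar>ln x\<bar>)" .
        have "\<bar>ln (g y) - ln (g (real n))\<bar> \<le> \<bar>\<rho>\<bar> * \<bar>ln (y / real n)\<bar> + e' * (1 + \<bar>ln (y / real n)\<bar>)"
          using X(2)[OF elim(2) yX] by (simp add: abs_mult[symmetric])
        also have "\<dots> = (\<bar>\<rho>\<bar> + e') * \<bar>ln (y / real n)\<bar> + e'"
          by (simp add: algebra_simps)
        also have "\<dots> \<le> (\<bar>\<rho>\<bar> + e') * (b n * (1 + \<bar>ln x\<bar>)) + e'"
          using e' lny by (intro add_right_mono mult_left_mono) auto
        finally have dg: "\<bar>ln (g y) - ln (g (real n))\<bar> \<le> (\<bar>\<rho>\<bar> + e') * (b n * (1 + \<bar>ln x\<bar>)) + e'" .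
        \<comment> \<open>The logarithm of the ratio of \<open>2 ^ n * Phi g q i\<close> to
          \<open>x powr p\<close>; the terms linear in n cancel because p (1 - q) = 1.\<close>
        define E where "E = p * r n + p / 2 * (ln (g (real n)) - ln (g y))"
        have "\<bar>E\<bar> \<le> p * \<bar>r n\<bar> + p / 2 * \<bar>ln (g y) - ln (g (real n))\<bar>"
          unfolding E_def using p1 by (intro order_trans[OF abs_triangle_ineq]) (simp add: abs_mult abs_minus_commute)
        also have "\<dots> \<le> p * \<bar>r n\<bar> * (1 + \<bar>ln x\<bar>) + p / 2 * ((\<bar>\<rho>\<bar> + e') * (b n * (1 + \<bar>ln x\<bar>)) + e')"
        proof (intro add_mono mult_left_mono dg)
          show "p * \<bar>r n\<bar> \<le> p * \<bar>r n\<bar> * (1 + \<bar>ln x\<bar>)"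
            using p1 mult_left_mono[of 1 "1 + \<bar>ln x\<bar>" "p * \<bar>r n\<bar>"] by simp
        qed (use p1 in auto)
        also have "\<dots> = (p * \<bar>r n\<bar> + p / 2 * (\<bar>\<rho>\<bar> + e') * b n) * (1 + \<bar>ln x\<bar>) + h / 2"
          by (simp add: algebra_simps flip: e'(2))
        also have "\<dots> \<le> h / 2 * (1 + \<bar>ln x\<bar>) + h / 2 * (1 + \<bar>ln x\<bar>)"
          using elim(1) h by (intro add_mono mult_right_mono) auto
        finally have Eb: "\<bar>E\<bar> \<le> h * (1 + \<bar>ln x\<bar>)" by simp
        have "2 ^ n * Phi g q i = exp (real n * L + p * ln i - p / 2 * ln (g y))"
          using i gy by (simp add: Phi_def powr_def y_def p exp_add exp_diff L_def exp_of_nat_mult exp_minus field_simps)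
        also have "real n * L + p * ln i - p / 2 * ln (g y) = E + p * ln x + real n * L * (1 - p * (1 - q))"
          by (simp add: E_def ln_i ln_s algebra_simps)
        also have "exp \<dots> = exp E * x powr p"
          using x pq by (simp add: exp_add powr_def)
        finally have "2 ^ n * Phi g q i - x powr p = (exp E - 1) * x powr p"
          by (simp add: algebra_simps)
        then have "\<bar>2 ^ n * Phi g q i - x powr p\<bar> = \<bar>exp E - 1\<bar> * x powr p"
          by (simp add: abs_mult)
        also have "\<dots> \<le> 4 * h * (1 + x powr (p + 1))"
          by (rule abs_exp_minus_one_powr_bound[OF x p1 h(2) Eb])
        also have "\<dots> \<le> e * (1 + x powr (p + 1))"
          using h(3) by (intro mult_right_mono) auto
        finally show ?thesis by (simp add: i_def)
      qed
    qed
  qed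
  moreover have "0 < d" by (simp add: d_def)
  ultimately show ?thesis using that by blast
qed

section \<open>The tree of dyadic increments\<close>

lemma tent_map_left:
  assumes "of_int z \<le> x" "x \<le> of_int z + 1/2"
  shows "tent_map x = x - of_int z"
  unfolding tent_map_def
proof (rule cInf_eq_minimum)
  show "x - of_int z \<in> range (\<lambda>z::int. \<bar>of_int z - x\<bar>)"
    using assms by (intro image_eqI[of _ _ z]) auto
  fix y assume "y \<in> range (\<lambda>z::int. \<bar>of_int z - x\<bar>)"
  then obtain w :: int where w: "y = \<bar>of_int w - x\<bar>" by auto
  consider "w \<le> z" | "w \<ge> z + 1" by linarith
  then show "x - of_int z \<le> y"
  proof cases
    case 1
    then have "real_of_int w \<le> of_int z" by simp
    then show ?thesis using w by linarith
  next
    case 2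
    then have "real_of_int w \<ge> of_int z + 1" by linarith
    then show ?thesis using w assms by linarith
  qed
qed

lemma tent_map_right:
  assumes "of_int z + 1/2 \<le> x" "x \<le> of_int z + 1"
  shows "tent_map x = of_int z + 1 - x"
  unfolding tent_map_def
proof (rule cInf_eq_minimum)
  show "of_int z + 1 - x \<in> range (\<lambda>z::int. \<bar>of_int z - x\<bar>)"
    using assms by (intro image_eqI[of _ _ "z + 1"]) auto
  fix y assume "y \<in> range (\<lambda>z::int. \<bar>of_int z - x\<bar>)"
  then obtain w :: int where w: "y = \<bar>of_int w - x\<bar>" by auto
  consider "w \<le> z" | "w \<ge> z + 1" by linarith
  then show "of_int z + 1 - x \<le> y"
  proof cases
    case 1
    then have "real_of_int w \<le> of_int z" by simp
    then show ?thesis using w assms by linarith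
  next
    case 2
    then have "real_of_int w \<ge> of_int z + 1" by linarith
    then show ?thesis using w assms by linarith
  qed
qed

lemma tent_map_cases:
  obtains z :: int where "of_int z \<le> x" "x \<le> of_int z + 1/2" "tent_map x = x - of_int z"
  | z :: int where "of_int z + 1/2 \<le> x" "x \<le> of_int z + 1" "tent_map x = of_int z + 1 - x"
proof -
  have "of_int \<lfloor>x\<rfloor> \<le> x" "x \<le> of_int \<lfloor>x\<rfloor> + 1" by linarith+
  then consider "x \<le> of_int \<lfloor>x\<rfloor> + 1/2" | "of_int \<lfloor>x\<rfloor> + 1/2 \<le> x"
    by linarith
  then show thesis
  proof cases
    case 1
    then show ?thesis
      using that(1)[of "\<lfloor>x\<rfloor>"] tent_map_left[of "\<lfloor>x\<rfloor>" x] by simp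
  next
    case 2
    then show ?thesis
      using that(2)[of "\<lfloor>x\<rfloor>"] tent_map_right[of "\<lfloor>x\<rfloor>" x] \<open>x \<le> of_int \<lfloor>x\<rfloor> + 1\<close> by simp
  qed
qed

lemma tent_map_nonneg: "0 \<le> tent_map x"
  by (rule tent_map_cases[of x]) auto

lemma tent_map_le_half: "tent_map x \<le> 1/2"
  by (rule tent_map_cases[of x]) auto

lemma tent_map_le: "tent_map x \<le> \<bar>of_int z - x\<bar>"
  unfolding tent_map_def by (rule cInf_lower) (auto intro!: bdd_belowI[of _ 0])

lemma tent_map_lipschitz: "\<bar>tent_map x - tent_map y\<bar> \<le> \<bar>x - y\<bar>"
proof -
  have *: "tent_map x \<le> tent_map y + \<bar>x - y\<bar>" for x y
  proof -
    obtain z :: int where "tent_map y = \<bar>of_int z - y\<bar>"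
      by (rule tent_map_cases[of y]) (metis abs_minus_commute abs_of_nonneg diff_ge_0_iff_ge, metis (no_types) abs_of_nonneg diff_ge_0_iff_ge of_int_1 of_int_add)
    then show ?thesis using tent_map_le[of x z] by linarith
  qed
  show ?thesis using *[of x y] *[of y x] by linarith
qed

lemma tent_map_of_nat [simp]: "tent_map (real k) = 0"
  using tent_map_left[of "int k" "real k"] by simp

lemma div_power2_bounds: "k div 2 ^ d * 2 ^ d \<le> k" "k + 1 \<le> (k div 2 ^ d + 1) * 2 ^ d" for k d :: nat
  using div_mult_mod_eq[of k "2 ^ d"] mod_less_divisor[of "2 ^ d" k] zero_less_power[of "2::nat" d]
  unfolding distrib_right by linarith+

text \<open>The tent map is affine between consecutive multiples of 1/2, and a dyadic interval of
  length at most 1/2 lies between two such multiples; the parity of \<open>i\<close> tells rising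
  from falling.\<close>

lemma tent_map_dyadic_midpoint:
  "tent_map (real (2 * k + 1) / 2 ^ (c + 2)) = (tent_map (real k / 2 ^ (c + 1)) + tent_map (real (k + 1) / 2 ^ (c + 1))) / 2"
proof -
  define i where "i = k div 2 ^ c"
  have k: "i * 2 ^ c \<le> k" "k + 1 \<le> (i + 1) * 2 ^ c"
    unfolding i_def by (rule div_power2_bounds)+
  then have kr: "real i * 2 ^ c \<le> real k" "real k + 1 \<le> (real i + 1) * 2 ^ c"
    by (simp_all add: of_nat_le_iff[where 'a=real, symmetric] algebra_simps del: of_nat_le_iff)
  define l m r where "l = real k / 2 ^ (c + 1)" "m = real (2 * k + 1) / 2 ^ (c + 2)" "r = real (k + 1) / 2 ^ (c + 1)"
  have m: "m = (l + r) / 2"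
    by (simp add: l_m_r_def field_simps)
  have lr: "real i / 2 \<le> l" "r \<le> (real i + 1) / 2"
    using kr by (simp_all add: l_m_r_def field_simps)
  have "l \<le> r" by (simp add: l_m_r_def field_simps)
  with m have lm: "l \<le> m" "m \<le> r" by (simp_all add: field_simps)
  have "tent_map m = (tent_map l + tent_map r) / 2"
  proof (cases "even i")
    case True
    then obtain z where z: "i = 2 * z" by (elim evenE)
    have "tent_map t = t - of_int (int z)" if "l \<le> t" "t \<le> r" for t
      using that lr z by (intro tent_map_left) auto
    from this[of l] this[of r] this[of m] lm \<open>l \<le> r\<close> show ?thesis by (simp add: m field_simps)
  next
    case False
    then obtain z where z: "i = 2 * z + 1" by (elim oddE)
    have "tent_map t = of_int (int z) + 1 - t" if "l \<le> t" "t \<le> r" for t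
      using that lr z by (intro tent_map_right) (auto simp: field_simps)
    from this[of l] this[of r] this[of m] lm \<open>l \<le> r\<close> show ?thesis by (simp add: m field_simps)
  qed
  then show ?thesis by (simp add: l_m_r_def)
qed

lemma sum_dyadic_double:
  fixes h :: "nat \<Rightarrow> 'a::comm_monoid_add"
  shows "sum h {2 * a..<2 * b} = (\<Sum>k\<in>{a..<b}. h (2 * k) + h (2 * k + 1))"
proof (induction b)
  case (Suc b)
  show ?case
  proof (cases "a \<le> b")
    case True
    then have "sum h {2 * a..<2 * Suc b} = sum h {2 * a..<2 * b} + (h (2 * b) + h (2 * b + 1))"
      by (simp add: sum.atLeastLessThan_Suc add.assoc)
    with Suc True show ?thesis by (simp add: sum.atLeastLessThan_Suc)
  qed simp
qed simp

section \<open>Dyadic blocks and trees of signed sums\<close>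

definition dyadic_block :: "nat \<Rightarrow> nat \<Rightarrow> nat set" where
  "dyadic_block j d = {j * 2 ^ d..<(j + 1) * 2 ^ d}"

lemma finite_dyadic_block [simp]: "finite (dyadic_block j d)"
  by (simp add: dyadic_block_def)

lemma card_dyadic_block [simp]: "card (dyadic_block j d) = 2 ^ d"
  by (simp add: dyadic_block_def)

lemma dyadic_block_zero [simp]: "dyadic_block 0 d = {..<2 ^ d}"
  by (auto simp: dyadic_block_def)

lemma dyadic_block_0 [simp]: "dyadic_block j 0 = {j}"
  by (auto simp: dyadic_block_def)

lemma sum_dyadic_block_Suc:
  "sum h (dyadic_block j (Suc d)) = (\<Sum>k\<in>dyadic_block j d. h (2 * k) + h (2 * k + 1))"
  using sum_dyadic_double[of h "j * 2 ^ d" "(j + 1) * 2 ^ d"]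
  by (simp add: dyadic_block_def mult.left_commute algebra_simps)

lemma dyadic_block_less:
  assumes "j < 2 ^ l" "k \<in> dyadic_block j d" shows "k < 2 ^ (l + d)"
proof -
  have "k < (j + 1) * 2 ^ d" using assms by (simp add: dyadic_block_def)
  also have "\<dots> \<le> 2 ^ l * 2 ^ d" using assms by (intro mult_right_mono) auto
  finally show ?thesis by (simp add: power_add)
qed

text \<open>The leaves at level \<open>n\<close> carry all \<open>2 ^ n\<close> signed sums of \<open>a 0, \<dots>, a (n - 1)\<close>.\<close>

definition signed_tree :: "(nat \<Rightarrow> real) \<Rightarrow> (nat \<Rightarrow> nat \<Rightarrow> real) \<Rightarrow> bool" where
  "signed_tree a S \<longleftrightarrow> S 0 0 = 0 \<and> (\<forall>n. \<forall>k<2 ^ n. \<exists>e\<in>{-1, 1}.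
     S (Suc n) (2 * k) = S n k + e * a n \<and> S (Suc n) (2 * k + 1) = S n k - e * a n)"

text \<open>The sign chosen at a node only decides which child receives \<open>+ a\<close> and which
  \<open>- a\<close>, so it drops out of a sum over both children.\<close>

lemma signed_tree_sum_Suc:
  fixes F :: "real \<Rightarrow> 'a::comm_monoid_add"
  assumes S: "signed_tree a S" and j: "j < 2 ^ l"
  shows "(\<Sum>k\<in>dyadic_block j (Suc d). F (S (l + Suc d) k)) =
    (\<Sum>k\<in>dyadic_block j d. F (S (l + d) k + a (l + d)) + F (S (l + d) k - a (l + d)))"
  unfolding sum_dyadic_block_Suc
proof (rule sum.cong[OF refl])
  fix k assume "k \<in> dyadic_block j d"
  from dyadic_block_less[OF j this] S obtain e where e: "e \<in> {-1, 1}"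
    "S (Suc (l + d)) (2 * k) = S (l + d) k + e * a (l + d)"
    "S (Suc (l + d)) (2 * k + 1) = S (l + d) k - e * a (l + d)"
    unfolding signed_tree_def by meson
  then show "F (S (l + Suc d) (2 * k)) + F (S (l + Suc d) (2 * k + 1)) =
      F (S (l + d) k + a (l + d)) + F (S (l + d) k - a (l + d))"
    by (auto simp: add.commute)
qed

lemma signed_tree_sum_lessThan_Suc:
  fixes F :: "real \<Rightarrow> 'a::comm_monoid_add"
  assumes S: "signed_tree a S"
  shows "(\<Sum>k<2 ^ Suc n. F (S (Suc n) k)) = (\<Sum>k<2 ^ n. F (S n k + a n) + F (S n k - a n))"
  using signed_tree_sum_Suc[OF S, of 0 0 F n] by simp

lemma dyadic_rational_le:
  "b * 2 ^ d \<le> a \<Longrightarrow> real b / 2 ^ m \<le> real a / 2 ^ (m + d)"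
  "a \<le> b * 2 ^ d \<Longrightarrow> real a / 2 ^ (m + d) \<le> real b / 2 ^ m"
  "a < b * 2 ^ d \<Longrightarrow> real a / 2 ^ (m + d) < real b / 2 ^ m"
proof -
  have eq: "real b / 2 ^ m = real (b * 2 ^ d) / 2 ^ (m + d)"
    by (simp add: power_add)
  have pos: "0 < (2::real) ^ (m + d)" by (rule zero_less_power) simp
  show "real b / 2 ^ m \<le> real a / 2 ^ (m + d)" if "b * 2 ^ d \<le> a"
    unfolding eq by (rule divide_right_mono[OF _ less_imp_le[OF pos]]) (simp only: of_nat_le_iff that)
  show "real a / 2 ^ (m + d) \<le> real b / 2 ^ m" if "a \<le> b * 2 ^ d"
    unfolding eq by (rule divide_right_mono[OF _ less_imp_le[OF pos]]) (simp only: of_nat_le_iff that)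
  show "real a / 2 ^ (m + d) < real b / 2 ^ m" if "a < b * 2 ^ d"
    unfolding eq by (rule divide_strict_right_mono[OF _ pos]) (simp only: of_nat_less_iff that)
qed

lemma signed_tree_bound:
  assumes S: "signed_tree a S" and k: "k < 2 ^ n"
  shows "\<bar>S n k\<bar> \<le> (\<Sum>m<n. \<bar>a m\<bar>)"
  using k
proof (induction n arbitrary: k)
  case 0
  then show ?case using S by (simp add: signed_tree_def)
next
  case (Suc n)
  have kn: "k div 2 < 2 ^ n" using Suc.prems by auto
  then obtain e where e: "e \<in> {-1, 1}"
    "S (Suc n) (2 * (k div 2)) = S n (k div 2) + e * a n"
    "S (Suc n) (2 * (k div 2) + 1) = S n (k div 2) - e * a n"
    using S unfolding signed_tree_def by meson
  have "k = 2 * (k div 2) \<or> k = 2 * (k div 2) + 1" by presburger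
  then have "\<bar>S (Suc n) k\<bar> \<le> \<bar>S n (k div 2)\<bar> + \<bar>a n\<bar>"
    using e by auto
  with Suc.IH[OF kn] show ?case by simp
qed

section \<open>Dyadic increments and total variation\<close>

definition dyadic_increment :: "(real \<Rightarrow> real) \<Rightarrow> nat \<Rightarrow> nat \<Rightarrow> real" where
  "dyadic_increment f n k = f (real (k + 1) / 2 ^ n) - f (real k / 2 ^ n)"

lemma increment_sum_telescope:
  "a \<le> b \<Longrightarrow> (\<Sum>k\<in>{a..<b}. dyadic_increment f n k) = f (real b / 2 ^ n) - f (real a / 2 ^ n)"
  using sum_Suc_diff'[of a b "\<lambda>k. f (real k / 2 ^ n)"] by (simp add: dyadic_increment_def)

lemma dyadic_increment_split:
  "dyadic_increment f n k = dyadic_increment f (Suc n) (2 * k) + dyadic_increment f (Suc n) (2 * k + 1)"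
proof -
  have "real (2 * k + 1 + 1) / 2 ^ Suc n = real (k + 1) / 2 ^ n" "real (2 * k) / 2 ^ Suc n = real k / 2 ^ n"
    by (simp_all add: field_simps)
  then show ?thesis by (simp only: dyadic_increment_def)
qed

lemma dyadic_V_mono:
  "dyadic_V 1 f n \<le> dyadic_V 1 f (Suc n)"
proof -
  have V: "dyadic_V 1 f n = (\<Sum>k<2 ^ n. \<bar>dyadic_increment f n k\<bar>)" for n
    by (simp add: dyadic_V_def dyadic_increment_def)
  have "dyadic_V 1 f n \<le> (\<Sum>k\<in>dyadic_block 0 n. \<bar>dyadic_increment f (Suc n) (2 * k)\<bar> + \<bar>dyadic_increment f (Suc n) (2 * k + 1)\<bar>)"
    unfolding V dyadic_block_zero dyadic_increment_split[of f n] by (intro sum_mono abs_triangle_ineq)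
  also have "\<dots> = dyadic_V 1 f (Suc n)"
    unfolding sum_dyadic_block_Suc[of "\<lambda>k. \<bar>dyadic_increment f (Suc n) k\<bar>", symmetric] by (simp add: V)
  finally show ?thesis .
qed

text \<open>Each partition increment telescopes over grid increments. The points may coincide, as
  happens when distinct points are rounded to the same grid point.\<close>

lemma partition_sum_le_dyadic_V:
  fixes c :: "nat \<Rightarrow> nat"
  assumes c: "\<And>i. i < N \<Longrightarrow> c i \<le> c (Suc i)" and N: "c N \<le> 2 ^ n"
  shows "(\<Sum>i<N. \<bar>f (real (c (Suc i)) / 2 ^ n) - f (real (c i) / 2 ^ n)\<bar>) \<le> dyadic_V 1 f n"
proof -
  have *: "M \<le> N \<Longrightarrow> c 0 \<le> c M \<and> (\<Sum>i<M. \<bar>f (real (c (Suc i)) / 2 ^ n) - f (real (c i) / 2 ^ n)\<bar>)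
     \<le> (\<Sum>k\<in>{c 0..<c M}. \<bar>dyadic_increment f n k\<bar>)" for M
  proof (induction M)
    case (Suc M)
    then have cM: "c M \<le> c (Suc M)" "c 0 \<le> c M" using c by auto
    have "\<bar>f (real (c (Suc M)) / 2 ^ n) - f (real (c M) / 2 ^ n)\<bar> = \<bar>\<Sum>k\<in>{c M..<c (Suc M)}. dyadic_increment f n k\<bar>"
      by (subst increment_sum_telescope[OF cM(1)]) simp
    also have "\<dots> \<le> (\<Sum>k\<in>{c M..<c (Suc M)}. \<bar>dyadic_increment f n k\<bar>)"
      by (rule sum_abs)
    finally show ?case
      using Suc cM sum.atLeastLessThan_concat[OF cM(2,1), of "\<lambda>k. \<bar>dyadic_increment f n k\<bar>"] by auto
  qed simp
  have "(\<Sum>k\<in>{c 0..<c N}. \<bar>dyadic_increment f n k\<bar>) \<le> (\<Sum>k<2 ^ n. \<bar>dyadic_increment f n k\<bar>)"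
    using N by (intro sum_mono2) auto
  also have "\<dots> = dyadic_V 1 f n"
    by (simp add: dyadic_V_def dyadic_increment_def)
  finally show ?thesis
    using *[of N] by linarith
qed

text \<open>An arbitrary partition is rounded down to the grid of level n. Rounding keeps the order,
  so the rounded sum is at most \<open>dyadic_V 1 f n\<close>, and \<open>cont\<close> carries it to
  the original sum as n grows.\<close>

lemma total_variation_eq_SUP_dyadic_V:
  assumes cont: "\<And>t. t \<in> {0..1} \<Longrightarrow> (\<lambda>n. f (real (nat \<lfloor>t * 2 ^ n\<rfloor>) / 2 ^ n)) \<longlonglongrightarrow> f t"
  shows "total_variation f 0 1 = (SUP n. ereal (dyadic_V 1 f n))"
proof (rule antisym)
  show "(SUP n. ereal (dyadic_V 1 f n)) \<le> total_variation f 0 1"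
    unfolding total_variation_def
  proof (rule SUP_least, rule Sup_upper)
    fix n
    show "ereal (dyadic_V 1 f n) \<in> {ereal (\<Sum>i<N. \<bar>f (x (Suc i)) - f (x i)\<bar>) |x N.
        x 0 = 0 \<and> x N = 1 \<and> (\<forall>i<N. x i < x (Suc i))}"
      by (rule CollectI, rule exI[of _ "\<lambda>i. real i / 2 ^ n"], rule exI[of _ "2 ^ n"])
         (auto simp: dyadic_V_def field_simps)
  qed
  show "total_variation f 0 1 \<le> (SUP n. ereal (dyadic_V 1 f n))"
    unfolding total_variation_def
  proof (rule Sup_least, clarify)
    fix x :: "nat \<Rightarrow> real" and N
    assume x: "x 0 = 0" "x N = 1" "\<forall>i<N. x i < x (Suc i)"
    have mono: "x i \<le> x j" if "i \<le> j" "j \<le> N" for i j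
      using that
    proof (induction j rule: dec_induct)
      case (step j)
      then show ?case using x(3) by (meson Suc_leD Suc_le_lessD less_eq_real_def order_trans)
    qed simp
    have x01: "x i \<in> {0..1}" if "i \<le> N" for i
      using mono[of 0 i] mono[of i N] that x by auto
    have "(\<lambda>n. ereal (\<Sum>i<N. \<bar>f (real (nat \<lfloor>x (Suc i) * 2 ^ n\<rfloor>) / 2 ^ n) - f (real (nat \<lfloor>x i * 2 ^ n\<rfloor>) / 2 ^ n)\<bar>))
        \<longlonglongrightarrow> ereal (\<Sum>i<N. \<bar>f (x (Suc i)) - f (x i)\<bar>)"
      by (intro tendsto_ereal tendsto_sum tendsto_rabs tendsto_diff cont x01) auto
    moreover have "ereal (\<Sum>i<N. \<bar>f (real (nat \<lfloor>x (Suc i) * 2 ^ n\<rfloor>) / 2 ^ n) - f (real (nat \<lfloor>x i * 2 ^ n\<rfloor>) / 2 ^ n)\<bar>)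
       \<le> (SUP n. ereal (dyadic_V 1 f n))" for n
    proof (rule SUP_upper2[of n])
      show "ereal (\<Sum>i<N. \<bar>f (real (nat \<lfloor>x (Suc i) * 2 ^ n\<rfloor>) / 2 ^ n) - f (real (nat \<lfloor>x i * 2 ^ n\<rfloor>) / 2 ^ n)\<bar>)
       \<le> ereal (dyadic_V 1 f n)"
        unfolding ereal_less_eq
      proof (rule partition_sum_le_dyadic_V)
        fix i assume "i < N"
        then have "x i \<le> x (Suc i)" using x by (simp add: less_imp_le)
        then show "nat \<lfloor>x i * 2 ^ n\<rfloor> \<le> nat \<lfloor>x (Suc i) * 2 ^ n\<rfloor>"
          by (intro nat_mono floor_mono mult_right_mono) auto
      next
        have "(2::real) ^ n = of_int (2 ^ n)" by simp
        then have "\<lfloor>(2::real) ^ n\<rfloor> = 2 ^ n" by (simp only: floor_of_int)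
        then show "nat \<lfloor>x N * 2 ^ n\<rfloor> \<le> 2 ^ n" using x by (simp add: nat_power_eq)
      qed
    qed simp
    ultimately show "ereal (\<Sum>i<N. \<bar>f (x (Suc i)) - f (x i)\<bar>) \<le> (SUP n. ereal (dyadic_V 1 f n))"
      by (intro LIMSEQ_le_const2) blast+
  qed
qed

section \<open>Increments of the signed tent series\<close>

locale signed_tent_series =
  fixes \<alpha> :: "nat \<Rightarrow> real" and \<sigma> :: "nat \<Rightarrow> real \<Rightarrow> real" and f :: "real \<Rightarrow> real"
  assumes summable_coeff: "summable (\<lambda>m. \<bar>\<alpha> m\<bar>)"
    and sign: "\<And>m t. t \<in> {0..1} \<Longrightarrow> \<sigma> m t \<in> {-1, 1}"
    and sign_const: "\<And>m k. k \<in> {1..2 ^ m} \<Longrightarrow> \<sigma> m constant_on {(real k - 1) / 2 ^ m ..< real k / 2 ^ m}"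
    and f_eq: "\<And>t. t \<in> {0..1} \<Longrightarrow> f t = (\<Sum>m. \<alpha> m * \<sigma> m t * tent_map (2 ^ m * t))"
begin

lemma sign_eq:
  assumes "m \<le> n" "k < 2 ^ n" "real k / 2 ^ n \<le> t" "t < real (k + 1) / 2 ^ n"
  shows "\<sigma> m t = \<sigma> m (real k / 2 ^ n)"
proof -
  define d where "d = n - m"
  have n: "n = m + d" using assms(1) by (simp add: d_def)
  define i where "i = k div 2 ^ d"
  have k: "i * 2 ^ d \<le> k" "k + 1 \<le> (i + 1) * 2 ^ d"
    unfolding i_def by (rule div_power2_bounds)+
  have "k < 2 ^ m * 2 ^ d"
    using assms(2) unfolding n power_add .
  then have "i < 2 ^ m"
    unfolding i_def by (rule less_mult_imp_div_less)
  then have "\<sigma> m constant_on {(real (i + 1) - 1) / 2 ^ m ..< real (i + 1) / 2 ^ m}"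
    by (intro sign_const) auto
  then obtain c where c: "\<forall>x\<in>{(real (i + 1) - 1) / 2 ^ m ..< real (i + 1) / 2 ^ m}. \<sigma> m x = c"
    unfolding constant_on_def by blast
  have "real i / 2 ^ m \<le> real k / 2 ^ n" "real (k + 1) / 2 ^ n \<le> real (i + 1) / 2 ^ m"
    using dyadic_rational_le(1)[OF k(1), of m] dyadic_rational_le(2)[OF k(2), of m] by (simp_all only: n)
  moreover have "real (i + 1) - 1 = real i" by simp
  ultimately have bounds: "(real (i + 1) - 1) / 2 ^ m \<le> real k / 2 ^ n" "real (k + 1) / 2 ^ n \<le> real (i + 1) / 2 ^ m"
    by (simp_all only:)
  have "\<sigma> m t = c"
    using order_trans[OF bounds(1) assms(3)] less_le_trans[OF assms(4) bounds(2)]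
    by (intro bspec[OF c]) (simp only: atLeastLessThan_iff simp_thms)
  moreover have "\<sigma> m (real k / 2 ^ n) = c"
    using bounds(1) less_le_trans[OF le_less_trans[OF assms(3,4)] bounds(2)]
    by (intro bspec[OF c]) (simp only: atLeastLessThan_iff simp_thms)
  ultimately show ?thesis by simp
qed

lemma tent_dyadic_zero:
  assumes "n \<le> m" shows "tent_map (2 ^ m * (real k / 2 ^ n)) = 0"
proof -
  obtain d where "m = n + d" using assms by (auto simp: le_iff_add)
  then have "2 ^ m * (real k / 2 ^ n) = real (2 ^ d * k)"
    by (simp add: power_add)
  then show ?thesis by (simp only: tent_map_of_nat)
qed

lemma f_dyadic:
  assumes "k \<le> 2 ^ n"
  shows "f (real k / 2 ^ n) = (\<Sum>m<n. \<alpha> m * \<sigma> m (real k / 2 ^ n) * tent_map (2 ^ m * (real k / 2 ^ n)))"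
proof -
  have "real k \<le> real (2 ^ n)" using assms by (simp only: of_nat_le_iff)
  then have t: "real k / 2 ^ n \<in> {0..1}" by simp
  show ?thesis
    unfolding f_eq[OF t]
  proof (rule suminf_finite)
    fix m assume "m \<notin> {..<n}"
    then have "tent_map (2 ^ m * (real k / 2 ^ n)) = 0" by (intro tent_dyadic_zero) simp
    then show "\<alpha> m * \<sigma> m (real k / 2 ^ n) * tent_map (2 ^ m * (real k / 2 ^ n)) = 0"
      by (simp only: mult_zero_right)
  qed simp
qed

lemma summable_terms:
  assumes "t \<in> {0..1}"
  shows "summable (\<lambda>m. \<alpha> m * \<sigma> m t * tent_map (2 ^ m * t))"
proof (rule summable_comparison_test[OF _ summable_coeff], intro exI allI impI)
  fix m
  have "\<bar>\<sigma> m t\<bar> = 1" using sign[OF assms, of m] by auto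
  then have "norm (\<alpha> m * \<sigma> m t * tent_map (2 ^ m * t)) = \<bar>\<alpha> m\<bar> * tent_map (2 ^ m * t)"
    using tent_map_nonneg[of "2 ^ m * t"] by (simp add: abs_mult)
  also have "\<dots> \<le> \<bar>\<alpha> m\<bar> * 1"
    using tent_map_le_half[of "2 ^ m * t"] by (intro mult_left_mono) auto
  finally show "norm (\<alpha> m * \<sigma> m t * tent_map (2 ^ m * t)) \<le> \<bar>\<alpha> m\<bar>" by simp
qed

text \<open>At the right end point of a dyadic interval the sign may differ, but only where the tent map vanishes.\<close>

lemma f_midpoint:
  assumes k: "k < 2 ^ n"
  obtains e where "e \<in> {-1, 1}"
    "f (real (2 * k + 1) / 2 ^ Suc n) = (f (real k / 2 ^ n) + f (real (k + 1) / 2 ^ n)) / 2 + e * \<alpha> n / 2"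
proof -
  define l c r where "l = real k / 2 ^ n" and "c = real (2 * k + 1) / 2 ^ Suc n" and "r = real (k + 1) / 2 ^ n"
  have ord: "l < c" "c < r" by (simp_all add: l_def c_def r_def field_simps)
  have k': "2 * k + 1 \<le> 2 ^ Suc n" "k \<le> 2 ^ n" "k + 1 \<le> 2 ^ n" using k by simp_all
  have "real (k + 1) \<le> real (2 ^ n)"
    using k'(3) by (simp only: of_nat_le_iff)
  then have r1: "r \<le> 1"
    by (simp add: r_def)
  have l0: "0 \<le> l" by (simp add: l_def)
  have mid: "\<alpha> m * \<sigma> m c * tent_map (2 ^ m * c)
      = (\<alpha> m * \<sigma> m l * tent_map (2 ^ m * l) + \<alpha> m * \<sigma> m r * tent_map (2 ^ m * r)) / 2" if m: "m < n" for m
  proof -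
    obtain d where d: "n = m + d + 1" using m less_iff_Suc_add[of m n] by auto
    have tm: "tent_map (2 ^ m * c) = (tent_map (2 ^ m * l) + tent_map (2 ^ m * r)) / 2"
    proof -
      have "2 ^ m * l = real k / 2 ^ (d + 1)" "2 ^ m * r = real (k + 1) / 2 ^ (d + 1)"
        "2 ^ m * c = real (2 * k + 1) / 2 ^ (d + 2)"
        by (simp_all add: l_def c_def r_def d power_add)
      then show ?thesis
        by (simp only: tent_map_dyadic_midpoint)
    qed
    have sc: "\<sigma> m c = \<sigma> m l"
      using ord unfolding l_def r_def by (intro sign_eq[OF less_imp_le[OF m] k]) simp_all
    have "\<sigma> m r * tent_map (2 ^ m * r) = \<sigma> m l * tent_map (2 ^ m * r)"
    proof -
      define i where "i = k div 2 ^ (d + 1)"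
      have i: "i * 2 ^ (d + 1) \<le> k" "k + 1 \<le> (i + 1) * 2 ^ (d + 1)"
        unfolding i_def by (rule div_power2_bounds)+
      show ?thesis
      \<comment> \<open>Either r is the right end of its level-\<open>m\<close> interval, where 2^m
        r is an integer and the tent vanishes, or r still lies in the half-open interval on which
        the sign is constant.\<close>
      proof (cases "k + 1 = (i + 1) * 2 ^ (d + 1)")
        case True
        then have "real (k + 1) = real (i + 1) * 2 ^ (d + 1)" by (simp only: of_nat_mult of_nat_power of_nat_numeral)
        then have "2 ^ m * r = real (i + 1)"
          by (simp add: r_def d power_add field_simps)
        then have "tent_map (2 ^ m * r) = 0" by (simp only: tent_map_of_nat)
        then show ?thesis by simp
      next
        case False
        have il: "i < 2 ^ m"
          using k by (simp add: i_def d less_mult_imp_div_less power_add mult_ac)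
        have "k + 1 < (i + 1) * 2 ^ (d + 1)" using i(2) False by linarith
        then have "real i / 2 ^ m \<le> l" "r < real (i + 1) / 2 ^ m"
          using dyadic_rational_le(1)[OF i(1), of m] dyadic_rational_le(3)[of "k + 1" "i + 1" "d + 1" m]
          by (simp_all add: l_def r_def d)
        then have "\<sigma> m r = \<sigma> m (real i / 2 ^ m)" "\<sigma> m l = \<sigma> m (real i / 2 ^ m)"
          using ord by (intro sign_eq[OF order_refl il]; linarith)+
        then show ?thesis by simp
      qed
    qed
    then have "\<alpha> m * \<sigma> m r * tent_map (2 ^ m * r) = \<alpha> m * \<sigma> m l * tent_map (2 ^ m * r)"
      by (simp only: mult.assoc)
    then show ?thesis
      unfolding tm sc by (simp only: distrib_left add_divide_distrib times_divide_eq_right)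
  qed
  \<comment> \<open>Coarser levels are affine between the end points and so average at the midpoint,
    while finer levels vanish there; level \<open>n\<close> alone contributes, with its peak
    value.\<close>
  have "tent_map (2 ^ n * c) = 1/2"
    using tent_map_left[of "int k" "2 ^ n * c"] by (simp add: c_def field_simps)
  moreover have "f c = (\<Sum>m<Suc n. \<alpha> m * \<sigma> m c * tent_map (2 ^ m * c))"
    unfolding c_def by (rule f_dyadic[OF k'(1)])
  ultimately have "f c = (\<Sum>m<n. (\<alpha> m * \<sigma> m l * tent_map (2 ^ m * l) + \<alpha> m * \<sigma> m r * tent_map (2 ^ m * r)) / 2) + \<sigma> n c * \<alpha> n / 2"
    by (simp add: mid)
  also have "(\<Sum>m<n. (\<alpha> m * \<sigma> m l * tent_map (2 ^ m * l) + \<alpha> m * \<sigma> m r * tent_map (2 ^ m * r)) / 2) = (f l + f r) / 2"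
    unfolding l_def r_def f_dyadic[OF k'(2)] f_dyadic[OF k'(3)]
    by (simp add: sum.distrib sum_divide_distrib add_divide_distrib)
  finally show ?thesis
    using that[of "\<sigma> n c"] sign[of c n] ord r1 l0 by (simp add: l_def c_def r_def)
qed

definition scaled_increment :: "nat \<Rightarrow> nat \<Rightarrow> real" where
  "scaled_increment n k = 2 ^ n * dyadic_increment f n k"

lemma signed_tree_scaled_increment: "signed_tree (\<lambda>m. \<alpha> m * 2 ^ m) scaled_increment"
  unfolding signed_tree_def
proof (intro conjI allI impI)
  show "scaled_increment 0 0 = 0"
    using f_dyadic[of 0 0] f_dyadic[of 1 0] by (simp add: scaled_increment_def dyadic_increment_def)
next
  fix n k :: nat assume k: "k < 2 ^ n"
  from f_midpoint[OF k] obtain e where e: "e \<in> {-1, 1}"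
    "f (real (2 * k + 1) / 2 ^ Suc n) = (f (real k / 2 ^ n) + f (real (k + 1) / 2 ^ n)) / 2 + e * \<alpha> n / 2" .
  have ends: "real (2 * k + 1 + 1) / 2 ^ Suc n = real (k + 1) / 2 ^ n" "real (2 * k) / 2 ^ Suc n = real k / 2 ^ n"
    by (simp_all add: field_simps)
  show "\<exists>e\<in>{- 1, 1}. scaled_increment (Suc n) (2 * k) = scaled_increment n k + e * (\<alpha> n * 2 ^ n) \<and>
      scaled_increment (Suc n) (2 * k + 1) = scaled_increment n k - e * (\<alpha> n * 2 ^ n)"
  proof (rule bexI[OF _ e(1)])
    show "scaled_increment (Suc n) (2 * k) = scaled_increment n k + e * (\<alpha> n * 2 ^ n) \<and>
      scaled_increment (Suc n) (2 * k + 1) = scaled_increment n k - e * (\<alpha> n * 2 ^ n)"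
      unfolding scaled_increment_def dyadic_increment_def ends e(2) by (simp add: algebra_simps)
  qed
qed

definition increment_bound :: "nat \<Rightarrow> real" where
  "increment_bound n = (\<Sum>m<n. \<bar>\<alpha> m\<bar> * 2 ^ m) / 2 ^ n"

text \<open>Up to a factor 1/2 these are the terms of the Cauchy product of the absolutely
  convergent coefficient series with the geometric series of ratio 1/2, hence a null
  sequence.\<close>

lemma increment_bound_tendsto_0: "increment_bound \<longlonglongrightarrow> 0"
proof -
  have "summable (\<lambda>n. \<Sum>i\<le>n. \<bar>\<alpha> i\<bar> * (1 / 2) ^ (n - i))"
    by (rule summable_Cauchy_product) (use summable_coeff in auto)
  then have "(\<lambda>n. (\<Sum>i\<le>n. \<bar>\<alpha> i\<bar> * (1 / 2) ^ (n - i)) / 2) \<longlonglongrightarrow> 0 / 2"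
    by (intro tendsto_divide summable_LIMSEQ_zero tendsto_const) simp_all
  also have "(\<lambda>n. (\<Sum>i\<le>n. \<bar>\<alpha> i\<bar> * (1 / 2) ^ (n - i)) / 2) = (\<lambda>n. increment_bound (Suc n))"
  proof
    fix n
    show "(\<Sum>i\<le>n. \<bar>\<alpha> i\<bar> * (1 / 2) ^ (n - i)) / 2 = increment_bound (Suc n)"
      unfolding increment_bound_def lessThan_Suc_atMost sum_divide_distrib
    proof (rule sum.cong[OF refl])
      fix i assume "i \<in> {..n}"
      then have "(2::real) ^ Suc n = 2 * 2 ^ i * 2 ^ (n - i)"
        by (simp flip: power_add)
      then show "\<bar>\<alpha> i\<bar> * (1 / 2) ^ (n - i) / 2 = \<bar>\<alpha> i\<bar> * 2 ^ i / 2 ^ Suc n"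
        by (simp add: power_one_over)
    qed
  qed
  finally show ?thesis
    by (simp add: filterlim_sequentially_Suc)
qed

lemma abs_scaled_increment_le:
  assumes "k < 2 ^ n"
  shows "\<bar>scaled_increment n k\<bar> / 2 ^ n \<le> increment_bound n"
  unfolding increment_bound_def
  using signed_tree_bound[OF signed_tree_scaled_increment assms]
  by (intro divide_right_mono) (simp_all add: abs_mult)

text \<open>Below level \<open>n\<close> the point and its rounding share the sign, and the
  Lipschitz bound for the tents sums to \<open>increment_bound n\<close>. From level
  \<open>n\<close> on the tents vanish at the rounded point, so the tail of the coefficients bounds
  the rest.\<close>

lemma f_dyadic_approx:
  assumes t: "t \<in> {0..1}"
  shows "(\<lambda>n. f (real (nat \<lfloor>t * 2 ^ n\<rfloor>) / 2 ^ n)) \<longlonglongrightarrow> f t"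
proof (cases "t = 1")
  \<comment> \<open>The half-open intervals of \<open>sign_const\<close> leave the sign at 1
    unconstrained, but rounding is exact there.\<close>
  case True
  have "f (real (nat \<lfloor>t * 2 ^ n\<rfloor>) / 2 ^ n) = f t" for n
  proof -
    have "(2::real) ^ n = of_int (2 ^ n)" by simp
    then have "\<lfloor>(2::real) ^ n\<rfloor> = 2 ^ n" by (simp only: floor_of_int)
    then show ?thesis by (simp add: True nat_power_eq)
  qed
  then show ?thesis by simp
next
  case False
  define b where "b n m = (if m < n then \<bar>\<alpha> m\<bar> * 2 ^ m / 2 ^ n else \<bar>\<alpha> m\<bar>)" for n m
  have tail: "summable (\<lambda>m. \<bar>\<alpha> (m + n)\<bar>)" for n
    by (rule summable_ignore_initial_segment[OF summable_coeff])
  have bsum: "summable (b n)" "suminf (b n) = increment_bound n + (\<Sum>m. \<bar>\<alpha> (m + n)\<bar>)" for n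
  proof -
    show 1: "summable (b n)"
      by (subst summable_iff_shift[of _ n, symmetric]) (simp add: b_def tail)
    show "suminf (b n) = increment_bound n + (\<Sum>m. \<bar>\<alpha> (m + n)\<bar>)"
      by (subst suminf_split_initial_segment[OF 1, of n]) (simp add: b_def increment_bound_def sum_divide_distrib)
  qed
  have "\<bar>f (real (nat \<lfloor>t * 2 ^ n\<rfloor>) / 2 ^ n) - f t\<bar> \<le> increment_bound n + (\<Sum>m. \<bar>\<alpha> (m + n)\<bar>)" for n
  proof -
    define k where "k = nat \<lfloor>t * 2 ^ n\<rfloor>"
    define s where "s = real k / 2 ^ n"
    have t01: "0 \<le> t" "t < 1" using t False by auto
    have kt: "real k \<le> t * 2 ^ n" "t * 2 ^ n < real k + 1"
      using t01 unfolding k_def by (simp_all add: of_nat_nat)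
    then have st: "s \<le> t" "t < real (k + 1) / 2 ^ n"
      unfolding s_def by (simp_all add: field_simps)
    have "t - s \<le> real (k + 1) / 2 ^ n - s"
      by (intro diff_right_mono less_imp_le st)
    also have "\<dots> = 1 / 2 ^ n"
      by (simp add: s_def flip: diff_divide_distrib)
    finally have st: "s \<le> t" "t < real (k + 1) / 2 ^ n" "t - s \<le> 1 / 2 ^ n"
      using st by blast+
    have "t * 2 ^ n < 1 * 2 ^ n"
      using t01 by (intro mult_strict_right_mono) auto
    from le_less_trans[OF kt(1) this] have "real k < real (2 ^ n)"
      by (simp only: of_nat_power of_nat_numeral mult_1)
    then have k: "k < 2 ^ n"
      by (simp only: of_nat_less_iff)
    have "0 \<le> s" by (simp add: s_def)
    with st(1) t01 have s01: "s \<in> {0..1}" by simp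
    have bd: "\<bar>\<alpha> m * \<sigma> m s * tent_map (2 ^ m * s) - \<alpha> m * \<sigma> m t * tent_map (2 ^ m * t)\<bar> \<le> b n m" for m
    proof (cases "m < n")
      case True
      have eq: "\<sigma> m t = \<sigma> m s"
        using sign_eq[OF less_imp_le[OF True] k st(1,2)[unfolded s_def]] unfolding s_def .
      have "\<bar>\<sigma> m s\<bar> = 1" using sign[OF s01, of m] by auto
      then have "\<bar>\<alpha> m * \<sigma> m s * tent_map (2 ^ m * s) - \<alpha> m * \<sigma> m t * tent_map (2 ^ m * t)\<bar>
          = \<bar>\<alpha> m\<bar> * \<bar>tent_map (2 ^ m * s) - tent_map (2 ^ m * t)\<bar>"
        unfolding eq right_diff_distrib[symmetric] by (simp add: abs_mult)
      also have "\<dots> \<le> \<bar>\<alpha> m\<bar> * \<bar>2 ^ m * s - 2 ^ m * t\<bar>"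
        by (intro mult_left_mono tent_map_lipschitz) auto
      also have "\<bar>2 ^ m * s - 2 ^ m * t\<bar> = 2 ^ m * (t - s)"
        unfolding right_diff_distrib[symmetric] using st(1) by (simp add: abs_mult)
      also have "\<bar>\<alpha> m\<bar> * (2 ^ m * (t - s)) \<le> \<bar>\<alpha> m\<bar> * (2 ^ m * (1 / 2 ^ n))"
        by (intro mult_left_mono st(3)) simp_all
      finally show ?thesis using True by (simp add: b_def)
    next
      case False
      have "\<bar>\<sigma> m t\<bar> = 1" using sign[OF t, of m] by auto
      moreover have "tent_map (2 ^ m * s) = 0"
        unfolding s_def using False by (intro tent_dyadic_zero) simp
      ultimately have "\<bar>\<alpha> m * \<sigma> m s * tent_map (2 ^ m * s) - \<alpha> m * \<sigma> m t * tent_map (2 ^ m * t)\<bar>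
          = \<bar>\<alpha> m\<bar> * tent_map (2 ^ m * t)"
        using tent_map_nonneg[of "2 ^ m * t"] by (simp add: abs_mult)
      also have "\<dots> \<le> \<bar>\<alpha> m\<bar> * 1"
        using tent_map_le_half[of "2 ^ m * t"] by (intro mult_left_mono) auto
      finally show ?thesis using False by (simp add: b_def)
    qed
    have "f s - f t = (\<Sum>m. \<alpha> m * \<sigma> m s * tent_map (2 ^ m * s) - \<alpha> m * \<sigma> m t * tent_map (2 ^ m * t))"
      unfolding f_eq[OF t] f_eq[OF s01] by (rule suminf_diff[OF summable_terms[OF s01] summable_terms[OF t]])
    also have "norm \<dots> \<le> suminf (b n)"
      using bd by (intro norm_suminf_le bsum(1)) auto
    finally show ?thesis
      by (simp add: bsum(2) s_def k_def)
  qed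
  note bound = this
  have "(\<lambda>n. increment_bound n + (\<Sum>m. \<bar>\<alpha> (m + n)\<bar>)) \<longlonglongrightarrow> 0 + 0"
    by (intro tendsto_add increment_bound_tendsto_0 suminf_exist_split2 summable_coeff)
  then have "(\<lambda>n. increment_bound n + (\<Sum>m. \<bar>\<alpha> (m + n)\<bar>)) \<longlonglongrightarrow> 0"
    by (simp only: add_0)
  then have "(\<lambda>n. f (real (nat \<lfloor>t * 2 ^ n\<rfloor>) / 2 ^ n) - f t) \<longlonglongrightarrow> 0"
    by (rule Lim_null_comparison[rotated]) (simp add: bound)
  then show ?thesis
    by (rule LIM_zero_cancel)
qed

lemma total_variation_eq: "total_variation f 0 1 = (SUP n. ereal (dyadic_V 1 f n))"
  by (rule total_variation_eq_SUP_dyadic_V) (rule f_dyadic_approx)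

lemma abs_scaled_increment: "\<bar>scaled_increment n k\<bar> / 2 ^ n = \<bar>f (real (k + 1) / 2 ^ n) - f (real k / 2 ^ n)\<bar>"
  unfolding scaled_increment_def dyadic_increment_def abs_mult by simp

lemma dyadic_V_eq: "dyadic_V r f n = (\<Sum>k<2 ^ n. (\<bar>scaled_increment n k\<bar> / 2 ^ n) powr r)"
  unfolding dyadic_V_def abs_scaled_increment ..

lemma dyadic_sum_eq:
  "dyadic_sum \<Psi> f t n = (\<Sum>k\<in>{..nat \<lfloor>t * 2 ^ n\<rfloor>} - {2 ^ n}. \<Psi> (\<bar>scaled_increment n k\<bar> / 2 ^ n))"
  unfolding dyadic_sum_def abs_scaled_increment ..

end

section \<open>Moments of signed sums\<close>

lemma cosh_le_exp_half_square: "cosh x \<le> exp (x\<^sup>2 / 2)" for x :: real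
proof -
  have *: "cosh x \<le> exp (x\<^sup>2 / 2)" if "0 \<le> x" for x :: real
  proof -
    \<comment> \<open>The logarithmic function of Hoeffding's lemma for a fair coin, taken at 2x,
      equals ln cosh x.\<close>
    have "- (2 * x) * (1 / 2) + ln (1 + 1 / 2 * (exp (2 * x) - 1)) \<le> (2 * x)\<^sup>2 / 8"
      using that by (intro Hoeffdings_lemma_aux) auto
    moreover have "1 + 1 / 2 * (exp (2 * x) - 1) = exp x * cosh x"
      by (simp add: cosh_field_def algebra_simps flip: exp_add)
    ultimately have "ln (cosh x) \<le> x\<^sup>2 / 2"
      by (simp add: ln_mult cosh_real_pos power2_eq_square)
    then have "exp (ln (cosh x)) \<le> exp (x\<^sup>2 / 2)"
      by (simp only: exp_le_cancel_iff)
    then show ?thesis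
      using cosh_real_pos[of x] by (simp only: exp_ln)
  qed
  show ?thesis
    using *[of x] *[of "- x"] by (cases "0 \<le> x") auto
qed

text \<open>Each bisection multiplies the sum by exp(i t a) + exp(-i t a) = 2 cos(t a). After
  division by \<open>2 ^ d\<close> this is the characteristic function of the signed sum with the
  first \<open>l\<close> signs fixed by the node \<open>j\<close>.\<close>

lemma signed_tree_block_sum_iexp:
  assumes S: "signed_tree a S" and j: "j < 2 ^ l"
  shows "(\<Sum>k\<in>dyadic_block j d. iexp (t * S (l + d) k)) =
    2 ^ d * iexp (t * S l j) * (\<Prod>m\<in>{l..<l + d}. complex_of_real (cos (t * a m)))"
proof (induction d)
  case (Suc d)
  have step: "iexp (t * (x + y)) + iexp (t * (x - y)) = 2 * complex_of_real (cos (t * y)) * iexp (t * x)" for x y :: real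
    by (simp add: ring_distribs exp_add exp_diff cos_exp_eq cos_of_real[symmetric] del: cos_of_real)
       (simp add: exp_minus field_simps)
  have "(\<Sum>k\<in>dyadic_block j (Suc d). iexp (t * S (l + Suc d) k)) =
      (\<Sum>k\<in>dyadic_block j d. iexp (t * (S (l + d) k + a (l + d))) + iexp (t * (S (l + d) k - a (l + d))))"
    by (rule signed_tree_sum_Suc[OF S j, of "\<lambda>x. iexp (t * x)"])
  also have "\<dots> = 2 * complex_of_real (cos (t * a (l + d))) * (\<Sum>k\<in>dyadic_block j d. iexp (t * S (l + d) k))"
    unfolding step sum_distrib_left ..
  finally show ?case
    unfolding Suc.IH by (simp add: prod.atLeastLessThan_Suc mult_ac)
qed simp

lemma signed_tree_sum_cosh:
  assumes S: "signed_tree a S"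
  shows "(\<Sum>k<2 ^ n. cosh (c * S n k)) = 2 ^ n * (\<Prod>m<n. cosh (c * a m))"
proof (induction n)
  case (Suc n)
  have "(\<Sum>k<2 ^ Suc n. cosh (c * S (Suc n) k)) =
      (\<Sum>k<2 ^ n. cosh (c * (S n k + a n)) + cosh (c * (S n k - a n)))"
    by (rule signed_tree_sum_lessThan_Suc[OF S, of "\<lambda>x. cosh (c * x)"])
  also have "\<dots> = 2 * cosh (c * a n) * (\<Sum>k<2 ^ n. cosh (c * S n k))"
    by (simp add: ring_distribs cosh_add cosh_diff sum_distrib_left mult_ac)
  finally show ?case
    unfolding Suc.IH by (simp add: mult_ac)
qed (use S in \<open>simp add: signed_tree_def\<close>)

lemma signed_tree_sum_square:
  assumes S: "signed_tree a S"
  shows "(\<Sum>k<2 ^ n. (S n k)\<^sup>2) = 2 ^ n * (\<Sum>m<n. (a m)\<^sup>2)"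
proof (induction n)
  case (Suc n)
  have "(\<Sum>k<2 ^ Suc n. (S (Suc n) k)\<^sup>2) = (\<Sum>k<2 ^ n. (S n k + a n)\<^sup>2 + (S n k - a n)\<^sup>2)"
    by (rule signed_tree_sum_lessThan_Suc[OF S])
  also have "\<dots> = (\<Sum>k<2 ^ n. 2 * (S n k)\<^sup>2 + 2 * (a n)\<^sup>2)"
    by (intro sum.cong refl) (simp add: power2_eq_square algebra_simps)
  also have "\<dots> = 2 * (\<Sum>k<2 ^ n. (S n k)\<^sup>2) + 2 ^ Suc n * (a n)\<^sup>2"
    by (simp add: sum.distrib sum_distrib_left)
  finally show ?case
    unfolding Suc.IH by (simp add: algebra_simps)
qed (use S in \<open>simp add: signed_tree_def\<close>)

lemma signed_tree_sum_fourth: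
  assumes S: "signed_tree a S"
  shows "(\<Sum>k<2 ^ n. (S n k) ^ 4) \<le> 3 * 2 ^ n * (\<Sum>m<n. (a m)\<^sup>2)\<^sup>2"
proof (induction n)
  case (Suc n)
  have "(\<Sum>k<2 ^ Suc n. (S (Suc n) k) ^ 4) = (\<Sum>k<2 ^ n. (S n k + a n) ^ 4 + (S n k - a n) ^ 4)"
    by (rule signed_tree_sum_lessThan_Suc[OF S])
  also have "\<dots> = (\<Sum>k<2 ^ n. 2 * (S n k) ^ 4 + 12 * (a n)\<^sup>2 * (S n k)\<^sup>2 + 2 * (a n) ^ 4)"
    by (intro sum.cong refl) (simp add: power2_eq_square power4_eq_xxxx algebra_simps)
  also have "\<dots> = 2 * (\<Sum>k<2 ^ n. (S n k) ^ 4) + 12 * (a n)\<^sup>2 * (\<Sum>k<2 ^ n. (S n k)\<^sup>2) + 2 ^ Suc n * (a n) ^ 4"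
    by (simp add: sum.distrib sum_distrib_left)
  \<comment> \<open>Inflating the pure fourth power by 3 completes the square: 12 * 2^n is twice 3 *
    2^(n+1). The constant 3 is the Gaussian fourth moment.\<close>
  also have "\<dots> \<le> 2 * (3 * 2 ^ n * (\<Sum>m<n. (a m)\<^sup>2)\<^sup>2) + 12 * (a n)\<^sup>2 * (2 ^ n * (\<Sum>m<n. (a m)\<^sup>2)) + 3 * (2 ^ Suc n * (a n) ^ 4)"
    unfolding signed_tree_sum_square[OF S] using Suc.IH by (intro add_mono) auto
  also have "\<dots> = 3 * 2 ^ Suc n * (\<Sum>m<Suc n. (a m)\<^sup>2)\<^sup>2"
    by (simp add: power2_sum algebra_simps power4_eq_xxxx power2_eq_square)
  finally show ?case .
qed (use S in \<open>simp add: signed_tree_def\<close>)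

text \<open>The constant comes from ln u \<le> u - 1 at u = |x| / (r + 1), which leaves an exponent
  r |x| / (r + 1) below |x|. Only its independence of x matters later.\<close>

lemma powr_le_cosh:
  fixes x r :: real
  assumes "0 \<le> r"
  shows "\<bar>x\<bar> powr r \<le> 2 * (r + 1) powr r * cosh x"
proof (cases "x = 0")
  case True
  then show ?thesis by simp
next
  case False
  have "ln (\<bar>x\<bar> / (r + 1)) \<le> \<bar>x\<bar> / (r + 1) - 1"
    using False assms by (intro ln_le_minus_one) auto
  then have "ln \<bar>x\<bar> \<le> \<bar>x\<bar> / (r + 1) + ln (r + 1)"
    using False assms by (simp add: ln_div)
  then have "r * ln \<bar>x\<bar> \<le> r * (\<bar>x\<bar> / (r + 1)) + r * ln (r + 1)"
    using assms mult_left_mono by (metis distrib_left)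
  also have "r * (\<bar>x\<bar> / (r + 1)) \<le> \<bar>x\<bar>"
    using assms by (simp add: field_simps)
  finally have "\<bar>x\<bar> powr r \<le> exp (\<bar>x\<bar> + r * ln (r + 1))"
    using False by (simp add: powr_def)
  also have "\<dots> = (r + 1) powr r * exp \<bar>x\<bar>"
    using assms by (simp add: powr_def exp_add)
  also have "\<dots> \<le> (r + 1) powr r * (2 * cosh x)"
    by (intro mult_left_mono) (cases "0 \<le> x"; simp add: cosh_field_def)+
  finally show ?thesis
    by (simp add: mult_ac)
qed

text \<open>Sub-Gaussian behaviour: after normalisation the product of the cosh factors is at most
  exp(1/2), whatever the coefficients and \<open>n\<close>.\<close>

lemma signed_tree_moment_bound:
  assumes S: "signed_tree a S" and r: "0 \<le> r" and pos: "0 < (\<Sum>m<n. (a m)\<^sup>2)"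
  shows "(\<Sum>k<2 ^ n. \<bar>S n k / sqrt (\<Sum>m<n. (a m)\<^sup>2)\<bar> powr r) \<le> 2 ^ n * (2 * (r + 1) powr r * exp (1/2))"
proof -
  define s where "s = sqrt (\<Sum>m<n. (a m)\<^sup>2)"
  have s: "0 < s" "s\<^sup>2 = (\<Sum>m<n. (a m)\<^sup>2)" using pos by (auto simp: s_def sum_nonneg)
  have "(\<Sum>k<2 ^ n. \<bar>S n k / s\<bar> powr r) \<le> (\<Sum>k<2 ^ n. 2 * (r + 1) powr r * cosh (1 / s * S n k))"
  proof (rule sum_mono)
    fix k
    show "\<bar>S n k / s\<bar> powr r \<le> 2 * (r + 1) powr r * cosh (1 / s * S n k)"
      using powr_le_cosh[OF r, of "S n k / s"] by (simp only: times_divide_eq_left mult_1)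
  qed
  also have "\<dots> = 2 ^ n * (2 * (r + 1) powr r * (\<Prod>m<n. cosh (1 / s * a m)))"
    unfolding sum_distrib_left[symmetric] signed_tree_sum_cosh[OF S] by simp
  also have "(\<Prod>m<n. cosh (1 / s * a m)) \<le> (\<Prod>m<n. exp ((1 / s * a m)\<^sup>2 / 2))"
    by (intro prod_mono conjI cosh_le_exp_half_square) (simp add: cosh_real_nonneg)
  also have "\<dots> = exp ((\<Sum>m<n. (a m)\<^sup>2) / s\<^sup>2 / 2)"
    by (simp add: exp_sum power_mult_distrib power_divide sum_divide_distrib)
  also have "(\<Sum>m<n. (a m)\<^sup>2) / s\<^sup>2 / 2 = 1/2"
    using s pos by simp
  finally show ?thesis
    by (simp add: s_def mult_left_mono)
qed

text \<open>The inequality \<open>x^2 \<le> 4 |x| + x^4 / 16\<close> turns the second and fourth moments into a bound for the first.\<close>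

lemma signed_tree_first_moment_lower:
  assumes S: "signed_tree a S"
  shows "2 ^ n * (sqrt (\<Sum>m<n. (a m)\<^sup>2) * (13 / 64)) \<le> (\<Sum>k<2 ^ n. \<bar>S n k\<bar>)"
proof -
  define s where "s = sqrt (\<Sum>m<n. (a m)\<^sup>2)"
  have s2: "s\<^sup>2 = (\<Sum>m<n. (a m)\<^sup>2)" "0 \<le> s" by (auto simp: s_def sum_nonneg)
  show ?thesis
  proof (cases "s = 0")
    case True
    then show ?thesis by (simp add: s_def sum_nonneg)
  next
    case False
    with s2 have s: "0 < s" by simp
    have ineq: "x\<^sup>2 \<le> 4 * s * \<bar>x\<bar> + x ^ 4 / (16 * s\<^sup>2)" for x :: real
    proof (cases "\<bar>x\<bar> \<le> 4 * s")
      case True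
      have "x\<^sup>2 = \<bar>x\<bar> * \<bar>x\<bar>" by (simp add: power2_eq_square)
      also have "\<dots> \<le> 4 * s * \<bar>x\<bar>" using True by (intro mult_right_mono) auto
      finally show ?thesis using s by (simp add: add_increasing2)
    next
      case False
      then have "(4 * s)\<^sup>2 \<le> \<bar>x\<bar>\<^sup>2" using s by (intro power_mono) auto
      then have "x\<^sup>2 * (16 * s\<^sup>2) \<le> x\<^sup>2 * x\<^sup>2" by (intro mult_left_mono) (auto simp: power_mult_distrib)
      then have "x\<^sup>2 \<le> x ^ 4 / (16 * s\<^sup>2)" using s by (simp add: field_simps power4_eq_xxxx power2_eq_square)
      then show ?thesis using s by (simp add: add_increasing)
    qed
    have "2 ^ n * s\<^sup>2 = (\<Sum>k<2 ^ n. (S n k)\<^sup>2)"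
      using signed_tree_sum_square[OF S] s2 by simp
    also have "\<dots> \<le> (\<Sum>k<2 ^ n. 4 * s * \<bar>S n k\<bar> + (S n k) ^ 4 / (16 * s\<^sup>2))"
      by (intro sum_mono ineq)
    also have "\<dots> = 4 * s * (\<Sum>k<2 ^ n. \<bar>S n k\<bar>) + (\<Sum>k<2 ^ n. (S n k) ^ 4) / (16 * s\<^sup>2)"
      by (simp add: sum.distrib sum_distrib_left sum_divide_distrib)
    also have "\<dots> \<le> 4 * s * (\<Sum>k<2 ^ n. \<bar>S n k\<bar>) + (3 * 2 ^ n * (s\<^sup>2)\<^sup>2) / (16 * s\<^sup>2)"
      using signed_tree_sum_fourth[OF S, of n] unfolding s2(1)[symmetric]
      by (intro add_left_mono divide_right_mono) simp_all
    \<comment> \<open>The fourth moment uses up 3/16 of the second moment; the remaining 13/16,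
      divided by the factor 4, give 13/64.\<close>
    also have "(3 * 2 ^ n * (s\<^sup>2)\<^sup>2) / (16 * s\<^sup>2) = 3 / 16 * (2 ^ n * s\<^sup>2)"
      using s by (simp add: power2_eq_square)
    finally have "2 ^ n * (s * s) * (13 / 64) \<le> s * (\<Sum>k<2 ^ n. \<bar>S n k\<bar>)"
      by (simp add: power2_eq_square)
    then have "s * (2 ^ n * (s * (13 / 64))) \<le> s * (\<Sum>k<2 ^ n. \<bar>S n k\<bar>)"
      by (simp add: mult_ac)
    then have "2 ^ n * (s * (13 / 64)) \<le> (\<Sum>k<2 ^ n. \<bar>S n k\<bar>)"
      using s by simp
    then show ?thesis by (simp add: s_def)
  qed
qed

text \<open>With \<open>e\<close> equal to half of 13/64, values below \<open>e\<close> account for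
  at most half of the first moment; above \<open>e\<close> the modulus is dominated by e^(1-r) times
  its r-th power.\<close>

lemma signed_tree_moment_lower:
  assumes S: "signed_tree a S" and r: "1 \<le> r" and pos: "0 < (\<Sum>m<n. (a m)\<^sup>2)"
  shows "2 ^ n * (13 / 128) powr r \<le> (\<Sum>k<2 ^ n. \<bar>S n k / sqrt (\<Sum>m<n. (a m)\<^sup>2)\<bar> powr r)"
proof -
  define s where "s = sqrt (\<Sum>m<n. (a m)\<^sup>2)"
  have s: "0 < s" using pos by (simp add: s_def)
  define e where "e = (13 / 128 :: real)"
  have e: "0 < e" by (simp add: e_def)
  have ineq: "\<bar>x\<bar> \<le> e + e powr (1 - r) * \<bar>x\<bar> powr r" for x
  proof (cases "\<bar>x\<bar> \<le> e")
    case False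
    then have x: "0 < \<bar>x\<bar>" by (simp add: e_def)
    have "1 \<le> (\<bar>x\<bar> / e) powr (r - 1)"
      using False r by (intro ge_one_powr_ge_zero) (auto simp: e_def)
    then have "\<bar>x\<bar> * 1 \<le> \<bar>x\<bar> * (\<bar>x\<bar> / e) powr (r - 1)"
      by (intro mult_left_mono) auto
    also have "\<dots> = e powr (1 - r) * \<bar>x\<bar> powr r"
      using x e by (simp add: powr_divide powr_diff del: abs_divide)
    finally show ?thesis by (simp add: e_def)
  qed (simp add: add_increasing2)
  have "2 ^ n * (2 * e) = 2 ^ n * (s * (13 / 64)) / s"
    using s by (simp add: e_def)
  also have "\<dots> \<le> (\<Sum>k<2 ^ n. \<bar>S n k\<bar>) / s"
    using signed_tree_first_moment_lower[OF S, of n] s by (intro divide_right_mono) (auto simp: s_def)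
  also have "\<dots> = (\<Sum>k<2 ^ n. \<bar>S n k / s\<bar>)"
    using s by (simp add: sum_divide_distrib)
  also have "\<dots> \<le> (\<Sum>k<2 ^ n. e + e powr (1 - r) * \<bar>S n k / s\<bar> powr r)"
    by (intro sum_mono ineq)
  also have "\<dots> = 2 ^ n * e + e powr (1 - r) * (\<Sum>k<2 ^ n. \<bar>S n k / s\<bar> powr r)"
    by (simp add: sum.distrib sum_distrib_left)
  finally have "2 ^ n * e \<le> e powr (1 - r) * (\<Sum>k<2 ^ n. \<bar>S n k / s\<bar> powr r)"
    by linarith
  then have "e powr (r - 1) * (2 ^ n * e) \<le> e powr (r - 1) * (e powr (1 - r) * (\<Sum>k<2 ^ n. \<bar>S n k / s\<bar> powr r))"
    by (rule mult_left_mono) simp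
  also have "\<dots> = (\<Sum>k<2 ^ n. \<bar>S n k / s\<bar> powr r)"
    by (simp add: e_def mult.assoc[symmetric] flip: powr_add)
  also have "e powr (r - 1) * (2 ^ n * e) = 2 ^ n * e powr r"
    by (simp add: e_def powr_diff)
  finally show ?thesis
    by (simp add: e_def s_def)
qed

text \<open>The Markov step behind uniform integrability: beyond R one more power of |x| gains a
  factor 1 / R.\<close>

lemma abs_powr_truncate:
  fixes x r R :: real
  assumes "0 < r" "0 < R"
  shows "\<bar>\<bar>x\<bar> powr r - min (\<bar>x\<bar> powr r) (R powr r)\<bar> \<le> \<bar>x\<bar> powr (r + 1) / R"
proof (cases "\<bar>x\<bar> \<le> R")
  case True
  then have "\<bar>x\<bar> powr r \<le> R powr r" using assms by (intro powr_mono2) auto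
  then show ?thesis using assms by simp
next
  case False
  have "\<bar>x\<bar> powr r * R \<le> \<bar>x\<bar> powr r * \<bar>x\<bar>" using False by (intro mult_left_mono) auto
  then have "\<bar>x\<bar> powr r \<le> \<bar>x\<bar> powr (r + 1) / R"
    using assms by (simp add: powr_add field_simps)
  moreover have "0 \<le> R powr r" "0 \<le> \<bar>x\<bar> powr r" by simp_all
  ultimately show ?thesis by linarith
qed

text \<open>Truncation at \<open>R\<close> gives a bounded continuous function, to which weak
  convergence applies. The bounded moment of order \<open>r + 1\<close> makes the truncation error
  at most K / R, uniformly in n.\<close>

lemma weak_conv_moment_tendsto:
  fixes \<mu> :: "nat \<Rightarrow> real measure" and M :: "real measure"
  assumes \<mu>: "\<And>n. real_distribution (\<mu> n)" and M: "real_distribution M" and conv: "weak_conv_m \<mu> M"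
    and r: "0 < r"
    and int_\<mu>: "\<And>n. integrable (\<mu> n) (\<lambda>x. \<bar>x\<bar> powr (r + 1))"
    and bound: "\<And>n. integral\<^sup>L (\<mu> n) (\<lambda>x. \<bar>x\<bar> powr (r + 1)) \<le> C"
    and int_M: "integrable M (\<lambda>x. \<bar>x\<bar> powr (r + 1))"
  shows "(\<lambda>n. integral\<^sup>L (\<mu> n) (\<lambda>x. \<bar>x\<bar> powr r)) \<longlonglongrightarrow> integral\<^sup>L M (\<lambda>x. \<bar>x\<bar> powr r)"
proof -
  define h where "h R x = min (\<bar>x\<bar> powr r) (R powr r)" for R x :: real
  have h_meas [measurable]: "h R \<in> borel_measurable borel" for R
    unfolding h_def[abs_def] by measurable
  have trunc: "integrable N (\<lambda>x. \<bar>x\<bar> powr r) \<and> \<bar>integral\<^sup>L N (\<lambda>x. \<bar>x\<bar> powr r) - integral\<^sup>L N (h R)\<bar> \<le> integral\<^sup>L N (\<lambda>x. \<bar>x\<bar> powr (r + 1)) / R"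
    if N: "real_distribution N" and int: "integrable N (\<lambda>x. \<bar>x\<bar> powr (r + 1))" and R: "0 < R" for N R
  proof -
    interpret N: real_distribution N by fact
    have [measurable]: "h R \<in> borel_measurable N" for R
      using h_meas by (simp cong: measurable_cong_sets)
    have hm: "integrable N (h R)"
      by (rule N.integrable_const_bound[of _ "R powr r"]) (auto simp: h_def)
    have i1: "integrable N (\<lambda>x. \<bar>x\<bar> powr r)"
    proof (rule Bochner_Integration.integrable_bound[of _ "\<lambda>x. h 1 x + \<bar>x\<bar> powr (r + 1)"])
      have "integrable N (h 1)"
        by (rule N.integrable_const_bound[of _ 1]) (auto simp: h_def)
      then show "integrable N (\<lambda>x. h 1 x + \<bar>x\<bar> powr (r + 1))"
        using int by simp
      show "AE x in N. norm (\<bar>x\<bar> powr r) \<le> norm (h 1 x + \<bar>x\<bar> powr (r + 1))"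
      proof (rule AE_I2)
        fix x
        show "norm (\<bar>x\<bar> powr r) \<le> norm (h 1 x + \<bar>x\<bar> powr (r + 1))"
          using abs_powr_truncate[OF r, of 1 x] by (simp add: h_def)
      qed
    qed simp
    have "\<bar>integral\<^sup>L N (\<lambda>x. \<bar>x\<bar> powr r) - integral\<^sup>L N (h R)\<bar> = \<bar>integral\<^sup>L N (\<lambda>x. \<bar>x\<bar> powr r - h R x)\<bar>"
      using i1 hm by simp
    also have "\<dots> \<le> integral\<^sup>L N (\<lambda>x. \<bar>\<bar>x\<bar> powr r - h R x\<bar>)"
      by (rule integral_abs_bound)
    also have "\<dots> \<le> integral\<^sup>L N (\<lambda>x. \<bar>x\<bar> powr (r + 1) / R)"
      using i1 hm int abs_powr_truncate[OF r R] by (intro integral_mono) (auto simp: h_def)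
    finally show ?thesis using i1 by simp
  qed
  show ?thesis
  proof (rule tendstoI)
    fix e :: real assume e: "0 < e"
    define K where "K = max C (integral\<^sup>L M (\<lambda>x. \<bar>x\<bar> powr (r + 1)))"
    have K: "C \<le> K" "integral\<^sup>L M (\<lambda>x. \<bar>x\<bar> powr (r + 1)) \<le> K" by (auto simp: K_def)
    have "0 \<le> integral\<^sup>L M (\<lambda>x. \<bar>x\<bar> powr (r + 1))" by simp
    then have K0: "0 \<le> K" using K by linarith
    define R where "R = 3 * K / e + 1"
    have R: "0 < R" using K0 e by (auto simp: R_def intro!: add_nonneg_pos)
    have KR: "K / R < e / 3"
      using K0 e R by (simp add: R_def field_simps)
    have "(\<lambda>n. integral\<^sup>L (\<mu> n) (h R)) \<longlonglongrightarrow> integral\<^sup>L M (h R)"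
    proof (rule weak_conv_imp_integral_bdd_continuous_conv[OF \<mu> M conv])
      fix x
      show "isCont (h R) x"
        unfolding h_def using r by (intro continuous_intros) auto
      show "norm (h R x) \<le> R powr r" by (simp add: h_def)
    qed
    then have "eventually (\<lambda>n. dist (integral\<^sup>L (\<mu> n) (h R)) (integral\<^sup>L M (h R)) < e / 3) sequentially"
      by (rule tendstoD) (use e in simp)
    then show "eventually (\<lambda>n. dist (integral\<^sup>L (\<mu> n) (\<lambda>x. \<bar>x\<bar> powr r)) (integral\<^sup>L M (\<lambda>x. \<bar>x\<bar> powr r)) < e) sequentially"
    proof eventually_elim
      case (elim n)
      have "\<bar>integral\<^sup>L (\<mu> n) (\<lambda>x. \<bar>x\<bar> powr r) - integral\<^sup>L (\<mu> n) (h R)\<bar> \<le> integral\<^sup>L (\<mu> n) (\<lambda>x. \<bar>x\<bar> powr (r + 1)) / R"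
        using trunc[OF \<mu> int_\<mu> R] by blast
      also have "\<dots> \<le> K / R"
        using bound[of n] K R by (intro divide_right_mono) auto
      finally have 1: "\<bar>integral\<^sup>L (\<mu> n) (\<lambda>x. \<bar>x\<bar> powr r) - integral\<^sup>L (\<mu> n) (h R)\<bar> \<le> K / R" .
      have "\<bar>integral\<^sup>L M (\<lambda>x. \<bar>x\<bar> powr r) - integral\<^sup>L M (h R)\<bar> \<le> integral\<^sup>L M (\<lambda>x. \<bar>x\<bar> powr (r + 1)) / R"
        using trunc[OF M int_M R] by blast
      also have "\<dots> \<le> K / R"
        using K R by (intro divide_right_mono) auto
      finally have 2: "\<bar>integral\<^sup>L M (\<lambda>x. \<bar>x\<bar> powr r) - integral\<^sup>L M (h R)\<bar> \<le> K / R" .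
      show ?case
        using 1 2 elim KR unfolding dist_real_def by linarith
    qed
  qed
qed

text \<open>The conditional law of the normalised signed sum of level \<open>l + d\<close>, given
  the first \<open>l\<close> signs: a node \<open>j\<close> of level \<open>l\<close> encodes them,
  and the leaves below it are equally likely.\<close>

definition block_law :: "(nat \<Rightarrow> nat \<Rightarrow> real) \<Rightarrow> (nat \<Rightarrow> real) \<Rightarrow> nat \<Rightarrow> nat \<Rightarrow> nat \<Rightarrow> real measure" where
  "block_law S s l j d = distr (measure_pmf (pmf_of_set (dyadic_block j d))) borel (\<lambda>k. S (l + d) k / s (l + d))"

lemma dyadic_block_nonempty: "dyadic_block j d \<noteq> {}"
  by (metis card.empty card_dyadic_block power_not_zero zero_neq_numeral)

lemma real_distribution_block_law: "real_distribution (block_law S s l j d)"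
  unfolding block_law_def by (rule prob_space.real_distribution_distr[OF prob_space_measure_pmf]) simp

lemma integral_block_law:
  fixes F :: "real \<Rightarrow> 'a :: {banach, second_countable_topology}"
  assumes [measurable]: "F \<in> borel_measurable borel"
  shows "integral\<^sup>L (block_law S s l j d) F = (1 / 2 ^ d) *\<^sub>R (\<Sum>k\<in>dyadic_block j d. F (S (l + d) k / s (l + d)))"
    and "integrable (block_law S s l j d) F"
proof -
  have *: "integral\<^sup>L (measure_pmf (pmf_of_set (dyadic_block j d))) (\<lambda>k. F (S (l + d) k / s (l + d)))
      = (\<Sum>k\<in>dyadic_block j d. pmf (pmf_of_set (dyadic_block j d)) k *\<^sub>R F (S (l + d) k / s (l + d)))"
    by (rule integral_measure_pmf) (auto simp: dyadic_block_nonempty)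
  show "integral\<^sup>L (block_law S s l j d) F = (1 / 2 ^ d) *\<^sub>R (\<Sum>k\<in>dyadic_block j d. F (S (l + d) k / s (l + d)))"
    unfolding block_law_def scaleR_sum_right
    by (subst integral_distr) (simp_all add: * dyadic_block_nonempty)
  show "integrable (block_law S s l j d) F"
    unfolding block_law_def
    by (subst integrable_distr_eq) (auto intro!: integrable_measure_pmf_finite simp: dyadic_block_nonempty)
qed

text \<open>The fixed signs enter the characteristic function only through the phase
  \<open>iexp (t * S l j / s (l + d))\<close>, which tends to 1 as \<open>s\<close> grows. Every
  block thus has the same limit law, and the sub-Gaussian bounds transfer its moments.\<close>

lemma block_moment_tendsto:
  assumes S: "signed_tree a S" and j: "j < 2 ^ l" and r: "0 < r"
    and s: "\<And>n. s n = sqrt (\<Sum>m<n. (a m)\<^sup>2)" and s_top: "filterlim s at_top sequentially"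
    and M: "real_distribution M" and int_M: "integrable M (\<lambda>x. \<bar>x\<bar> powr (r + 1))"
    and cos_prod: "\<And>t. (\<lambda>d. \<Prod>m\<in>{l..<l + d}. complex_of_real (cos (t * a m / s (l + d)))) \<longlonglongrightarrow> char M t"
  shows "(\<lambda>d. (\<Sum>k\<in>dyadic_block j d. \<bar>S (l + d) k / s (l + d)\<bar> powr r) / 2 ^ d)
    \<longlonglongrightarrow> integral\<^sup>L M (\<lambda>x. \<bar>x\<bar> powr r)"
proof -
  have "eventually (\<lambda>n. 0 < s n) sequentially"
    using s_top by (simp add: filterlim_at_top_dense)
  then obtain n0 where n0: "\<And>n. n \<ge> n0 \<Longrightarrow> 0 < s n"
    by (auto simp: eventually_sequentially)
  have s_shift: "filterlim (\<lambda>d. s (l + d)) at_top sequentially"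
    using filterlim_compose[OF s_top filterlim_add_const_nat_at_top[of l]] by (simp add: add.commute)
  \<comment> \<open>The shift makes the normalisation positive for every index, so that the moment
    bound holds along the entire sequence.\<close>
  define \<mu> where "\<mu> d = block_law S s l j (d + n0)" for d
  have \<mu>: "real_distribution (\<mu> d)" for d
    unfolding \<mu>_def by (rule real_distribution_block_law)
  have char_eq: "char (block_law S s l j d) t = iexp (t * S l j / s (l + d)) *
      (\<Prod>m\<in>{l..<l + d}. complex_of_real (cos (t * a m / s (l + d))))" for d t
  proof -
    have "char (block_law S s l j d) t = (1 / 2 ^ d) *\<^sub>R (\<Sum>k\<in>dyadic_block j d. iexp (t * (S (l + d) k / s (l + d))))"
      unfolding char_def by (rule integral_block_law(1)) measurable
    also have "(\<Sum>k\<in>dyadic_block j d. iexp (t * (S (l + d) k / s (l + d)))) = (\<Sum>k\<in>dyadic_block j d. iexp (t / s (l + d) * S (l + d) k))"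
      by simp
    also have "\<dots> = 2 ^ d * iexp (t / s (l + d) * S l j) * (\<Prod>m\<in>{l..<l + d}. complex_of_real (cos (t / s (l + d) * a m)))"
      by (rule signed_tree_block_sum_iexp[OF S j])
    finally show ?thesis
      by (simp add: scaleR_conv_of_real)
  qed
  have "(\<lambda>d. char (block_law S s l j d) t) \<longlonglongrightarrow> iexp 0 * char M t" for t
    unfolding char_eq
  proof (intro tendsto_mult cos_prod)
    have "(\<lambda>d. t * S l j / s (l + d)) \<longlonglongrightarrow> 0"
      by (rule real_tendsto_divide_at_top[OF tendsto_const s_shift])
    then show "(\<lambda>d. iexp (t * S l j / s (l + d))) \<longlonglongrightarrow> iexp 0"
      by (rule isCont_tendsto_compose[OF isCont_iexp])
  qed
  then have "(\<lambda>d. char (block_law S s l j d) t) \<longlonglongrightarrow> char M t" for t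
    by simp
  then have "(\<lambda>d. char (\<mu> d) t) \<longlonglongrightarrow> char M t" for t
    unfolding \<mu>_def by (rule LIMSEQ_ignore_initial_segment)
  from levy_continuity[OF \<mu> M this] have weak: "weak_conv_m \<mu> M" .
  \<comment> \<open>A block holds only the share 2^-l of the leaves; bounding its sum by that of the
    whole level costs the factor \<open>2 ^ l\<close>.\<close>
  define C where "C = 2 ^ l * (2 * (r + 2) powr (r + 1) * exp (1/2))"
  have "integral\<^sup>L (\<mu> d) (\<lambda>x. \<bar>x\<bar> powr (r + 1)) \<le> C" for d
  proof -
    define n where "n = l + (d + n0)"
    have "0 < s n" using n0[of n] by (simp add: n_def)
    then have pos: "0 < (\<Sum>m<n. (a m)\<^sup>2)" by (simp add: s)
    have "dyadic_block j (d + n0) \<subseteq> {..<2 ^ n}"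
      using dyadic_block_less[OF j, of _ "d + n0"] by (auto simp: n_def)
    then have "(\<Sum>k\<in>dyadic_block j (d + n0). \<bar>S n k / s n\<bar> powr (r + 1)) \<le> (\<Sum>k<2 ^ n. \<bar>S n k / s n\<bar> powr (r + 1))"
      by (intro sum_mono2) auto
    also have "\<dots> \<le> 2 ^ n * (2 * (r + 1 + 1) powr (r + 1) * exp (1/2))"
      unfolding s by (rule signed_tree_moment_bound[OF S _ pos]) (use r in simp)
    also have "\<dots> = 2 ^ (d + n0) * C"
      by (simp add: C_def n_def power_add mult_ac add.assoc)
    finally show ?thesis
      unfolding \<mu>_def by (subst integral_block_law(1)) (simp_all add: n_def field_simps)
  qed
  from weak_conv_moment_tendsto[OF \<mu> M weak r _ this int_M]
  have "(\<lambda>d. integral\<^sup>L (\<mu> d) (\<lambda>x. \<bar>x\<bar> powr r)) \<longlonglongrightarrow> integral\<^sup>L M (\<lambda>x. \<bar>x\<bar> powr r)"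
    unfolding \<mu>_def by (simp add: integral_block_law(2))
  then have "(\<lambda>d. integral\<^sup>L (block_law S s l j d) (\<lambda>x. \<bar>x\<bar> powr r)) \<longlonglongrightarrow> integral\<^sup>L M (\<lambda>x. \<bar>x\<bar> powr r)"
    unfolding \<mu>_def by (rule LIMSEQ_offset)
  then show ?thesis
    by (subst (asm) integral_block_law(1)) simp_all
qed

section \<open>Products of cosines and growth\<close>

lemma one_minus_cos_le: "\<bar>1 - cos u\<bar> \<le> u\<^sup>2 / 2" for u :: real
proof -
  have "1 - cos u = 2 * (sin (u / 2))\<^sup>2"
    using cos_double_sin[of "u / 2"] by simp
  moreover have "(sin (u / 2))\<^sup>2 \<le> (u / 2)\<^sup>2"
    using abs_sin_x_le_abs_x[of "u / 2"] by (simp only: abs_le_square_iff)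
  ultimately show ?thesis
    by (simp add: power_divide)
qed

text \<open>Both functions agree with 1 - u^2/2 up to order four, with errors u^4/24 and
  u^4/8.\<close>

lemma cos_exp_approx: "\<bar>cos u - exp (- (u\<^sup>2 / 2))\<bar> \<le> u ^ 4" for u :: real
proof -
  have sum: "(\<Sum>k\<le>3. (\<i> * complex_of_real u) ^ k / fact k) = 1 + \<i> * u - u\<^sup>2 / 2 - \<i> * u ^ 3 / 6"
    by (simp add: numeral_eq_Suc fact_numeral power_mult_distrib)
  have "\<bar>Re (iexp u - (\<Sum>k\<le>3. (\<i> * complex_of_real u) ^ k / fact k))\<bar> \<le> \<bar>u\<bar> ^ Suc 3 / fact (Suc 3)"
    using iexp_approx1[of u 3] abs_Re_le_cmod order_trans by blast
  also have "Re (iexp u - (\<Sum>k\<le>3. (\<i> * complex_of_real u) ^ k / fact k)) = cos u - (1 - u\<^sup>2 / 2)"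
    unfolding sum by (simp add: Re_exp flip: of_real_power)
  finally have 1: "\<bar>cos u - (1 - u\<^sup>2 / 2)\<bar> \<le> u ^ 4 / 24"
    by (simp add: fact_numeral power_even_abs)
  define v where "v = u\<^sup>2 / 2"
  have v: "0 \<le> v" by (simp add: v_def)
  have "1 - v \<le> exp (- v)"
    using exp_ge_add_one_self[of "- v"] by simp
  moreover have "exp (- v) \<le> 1 - v + v\<^sup>2 / 2"
  proof -
    \<comment> \<open>The product equals 1 + v^4/4.\<close>
    have "1 \<le> (1 - v + v\<^sup>2 / 2) * (1 + v + v\<^sup>2 / 2)"
      using v by (simp add: power2_eq_square algebra_simps)
    also have "\<dots> \<le> (1 - v + v\<^sup>2 / 2) * exp v"
    proof (intro mult_left_mono exp_lower_Taylor_quadratic v)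
      have "0 \<le> (1 - v)\<^sup>2 / 2 + 1/2" by simp
      also have "\<dots> = 1 - v + v\<^sup>2 / 2" by (simp add: power2_eq_square field_simps)
      finally show "0 \<le> 1 - v + v\<^sup>2 / 2" .
    qed
    finally show ?thesis by (simp add: exp_minus field_simps)
  qed
  ultimately have 2: "\<bar>exp (- v) - (1 - v)\<bar> \<le> v\<^sup>2 / 2" by simp
  have "v\<^sup>2 / 2 = u ^ 4 / 8" by (simp add: v_def power2_eq_square power4_eq_xxxx)
  moreover have "0 \<le> u ^ 4" by simp
  ultimately show ?thesis using 1 2 unfolding v_def by linarith
qed

text \<open>The central limit theorem under Lyapunov's condition. The ratio tending to 1 says that
  \<open>(a n) ^ 2\<close> is negligible against \<open>s2 n\<close>, and so the quotient
  \<open>Q\<close> of the fourth powers and the squared variance vanishes. A finite initial piece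
  \<open>K\<close> is lost against the growing denominator.\<close>

lemma prod_cos_tendsto_gaussian:
  fixes a s2 :: "nat \<Rightarrow> real" and t :: real
  assumes s2: "\<And>n. s2 n = (\<Sum>m<n. (a m)\<^sup>2)" and top: "filterlim s2 at_top sequentially"
    and ratio: "(\<lambda>n. s2 (Suc n) / s2 n) \<longlonglongrightarrow> 1"
  shows "(\<lambda>n. \<Prod>m\<in>{l..<n}. cos (t * a m / sqrt (s2 n))) \<longlonglongrightarrow> exp (- (t\<^sup>2 / 2))"
proof -
  have s2_nonneg: "0 \<le> s2 n" for n by (simp add: s2 sum_nonneg)
  have s2_mono: "m \<le> n \<Longrightarrow> s2 m \<le> s2 n" for m n
    unfolding s2 by (intro sum_mono2) auto
  have pos: "eventually (\<lambda>n. 0 < s2 n) sequentially"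
    using top by (simp add: filterlim_at_top_dense)
  define Q where "Q n = (\<Sum>m<n. (a m) ^ 4) / (s2 n)\<^sup>2" for n
  have Q: "Q \<longlonglongrightarrow> 0"
  proof (rule LIMSEQ_I)
    fix e :: real assume e: "0 < e"
    have "eventually (\<lambda>n. s2 (Suc n) / s2 n < 1 + e / 2) sequentially"
      using ratio by (rule order_tendstoD) (use e in simp)
    with pos have "eventually (\<lambda>n. 0 < s2 n \<and> (a n)\<^sup>2 \<le> e / 2 * s2 n) sequentially"
    proof eventually_elim
      case (elim n)
      then show ?case by (simp add: s2 field_simps)
    qed
    then obtain N where N: "\<And>n. n \<ge> N \<Longrightarrow> 0 < s2 n \<and> (a n)\<^sup>2 \<le> e / 2 * s2 n"
      by (auto simp: eventually_sequentially)
    define K where "K = (\<Sum>m<N. (a m) ^ 4)"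
    have s2sq: "filterlim (\<lambda>n. s2 n * s2 n) at_top sequentially"
      by (rule filterlim_at_top_mult_at_top[OF top top])
    have "(\<lambda>n. K / (s2 n * s2 n)) \<longlonglongrightarrow> 0"
      by (rule real_tendsto_divide_at_top[OF tendsto_const s2sq])
    then have "eventually (\<lambda>n. K / (s2 n * s2 n) < e / 2) sequentially"
      by (rule order_tendstoD) (use e in simp)
    with eventually_ge_at_top[of N] have "eventually (\<lambda>n. norm (Q n - 0) < e) sequentially"
    proof eventually_elim
      case (elim n)
      have "(\<Sum>m<n. (a m) ^ 4) = K + (\<Sum>m\<in>{N..<n}. (a m) ^ 4)"
        unfolding K_def lessThan_atLeast0 by (rule sum.atLeastLessThan_concat[symmetric]) (use elim in auto)
      also have "(\<Sum>m\<in>{N..<n}. (a m) ^ 4) \<le> (\<Sum>m\<in>{N..<n}. e / 2 * s2 n * (a m)\<^sup>2)"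
      proof (rule sum_mono)
        fix m assume m: "m \<in> {N..<n}"
        have "(a m)\<^sup>2 \<le> e / 2 * s2 n"
        proof -
          have "(a m)\<^sup>2 \<le> e / 2 * s2 m" using N[of m] m by simp
          also have "\<dots> \<le> e / 2 * s2 n" using m e by (intro mult_left_mono s2_mono) auto
          finally show ?thesis .
        qed
        then have "(a m)\<^sup>2 * (a m)\<^sup>2 \<le> e / 2 * s2 n * (a m)\<^sup>2"
          by (intro mult_right_mono) auto
        then show "(a m) ^ 4 \<le> e / 2 * s2 n * (a m)\<^sup>2"
          by (simp add: power2_eq_square power4_eq_xxxx mult_ac)
      qed
      also have "\<dots> = e / 2 * s2 n * (\<Sum>m\<in>{N..<n}. (a m)\<^sup>2)"
        by (simp add: sum_distrib_left)
      also have "\<dots> \<le> e / 2 * s2 n * s2 n"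
        using e s2_nonneg[of n] unfolding s2[of n] by (intro mult_left_mono sum_mono2) auto
      finally have "(\<Sum>m<n. (a m) ^ 4) \<le> K + e / 2 * (s2 n * s2 n)" by simp
      moreover have sn: "0 < s2 n * s2 n" using N[of n] elim by simp
      ultimately have "Q n \<le> (K + e / 2 * (s2 n * s2 n)) / (s2 n * s2 n)"
        unfolding Q_def power2_eq_square by (intro divide_right_mono) auto
      also have "\<dots> = K / (s2 n * s2 n) + e / 2"
        using less_imp_neq[OF sn, symmetric] by (simp only: add_divide_distrib nonzero_mult_div_cancel_right not_False_eq_True)
      finally have "Q n < e" using elim by linarith
      moreover have "0 \<le> Q n" by (simp add: Q_def sum_nonneg)
      ultimately show ?case by simp
    qed
    then show "\<exists>no. \<forall>n\<ge>no. norm (Q n - 0) < e"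
      by (simp add: eventually_sequentially)
  qed
  have "(\<lambda>n. t ^ 4 * Q n) \<longlonglongrightarrow> 0"
    using Q by (rule tendsto_mult_right_zero)
  \<comment> \<open>All factors have modulus at most 1, so the products differ by at most the sum of
    the differences of their factors. The exponent lacks the share of \<open>s2 l\<close> because
    the product starts at \<open>l\<close>.\<close>
  moreover have "eventually (\<lambda>n. norm ((\<Prod>m\<in>{l..<n}. cos (t * a m / sqrt (s2 n))) - exp (- (t\<^sup>2 / 2 * (1 - s2 l / s2 n)))) \<le> t ^ 4 * Q n) sequentially"
    using pos eventually_ge_at_top[of l]
  proof eventually_elim
    case (elim n)
    have expp: "exp (- (t\<^sup>2 / 2 * (1 - s2 l / s2 n))) = (\<Prod>m\<in>{l..<n}. exp (- ((t * a m / sqrt (s2 n))\<^sup>2 / 2)))"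
    proof -
      have "s2 n = s2 l + (\<Sum>m\<in>{l..<n}. (a m)\<^sup>2)"
        unfolding s2 lessThan_atLeast0 by (rule sum.atLeastLessThan_concat[symmetric]) (use elim in auto)
      then have "t\<^sup>2 / 2 * (1 - s2 l / s2 n) = t\<^sup>2 / 2 * ((\<Sum>m\<in>{l..<n}. (a m)\<^sup>2) / s2 n)"
        using elim by (simp add: field_simps)
      also have "\<dots> = (\<Sum>m\<in>{l..<n}. (t * a m / sqrt (s2 n))\<^sup>2 / 2)"
        using elim by (simp add: sum_distrib_left sum_divide_distrib power_divide power_mult_distrib mult.commute)
      finally show ?thesis by (simp add: exp_sum sum_negf[symmetric])
    qed
    have "norm ((\<Prod>m\<in>{l..<n}. cos (t * a m / sqrt (s2 n))) - exp (- (t\<^sup>2 / 2 * (1 - s2 l / s2 n))))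
        \<le> (\<Sum>m\<in>{l..<n}. norm (cos (t * a m / sqrt (s2 n)) - exp (- ((t * a m / sqrt (s2 n))\<^sup>2 / 2))))"
      unfolding expp by (rule norm_prod_diff) auto
    also have "\<dots> \<le> (\<Sum>m\<in>{l..<n}. (t * a m / sqrt (s2 n)) ^ 4)"
      by (intro sum_mono) (simp only: real_norm_def cos_exp_approx)
    also have "\<dots> \<le> (\<Sum>m<n. (t * a m / sqrt (s2 n)) ^ 4)"
      by (intro sum_mono2) auto
    also have "\<dots> = t ^ 4 * Q n"
    proof -
      have "sqrt (s2 n) ^ 4 = (s2 n)\<^sup>2"
        using elim by (simp add: power4_eq_xxxx power2_eq_square mult.assoc)
      then show ?thesis
        by (simp add: Q_def power_divide power_mult_distrib sum_distrib_left sum_divide_distrib)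
    qed
    finally show ?case .
  qed
  ultimately have "(\<lambda>n. (\<Prod>m\<in>{l..<n}. cos (t * a m / sqrt (s2 n))) - exp (- (t\<^sup>2 / 2 * (1 - s2 l / s2 n)))) \<longlonglongrightarrow> 0"
    by (rule Lim_null_comparison[rotated])
  moreover have "(\<lambda>n. exp (- (t\<^sup>2 / 2 * (1 - s2 l / s2 n)))) \<longlonglongrightarrow> exp (- (t\<^sup>2 / 2 * (1 - 0)))"
    by (intro tendsto_intros real_tendsto_divide_at_top[OF tendsto_const top])
  ultimately show ?thesis
    using tendsto_add by fastforce
qed

text \<open>The last J normalised weights, read backwards, converge in modulus to
  \<open>b 0\<close>, ..., \<open>b (J - 1)\<close>. All earlier cosines together differ from 1 by
  at most t^2/2 times \<open>s2 n / s2 (n + J)\<close>, whose limit \<kappa>^-J is made small by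
  choosing J before n. The signs of \<open>a\<close> are invisible to the cosine, so limits of
  squares suffice.\<close>

lemma prod_cos_tendsto_geometric:
  fixes a s2 b :: "nat \<Rightarrow> real" and t \<kappa> L :: real
  assumes s2: "\<And>n. s2 n = (\<Sum>m<n. (a m)\<^sup>2)" and pos: "eventually (\<lambda>n. 0 < s2 n) sequentially"
    and ratio: "(\<lambda>n. s2 (Suc n) / s2 n) \<longlonglongrightarrow> \<kappa>" and \<kappa>: "1 < \<kappa>"
    and b: "\<And>j. 0 \<le> b j" "\<And>j. (b j)\<^sup>2 = (\<kappa> - 1) / \<kappa> ^ Suc j"
    and lim: "(\<lambda>J. \<Prod>j<J. cos (t * b j)) \<longlonglongrightarrow> L"
  shows "(\<lambda>n. \<Prod>m\<in>{l..<n}. cos (t * a m / sqrt (s2 n))) \<longlonglongrightarrow> L"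
proof -
  have s2_nonneg: "0 \<le> s2 n" for n by (simp add: s2 sum_nonneg)
  from pos obtain n0 where n0: "\<And>n. n \<ge> n0 \<Longrightarrow> 0 < s2 n"
    by (auto simp: eventually_sequentially)
  have shift: "(\<lambda>n. s2 n / s2 (n + J)) \<longlonglongrightarrow> 1 / \<kappa> ^ J" for J
  proof (induction J)
    case 0
    have "eventually (\<lambda>n. s2 n / s2 (n + 0) = 1) sequentially"
      using pos by eventually_elim simp
    then show ?case by (simp add: tendsto_eventually)
  next
    case (Suc J)
    have "(\<lambda>n. s2 (Suc (n + J)) / s2 (n + J)) \<longlonglongrightarrow> \<kappa>"
      using LIMSEQ_ignore_initial_segment[OF ratio, of J] by simp
    then have "(\<lambda>n. s2 n / s2 (n + J) / (s2 (Suc (n + J)) / s2 (n + J))) \<longlonglongrightarrow> 1 / \<kappa> ^ J / \<kappa>"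
      using \<kappa> by (intro tendsto_divide Suc.IH) auto
    moreover have "eventually (\<lambda>n. s2 n / s2 (n + J) / (s2 (Suc (n + J)) / s2 (n + J)) = s2 n / s2 (n + Suc J)) sequentially"
      using eventually_ge_at_top[of n0]
    proof eventually_elim
      case (elim n)
      then show ?case using n0[of "n + J"] by simp
    qed
    ultimately have "(\<lambda>n. s2 n / s2 (n + Suc J)) \<longlonglongrightarrow> 1 / \<kappa> ^ J / \<kappa>"
      by (rule Lim_transform_eventually)
    then show ?case by (simp add: mult.commute)
  qed
  have factor: "(\<lambda>n. cos (t * a (n + i) / sqrt (s2 (n + J)))) \<longlonglongrightarrow> cos (t * b (J - Suc i))" if i: "i < J" for i J
  proof -
    obtain k where J: "J = Suc (i + k)" using i less_iff_Suc_add by auto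
    have "(\<lambda>n. s2 (Suc (n + i)) / s2 (Suc (n + i) + k) - s2 (n + i) / s2 (n + i + Suc k)) \<longlonglongrightarrow> 1 / \<kappa> ^ k - 1 / \<kappa> ^ Suc k"
      using LIMSEQ_ignore_initial_segment[OF shift[of k], of "Suc i"] LIMSEQ_ignore_initial_segment[OF shift[of "Suc k"], of i]
      by (intro tendsto_diff) simp_all
    \<comment> \<open>Both quotients have the denominator \<open>s2 (n + J)\<close>, and their
      numerators are consecutive partial sums, so the difference isolates one squared
      coefficient.\<close>
    moreover have "s2 (Suc (n + i)) / s2 (Suc (n + i) + k) - s2 (n + i) / s2 (n + i + Suc k) = (a (n + i))\<^sup>2 / s2 (n + J)" for n
      by (simp add: J s2[of "Suc (n + i)"] s2[of "n + i"] add_divide_distrib add.assoc)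
    moreover have "1 / \<kappa> ^ k - 1 / \<kappa> ^ Suc k = (b (J - Suc i))\<^sup>2"
      using \<kappa> by (simp add: b J field_simps)
    ultimately have "(\<lambda>n. (a (n + i))\<^sup>2 / s2 (n + J)) \<longlonglongrightarrow> (b (J - Suc i))\<^sup>2"
      by simp
    then have "(\<lambda>n. cos (\<bar>t\<bar> * sqrt ((a (n + i))\<^sup>2 / s2 (n + J)))) \<longlonglongrightarrow> cos (\<bar>t\<bar> * sqrt ((b (J - Suc i))\<^sup>2))"
      by (intro tendsto_intros)
    moreover have "cos (\<bar>t\<bar> * sqrt ((a (n + i))\<^sup>2 / s2 (n + J))) = cos (t * a (n + i) / sqrt (s2 (n + J)))" for n
    proof -
      have "\<bar>t\<bar> * sqrt ((a (n + i))\<^sup>2 / s2 (n + J)) = \<bar>t * a (n + i) / sqrt (s2 (n + J))\<bar>"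
        using s2_nonneg[of "n + J"] by (simp add: real_sqrt_divide abs_mult)
      then show ?thesis by (simp only: cos_abs_real)
    qed
    moreover have "cos (\<bar>t\<bar> * sqrt ((b (J - Suc i))\<^sup>2)) = cos (t * b (J - Suc i))"
    proof -
      have "\<bar>t\<bar> * sqrt ((b (J - Suc i))\<^sup>2) = \<bar>t * b (J - Suc i)\<bar>"
        using b(1)[of "J - Suc i"] by (simp add: abs_mult)
      then show ?thesis by (simp only: cos_abs_real)
    qed
    ultimately show ?thesis by simp
  qed
  show ?thesis
  proof (rule tendstoI)
    fix e :: real assume e: "0 < e"
    have "(\<lambda>J. t\<^sup>2 / 2 * (1 / \<kappa> ^ J)) \<longlonglongrightarrow> t\<^sup>2 / 2 * 0"
      using \<kappa> by (intro tendsto_mult tendsto_const LIMSEQ_inverse_realpow_zero[unfolded inverse_eq_divide])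
    then have "eventually (\<lambda>J. t\<^sup>2 / 2 * (1 / \<kappa> ^ J) < e / 3) sequentially"
      by (rule order_tendstoD) (use e in simp)
    moreover have "eventually (\<lambda>J. dist (\<Prod>j<J. cos (t * b j)) L < e / 3) sequentially"
      using lim by (rule tendstoD) (use e in simp)
    ultimately have "eventually (\<lambda>J. t\<^sup>2 / 2 * (1 / \<kappa> ^ J) < e / 3 \<and> dist (\<Prod>j<J. cos (t * b j)) L < e / 3) sequentially"
      by (rule eventually_conj)
    then obtain J where J: "t\<^sup>2 / 2 * (1 / \<kappa> ^ J) < e / 3" "dist (\<Prod>j<J. cos (t * b j)) L < e / 3"
      by (auto simp: eventually_sequentially)
    have "(\<lambda>n. \<Prod>i<J. cos (t * a (n + i) / sqrt (s2 (n + J)))) \<longlonglongrightarrow> (\<Prod>i<J. cos (t * b (J - Suc i)))"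
      by (intro tendsto_prod factor) simp
    also have "(\<Prod>i<J. cos (t * b (J - Suc i))) = (\<Prod>j<J. cos (t * b j))"
      by (rule prod.nat_diff_reindex)
    finally have "eventually (\<lambda>n. dist (\<Prod>i<J. cos (t * a (n + i) / sqrt (s2 (n + J)))) (\<Prod>j<J. cos (t * b j)) < e / 3) sequentially"
      by (rule tendstoD) (use e in simp)
    moreover have "eventually (\<lambda>n. t\<^sup>2 / 2 * (s2 n / s2 (n + J)) < e / 3) sequentially"
      by (rule order_tendstoD(2)[OF tendsto_mult[OF tendsto_const shift] J(1)])
    ultimately have "eventually (\<lambda>n. dist (\<Prod>m\<in>{l..<n + J}. cos (t * a m / sqrt (s2 (n + J)))) L < e) sequentially"
      using eventually_ge_at_top[of "max l n0"]
    proof eventually_elim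
      case (elim n)
      define u where "u m = t * a m / sqrt (s2 (n + J))" for m
      have sp: "0 < s2 (n + J)" using n0[of "n + J"] elim by simp
      have split: "(\<Prod>m\<in>{l..<n + J}. cos (u m)) = (\<Prod>m\<in>{l..<n}. cos (u m)) * (\<Prod>i<J. cos (u (n + i)))"
      proof -
        have "(\<Prod>m\<in>{l..<n + J}. cos (u m)) = (\<Prod>m\<in>{l..<n}. cos (u m)) * (\<Prod>m\<in>{n..<n + J}. cos (u m))"
          using elim by (intro prod.atLeastLessThan_concat[symmetric]) auto
        also have "(\<Prod>m\<in>{n..<n + J}. cos (u m)) = (\<Prod>i<J. cos (u (n + i)))"
          using prod.shift_bounds_nat_ivl[of "\<lambda>m. cos (u m)" 0 n J] by (simp add: lessThan_atLeast0 add.commute)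
        finally show ?thesis .
      qed
      have "\<bar>(\<Prod>m\<in>{l..<n}. cos (u m)) - (\<Prod>m\<in>{l..<n}. 1)\<bar> \<le> (\<Sum>m\<in>{l..<n}. norm (cos (u m) - 1))"
        unfolding real_norm_def[symmetric] by (rule norm_prod_diff) auto
      also have "\<dots> \<le> (\<Sum>m\<in>{l..<n}. (u m)\<^sup>2 / 2)"
        using one_minus_cos_le by (intro sum_mono) (simp add: abs_minus_commute)
      also have "\<dots> \<le> (\<Sum>m<n. (u m)\<^sup>2 / 2)"
        by (intro sum_mono2) auto
      also have "\<dots> = t\<^sup>2 / 2 * (s2 n / s2 (n + J))"
        using sp by (simp add: u_def s2[of n] power_divide power_mult_distrib sum_distrib_left sum_divide_distrib mult.commute)
      finally have 1: "\<bar>(\<Prod>m\<in>{l..<n}. cos (u m)) - 1\<bar> < e / 3"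
        using elim by simp
      have 2: "\<bar>\<Prod>i<J. cos (u (n + i))\<bar> \<le> 1"
        unfolding abs_prod by (intro prod_le_1) auto
      have "(\<Prod>m\<in>{l..<n + J}. cos (u m)) - (\<Prod>i<J. cos (u (n + i))) = ((\<Prod>m\<in>{l..<n}. cos (u m)) - 1) * (\<Prod>i<J. cos (u (n + i)))"
        unfolding split left_diff_distrib by simp
      then have "\<bar>(\<Prod>m\<in>{l..<n + J}. cos (u m)) - (\<Prod>i<J. cos (u (n + i)))\<bar> \<le> \<bar>(\<Prod>m\<in>{l..<n}. cos (u m)) - 1\<bar>"
        using mult_left_mono[OF 2, of "\<bar>(\<Prod>m\<in>{l..<n}. cos (u m)) - 1\<bar>"] by (simp only: abs_mult abs_ge_zero mult_1_right)
      moreover have "\<bar>x - 1\<bar> < e / 3 \<Longrightarrow> \<bar>y - z\<bar> < e / 3 \<Longrightarrow> \<bar>z - L\<bar> < e / 3 \<Longrightarrow> \<bar>w - y\<bar> \<le> \<bar>x - 1\<bar> \<Longrightarrow> \<bar>w - L\<bar> < e"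
        for x y z w :: real by linarith
      ultimately show ?case
        using 1 elim(1) J(2) unfolding u_def dist_real_def by blast
    qed
    then show "eventually (\<lambda>n. dist (\<Prod>m\<in>{l..<n}. cos (t * a m / sqrt (s2 n))) L < e) sequentially"
      by (subst (asm) eventually_sequentially_seg[of "\<lambda>n. dist (\<Prod>m\<in>{l..<n}. cos (t * a m / sqrt (s2 n))) L < e"])
  qed
qed

text \<open>The multiplier (n + 1) / n changes with n, so the estimate uniform over multipliers in
  [1, 2] is used.\<close>

lemma regularly_varying_Suc_ratio:
  assumes g: "regularly_varying g \<rho>"
  shows "(\<lambda>n. g (real (Suc n)) / g (real n)) \<longlonglongrightarrow> 1"
proof -
  have gp: "0 < g (real n)" for n using regularly_varying_pos[OF g] by simp
  have "(\<lambda>n. ln (g (real (Suc n))) - ln (g (real n)) - \<rho> * ln (real (Suc n) / real n)) \<longlonglongrightarrow> 0"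
  proof (rule LIMSEQ_I)
    fix e :: real assume "0 < e"
    then have "0 < e / 2" by simp
    from regularly_varying_uniform[OF g this] obtain X where X: "1 \<le> X"
      "\<And>x l. X \<le> x \<Longrightarrow> 1 \<le> l \<Longrightarrow> l \<le> 2 \<Longrightarrow> \<bar>ln (g (l * x)) - ln (g x) - \<rho> * ln l\<bar> \<le> e / 2"
      by metis
    obtain N :: nat where N: "X \<le> real N" using real_arch_simple by blast
    show "\<exists>no. \<forall>n\<ge>no. norm (ln (g (real (Suc n))) - ln (g (real n)) - \<rho> * ln (real (Suc n) / real n) - 0) < e"
    proof (intro exI allI impI)
      fix n assume n: "N \<le> n"
      then have Xn: "X \<le> real n" "1 \<le> real n" using N X(1) by linarith+
      have "\<bar>ln (g (real (Suc n) / real n * real n)) - ln (g (real n)) - \<rho> * ln (real (Suc n) / real n)\<bar> \<le> e / 2"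
        using Xn by (intro X(2)) (simp_all add: field_simps)
      with Xn \<open>0 < e\<close> show "norm (ln (g (real (Suc n))) - ln (g (real n)) - \<rho> * ln (real (Suc n) / real n) - 0) < e"
        by simp
    qed
  qed
  moreover have "(\<lambda>n. \<rho> * ln (real (Suc n) / real n)) \<longlonglongrightarrow> \<rho> * ln 1"
    by (intro tendsto_intros LIMSEQ_Suc_n_over_n) simp
  ultimately have "(\<lambda>n. ln (g (real (Suc n))) - ln (g (real n)) - \<rho> * ln (real (Suc n) / real n) + \<rho> * ln (real (Suc n) / real n)) \<longlonglongrightarrow> 0 + \<rho> * ln 1"
    by (rule tendsto_add)
  then have "(\<lambda>n. exp (ln (g (real (Suc n))) - ln (g (real n)))) \<longlonglongrightarrow> exp 0"
    by (intro tendsto_exp) simp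
  moreover have "exp (ln (g (real (Suc n))) - ln (g (real n))) = g (real (Suc n)) / g (real n)" for n
    using gp[of n] gp[of "Suc n"] by (simp only: exp_diff exp_ln)
  ultimately show ?thesis by simp
qed

text \<open>ln g(n) is of order at most ln n and hence o(n), so the exponential rate decides
  whatever the power of \<open>g\<close>.\<close>

lemma regularly_varying_times_exp:
  assumes g: "regularly_varying g \<rho>"
  shows "0 < \<delta> \<Longrightarrow> filterlim (\<lambda>n. 2 powr (\<delta> * real n) * g (real n) powr c) at_top sequentially"
    and "\<delta> < 0 \<Longrightarrow> (\<lambda>n. 2 powr (\<delta> * real n) * g (real n) powr c) \<longlonglongrightarrow> 0"
proof -
  have gp: "0 < g (real n)" for n using regularly_varying_pos[OF g] by simp
  have eq: "2 powr (\<delta> * real n) * g (real n) powr c = exp (\<delta> * real n * ln 2 + c * ln (g (real n)))" for n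
    using gp[of n] by (simp add: powr_def exp_add)
  have "(\<lambda>n. ln (g (real n)) / ln (real n)) \<longlonglongrightarrow> \<rho>"
    by (rule filterlim_compose[OF regularly_varying_ln_over_ln[OF g] filterlim_real_sequentially])
  then have "(\<lambda>n. \<delta> * ln 2 + c * (ln (g (real n)) / ln (real n) * (ln (real n) / real n))) \<longlonglongrightarrow> \<delta> * ln 2 + c * (\<rho> * 0)"
    by (intro tendsto_intros lim_ln_over_n)
  then have lim: "(\<lambda>n. \<delta> * ln 2 + c * (ln (g (real n)) / ln (real n) * (ln (real n) / real n))) \<longlonglongrightarrow> \<delta> * ln 2"
    by simp
  have ev: "eventually (\<lambda>n. (\<delta> * ln 2 + c * (ln (g (real n)) / ln (real n) * (ln (real n) / real n))) * real n
      = \<delta> * real n * ln 2 + c * ln (g (real n))) sequentially"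
    using eventually_gt_at_top[of 1]
  proof eventually_elim
    case (elim n)
    then have "ln (real n) \<noteq> 0" "real n \<noteq> 0" by auto
    then show ?case by (simp add: field_simps)
  qed
  show "filterlim (\<lambda>n. 2 powr (\<delta> * real n) * g (real n) powr c) at_top sequentially" if "0 < \<delta>"
  proof -
    have "filterlim (\<lambda>n. (\<delta> * ln 2 + c * (ln (g (real n)) / ln (real n) * (ln (real n) / real n))) * real n) at_top sequentially"
      by (rule filterlim_tendsto_pos_mult_at_top[OF lim _ filterlim_real_sequentially]) (use that in simp)
    then have "filterlim (\<lambda>n. \<delta> * real n * ln 2 + c * ln (g (real n))) at_top sequentially"
      by (rule filterlim_cong[THEN iffD1, OF refl refl ev])
    then show ?thesis
      unfolding eq by (rule filterlim_compose[OF exp_at_top])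
  qed
  show "(\<lambda>n. 2 powr (\<delta> * real n) * g (real n) powr c) \<longlonglongrightarrow> 0" if "\<delta> < 0"
  proof -
    have "filterlim (\<lambda>n. (\<delta> * ln 2 + c * (ln (g (real n)) / ln (real n) * (ln (real n) / real n))) * real n) at_bot sequentially"
      by (rule filterlim_tendsto_neg_mult_at_bot[OF lim _ filterlim_real_sequentially]) (use that in \<open>simp add: mult_neg_pos\<close>)
    then have "filterlim (\<lambda>n. \<delta> * real n * ln 2 + c * ln (g (real n))) at_bot sequentially"
      by (rule filterlim_cong[THEN iffD1, OF refl refl ev])
    then show ?thesis
      unfolding eq by (rule filterlim_compose[OF exp_at_bot])
  qed
qed

lemma regularly_varying_limit:
  assumes g: "regularly_varying g \<rho>"
  shows "0 < \<rho> \<Longrightarrow> filterlim (\<lambda>n. g (real n)) at_top sequentially"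
    and "\<rho> < 0 \<Longrightarrow> (\<lambda>n. g (real n)) \<longlonglongrightarrow> 0"
proof -
  have "0 < g (real n)" for n using regularly_varying_pos[OF g] by simp
  then have eq: "g (real n) = exp (ln (g (real n)))" for n by simp
  have lim: "(\<lambda>n. ln (g (real n)) / ln (real n)) \<longlonglongrightarrow> \<rho>"
    by (rule filterlim_compose[OF regularly_varying_ln_over_ln[OF g] filterlim_real_sequentially])
  have ln_top: "filterlim (\<lambda>n. ln (real n)) at_top sequentially"
    by (rule filterlim_compose[OF ln_at_top filterlim_real_sequentially])
  have ev: "eventually (\<lambda>n. ln (g (real n)) / ln (real n) * ln (real n) = ln (g (real n))) sequentially"
    using eventually_gt_at_top[of 1] by eventually_elim simp
  show "filterlim (\<lambda>n. g (real n)) at_top sequentially" if "0 < \<rho>"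
  proof -
    have "filterlim (\<lambda>n. ln (g (real n)) / ln (real n) * ln (real n)) at_top sequentially"
      by (rule filterlim_tendsto_pos_mult_at_top[OF lim that ln_top])
    then have "filterlim (\<lambda>n. ln (g (real n))) at_top sequentially"
      by (rule filterlim_cong[THEN iffD1, OF refl refl ev])
    then have "filterlim (\<lambda>n. exp (ln (g (real n)))) at_top sequentially"
      by (rule filterlim_compose[OF exp_at_top])
    then show ?thesis by (simp only: eq[symmetric])
  qed
  show "(\<lambda>n. g (real n)) \<longlonglongrightarrow> 0" if "\<rho> < 0"
  proof -
    have "filterlim (\<lambda>n. ln (g (real n)) / ln (real n) * ln (real n)) at_bot sequentially"
      by (rule filterlim_tendsto_neg_mult_at_bot[OF lim that ln_top])
    then have "filterlim (\<lambda>n. ln (g (real n))) at_bot sequentially"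
      by (rule filterlim_cong[THEN iffD1, OF refl refl ev])
    then have "(\<lambda>n. exp (ln (g (real n)))) \<longlonglongrightarrow> 0"
      by (rule filterlim_compose[OF exp_at_bot])
    then show ?thesis by (simp only: eq[symmetric])
  qed
qed

section \<open>Rademacher series\<close>

locale symmetric_bernoulli = prob_space M for M :: "'w measure" +
  fixes Y :: "nat \<Rightarrow> 'w \<Rightarrow> real"
  assumes indep: "indep_vars (\<lambda>_. borel) Y {1..}"
    and vals: "\<And>m \<omega>. 1 \<le> m \<Longrightarrow> \<omega> \<in> space M \<Longrightarrow> Y m \<omega> = -1 \<or> Y m \<omega> = 1"
    and prob_one: "\<And>m. 1 \<le> m \<Longrightarrow> prob {\<omega> \<in> space M. Y m \<omega> = 1} = 1 / 2"
    and prob_minus_one: "\<And>m. 1 \<le> m \<Longrightarrow> prob {\<omega> \<in> space M. Y m \<omega> = -1} = 1 / 2"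

lemma iid_symmetric_bernoulli_locale:
  "iid_symmetric_bernoulli M Y \<Longrightarrow> symmetric_bernoulli M Y"
  unfolding iid_symmetric_bernoulli_def symmetric_bernoulli_def symmetric_bernoulli_axioms_def
  by (auto simp: Pi_iff)

context symmetric_bernoulli
begin

lemma Y_measurable [measurable]: "Y (Suc m) \<in> borel_measurable M"
  using indep by (auto simp: indep_vars_def)

lemma Y_measurable': "1 \<le> m \<Longrightarrow> Y m \<in> borel_measurable M"
  using Y_measurable[of "m - 1"] by simp

lemma expectation_even_odd:
  fixes F :: "real \<Rightarrow> 'a :: {banach, second_countable_topology}"
  assumes m: "1 \<le> m"
  shows "expectation (\<lambda>\<omega>. F (Y m \<omega>)) = (1 / 2) *\<^sub>R (F 1 + F (-1))"
proof -
  have [measurable]: "Y m \<in> borel_measurable M" by (rule Y_measurable'[OF m])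
  have "expectation (\<lambda>\<omega>. F (Y m \<omega>)) =
      expectation (\<lambda>\<omega>. indicator {\<omega> \<in> space M. Y m \<omega> = 1} \<omega> *\<^sub>R F 1 + indicator {\<omega> \<in> space M. Y m \<omega> = -1} \<omega> *\<^sub>R F (-1))"
    using vals[OF m] by (intro Bochner_Integration.integral_cong refl) (auto simp: indicator_def)
  also have "\<dots> = (1 / 2) *\<^sub>R F 1 + (1 / 2) *\<^sub>R F (-1)"
  proof -
    have events: "{\<omega> \<in> space M. Y m \<omega> = c} \<in> events" for c
      by measurable
    have space: "{\<omega> \<in> space M. Y m \<omega> = c} \<inter> space M = {\<omega> \<in> space M. Y m \<omega> = c}" for c
      by auto
    have int: "integrable M (\<lambda>\<omega>. indicat_real {\<omega> \<in> space M. Y m \<omega> = c} \<omega> *\<^sub>R x)" for c and x :: 'a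
      by (intro integrable_scaleR_left integrable_real_indicator events) (simp add: emeasure_eq_measure)
    have eval: "expectation (\<lambda>\<omega>. indicat_real {\<omega> \<in> space M. Y m \<omega> = c} \<omega> *\<^sub>R x) = prob {\<omega> \<in> space M. Y m \<omega> = c} *\<^sub>R x" for c and x :: 'a
      using events[of c] by (subst integral_scaleR_left) (simp_all add: space emeasure_eq_measure)
    show ?thesis
      unfolding Bochner_Integration.integral_add[OF int int] eval prob_one[OF m] prob_minus_one[OF m] ..
  qed
  finally show ?thesis by (simp add: scaleR_right_distrib)
qed

text \<open>The martingale difference property: a bounded function of earlier coordinates is
  independent of \<open>Y m\<close>, which is centred. Writing it through \<open>restrict\<close>
  makes the dependence on the coordinates in \<open>A\<close> explicit.\<close>

lemma expectation_times_later:
  assumes A: "A \<subseteq> {1..}" and m: "1 \<le> m" "m \<notin> A"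
    and H: "H \<in> borel_measurable (PiM A (\<lambda>_. borel))"
    and B: "\<And>\<omega>. \<omega> \<in> space M \<Longrightarrow> \<bar>H (restrict (\<lambda>i. Y i \<omega>) A)\<bar> \<le> B"
  shows "expectation (\<lambda>\<omega>. H (restrict (\<lambda>i. Y i \<omega>) A) * Y m \<omega>) = 0"
proof -
  have "indep_var (PiM A (\<lambda>_. borel)) (\<lambda>\<omega>. restrict (\<lambda>i. Y i \<omega>) A) (PiM {m} (\<lambda>_. borel)) (\<lambda>\<omega>. restrict (\<lambda>i. Y i \<omega>) {m})"
    using A m by (intro indep_var_restrict[OF indep]) auto
  then have "indep_var borel (H \<circ> (\<lambda>\<omega>. restrict (\<lambda>i. Y i \<omega>) A)) borel ((\<lambda>y. y m) \<circ> (\<lambda>\<omega>. restrict (\<lambda>i. Y i \<omega>) {m}))"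
    by (rule indep_var_compose) (auto intro: H)
  moreover have "(\<lambda>y. y m) \<circ> (\<lambda>\<omega>. restrict (\<lambda>i. Y i \<omega>) {m}) = Y m"
    by (auto simp: comp_def)
  ultimately have ind: "indep_var borel (\<lambda>\<omega>. H (restrict (\<lambda>i. Y i \<omega>) A)) borel (Y m)"
    by (simp only: comp_def)
  have i1: "integrable M (\<lambda>\<omega>. H (restrict (\<lambda>i. Y i \<omega>) A))"
    using B by (intro integrable_const_bound[of _ B] AE_I2 indep_var_rv1[OF ind]) auto
  have i2: "integrable M (Y m)"
    using vals[OF m(1)] by (intro integrable_const_bound[of _ 1] AE_I2 indep_var_rv2[OF ind]) fastforce
  have "expectation (\<lambda>\<omega>. H (restrict (\<lambda>i. Y i \<omega>) A) * Y m \<omega>) = expectation (\<lambda>\<omega>. H (restrict (\<lambda>i. Y i \<omega>) A)) * expectation (Y m)"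
    by (rule indep_var_lebesgue_integral[OF ind i1 i2])
  also have "expectation (Y m) = 0"
    using expectation_even_odd[OF m(1), of "\<lambda>x. x"] by simp
  finally show ?thesis by (simp only: mult_zero_right)
qed

definition partial_sum :: "(nat \<Rightarrow> real) \<Rightarrow> nat \<Rightarrow> 'w \<Rightarrow> real" where
  "partial_sum a n \<omega> = (\<Sum>m<n. a m * Y (m + 1) \<omega>)"

lemma partial_sum_measurable [measurable]: "partial_sum a n \<in> borel_measurable M"
  unfolding partial_sum_def[abs_def] by simp

lemma partial_sum_bound:
  assumes "\<omega> \<in> space M" shows "\<bar>partial_sum a n \<omega>\<bar> \<le> (\<Sum>m<n. \<bar>a m\<bar>)"
  unfolding partial_sum_def
proof (rule order_trans[OF sum_abs sum_mono])
  fix m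
  show "\<bar>a m * Y (m + 1) \<omega>\<bar> \<le> \<bar>a m\<bar>"
    using vals[of "m + 1" \<omega>] assms by auto
qed

lemma continuous_partial_sum_bounded:
  fixes F :: "real \<Rightarrow> real"
  assumes F: "continuous_on UNIV F"
  obtains B where "\<And>\<omega>. \<omega> \<in> space M \<Longrightarrow> \<bar>F (partial_sum a n \<omega>)\<bar> \<le> B"
proof -
  define K where "K = (\<Sum>m<n. \<bar>a m\<bar>)"
  have "compact (F ` {-K..K})"
    by (intro compact_continuous_image continuous_on_subset[OF F]) auto
  then obtain B where "\<forall>y\<in>F ` {-K..K}. norm y \<le> B"
    using compact_imp_bounded bounded_iff by metis
  then show thesis
    using that[of B] partial_sum_bound[of _ a n] by (force simp: K_def abs_le_iff)
qed

lemma integrable_partial_sum: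
  fixes F :: "real \<Rightarrow> real"
  assumes F: "continuous_on UNIV F"
  shows "integrable M (\<lambda>\<omega>. F (partial_sum a n \<omega>))"
proof -
  obtain B where "\<And>\<omega>. \<omega> \<in> space M \<Longrightarrow> \<bar>F (partial_sum a n \<omega>)\<bar> \<le> B"
    using continuous_partial_sum_bounded[OF F] by blast
  moreover have [measurable]: "F \<in> borel_measurable borel"
    by (rule borel_measurable_continuous_onI[OF F])
  ultimately show ?thesis
    by (intro integrable_const_bound[of _ B] AE_I2) auto
qed

text \<open>As a function of the last sign, F is an even part plus an odd part times that sign, and
  the odd part has expectation zero.\<close>

lemma expectation_partial_sum_Suc:
  fixes F :: "real \<Rightarrow> real"
  assumes F: "continuous_on UNIV F"
  shows "expectation (\<lambda>\<omega>. F (partial_sum a (Suc n) \<omega>)) =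
    expectation (\<lambda>\<omega>. F (partial_sum a n \<omega> + a n) + F (partial_sum a n \<omega> - a n)) / 2"
proof -
  define G where "G x = (F (x + a n) - F (x - a n)) / 2" for x
  define E where "E x = (F (x + a n) + F (x - a n)) / 2" for x
  have G: "continuous_on UNIV G" and E: "continuous_on UNIV E"
    unfolding G_def E_def by (intro continuous_intros continuous_on_compose2[OF F]; auto)+
  have Gm [measurable]: "G \<in> borel_measurable borel"
    by (rule borel_measurable_continuous_onI[OF G])
  obtain B where B: "\<And>\<omega>. \<omega> \<in> space M \<Longrightarrow> \<bar>G (partial_sum a n \<omega>)\<bar> \<le> B"
    using continuous_partial_sum_bounded[OF G] by blast
  define H where "H y = G (\<Sum>m<n. a m * y (m + 1))" for y :: "nat \<Rightarrow> real"
  have H_eq: "H (restrict (\<lambda>i. Y i \<omega>) {1..n}) = G (partial_sum a n \<omega>)" for \<omega>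
    unfolding H_def partial_sum_def by (intro arg_cong[of _ _ G] sum.cong) auto
  have "H \<in> borel_measurable (PiM {1..n} (\<lambda>_. borel))"
    unfolding H_def by (intro measurable_compose[OF _ Gm] borel_measurable_sum borel_measurable_times) auto
  then have "expectation (\<lambda>\<omega>. H (restrict (\<lambda>i. Y i \<omega>) {1..n}) * Y (Suc n) \<omega>) = 0"
    by (rule expectation_times_later[where B=B, rotated 3]) (simp_all only: H_eq B, auto)
  then have zero: "expectation (\<lambda>\<omega>. G (partial_sum a n \<omega>) * Y (Suc n) \<omega>) = 0"
    by (simp only: H_eq)
  have intG: "integrable M (\<lambda>\<omega>. G (partial_sum a n \<omega>) * Y (Suc n) \<omega>)"
    using vals[of "Suc n"] B
    by (intro integrable_const_bound[of _ B] AE_I2) (fastforce simp: abs_mult)+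
  have "expectation (\<lambda>\<omega>. F (partial_sum a (Suc n) \<omega>)) = expectation (\<lambda>\<omega>. E (partial_sum a n \<omega>) + G (partial_sum a n \<omega>) * Y (Suc n) \<omega>)"
  proof (intro Bochner_Integration.integral_cong refl)
    fix \<omega> assume "\<omega> \<in> space M"
    then have "Y (Suc n) \<omega> = -1 \<or> Y (Suc n) \<omega> = 1" by (intro vals) auto
    then show "F (partial_sum a (Suc n) \<omega>) = E (partial_sum a n \<omega>) + G (partial_sum a n \<omega>) * Y (Suc n) \<omega>"
      by (auto simp: partial_sum_def E_def G_def field_simps)
  qed
  also have "\<dots> = expectation (\<lambda>\<omega>. E (partial_sum a n \<omega>))"
    using integrable_partial_sum[OF E] intG zero by simp
  finally show ?thesis by (simp add: E_def)
qed

text \<open>Tree averages and expectations obey the same one-step recursion. The induction must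
  range over all continuous \<open>F\<close>, since each step replaces \<open>F\<close> by a sum of
  two translates.\<close>

lemma expectation_partial_sum_tree:
  fixes F :: "real \<Rightarrow> real"
  assumes F: "continuous_on UNIV F" and S: "signed_tree a S"
  shows "expectation (\<lambda>\<omega>. F (partial_sum a n \<omega>)) = (\<Sum>k<2 ^ n. F (S n k)) / 2 ^ n"
  using F
proof (induction n arbitrary: F)
  case 0
  then show ?case using S by (simp add: partial_sum_def signed_tree_def prob_space)
next
  case (Suc n)
  have "continuous_on UNIV (\<lambda>x. F (x + a n) + F (x - a n))"
    by (intro continuous_intros continuous_on_compose2[OF Suc.prems]) auto
  from Suc.IH[OF this] show ?case
    unfolding expectation_partial_sum_Suc[OF Suc.prems] signed_tree_sum_lessThan_Suc[OF S] by simp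
qed

end

text \<open>Partial sums as functions of the sequence of signs rather than of the sample point, so
  that depending only on the first k signs becomes measurability on
  \<open>PiM {1..k}\<close>.\<close>

definition coordinate_sum :: "(nat \<Rightarrow> real) \<Rightarrow> nat \<Rightarrow> (nat \<Rightarrow> real) \<Rightarrow> real" where
  "coordinate_sum a n y = (\<Sum>m<n. a m * y (m + 1))"

text \<open>The partial sums, frozen when they first leave \<open>(-e, e)\<close>.\<close>

primrec stopped_sum :: "(nat \<Rightarrow> real) \<Rightarrow> real \<Rightarrow> nat \<Rightarrow> (nat \<Rightarrow> real) \<Rightarrow> real" where
  "stopped_sum a e 0 y = 0"
| "stopped_sum a e (Suc n) y =
     stopped_sum a e n y + (if \<forall>j\<le>n. \<bar>coordinate_sum a j y\<bar> < e then a n * y (n + 1) else 0)"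

lemma coordinate_sum_restrict: "n \<le> k \<Longrightarrow> coordinate_sum a n (restrict y {1..k}) = coordinate_sum a n y"
  unfolding coordinate_sum_def by (intro sum.cong) auto

lemma stopped_sum_restrict: "n \<le> k \<Longrightarrow> stopped_sum a e n (restrict y {1..k}) = stopped_sum a e n y"
proof (induction n)
  case (Suc n)
  have "(\<forall>j\<le>n. \<bar>coordinate_sum a j (restrict y {1..k})\<bar> < e) \<longleftrightarrow> (\<forall>j\<le>n. \<bar>coordinate_sum a j y\<bar> < e)"
    using Suc.prems by (auto simp: coordinate_sum_restrict[unfolded One_nat_def])
  moreover have "restrict y {1..k} (n + 1) = y (n + 1)"
    using Suc.prems by simp
  moreover have "stopped_sum a e n (restrict y {1..k}) = stopped_sum a e n y"
    using Suc by (simp only: Suc_leD)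
  ultimately show ?case
    by (simp only: stopped_sum.simps)
qed simp

lemma coordinate_sum_measurable:
  "n \<le> k \<Longrightarrow> coordinate_sum a n \<in> borel_measurable (PiM {1..k} (\<lambda>_. borel))"
  unfolding coordinate_sum_def[abs_def]
proof (rule borel_measurable_sum)
  fix m assume "n \<le> k" "m \<in> {..<n}"
  then have "m + 1 \<in> {1..k}" by simp
  then have "(\<lambda>y. y (m + 1)) \<in> borel_measurable (PiM {1..k} (\<lambda>_. borel :: real measure))"
    by (rule measurable_component_singleton)
  then show "(\<lambda>y. a m * y (m + 1)) \<in> borel_measurable (PiM {1..k} (\<lambda>_. borel))"
    by (rule borel_measurable_times[OF borel_measurable_const])
qed

lemma coordinate_sum_bounded_measurable:
  assumes "n \<le> k"
  shows "{y \<in> space (PiM {1..k} (\<lambda>_. borel)). \<forall>j\<le>n. \<bar>coordinate_sum a j y\<bar> < e} \<in> sets (PiM {1..k} (\<lambda>_. borel))"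
proof -
  have "{y \<in> space (PiM {1..k} (\<lambda>_. borel)). \<forall>j\<in>{..n}. \<bar>coordinate_sum a j y\<bar> < e} \<in> sets (PiM {1..k} (\<lambda>_. borel))"
  proof (rule sets.sets_Collect_finite_All)
    fix j assume "j \<in> {..n}"
    then have "j \<le> k" using assms by simp
    then show "{y \<in> space (PiM {1..k} (\<lambda>_. borel)). \<bar>coordinate_sum a j y\<bar> < e} \<in> sets (PiM {1..k} (\<lambda>_. borel))"
      by (rule borel_measurable_less[OF borel_measurable_abs[OF coordinate_sum_measurable] borel_measurable_const])
  qed simp
  then show ?thesis by (simp only: Ball_def atMost_iff)
qed

lemma stopped_sum_measurable:
  "n \<le> k \<Longrightarrow> stopped_sum a e n \<in> borel_measurable (PiM {1..k} (\<lambda>_. borel))"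
proof (induction n)
  case 0
  have "stopped_sum a e 0 = (\<lambda>_. 0)"
    by (rule ext) simp
  then show ?case by (simp only: borel_measurable_const)
next
  case (Suc n)
  have n: "n \<le> k" "n + 1 \<in> {1..k}"
    using Suc.prems by simp_all
  have "(\<lambda>y. y (n + 1)) \<in> borel_measurable (PiM {1..k} (\<lambda>_. borel :: real measure))"
    by (rule measurable_component_singleton[OF n(2)])
  then have "(\<lambda>y. if \<forall>j\<le>n. \<bar>coordinate_sum a j y\<bar> < e then a n * y (n + 1) else 0) \<in> borel_measurable (PiM {1..k} (\<lambda>_. borel))"
    by (rule measurable_If[OF borel_measurable_times[OF borel_measurable_const] borel_measurable_const coordinate_sum_bounded_measurable[OF n(1)]])
  then have "(\<lambda>y. stopped_sum a e n y + (if \<forall>j\<le>n. \<bar>coordinate_sum a j y\<bar> < e then a n * y (n + 1) else 0))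
      \<in> borel_measurable (PiM {1..k} (\<lambda>_. borel))"
    by (rule borel_measurable_add[OF Suc.IH[OF n(1)]])
  moreover have "stopped_sum a e (Suc n) = (\<lambda>y. stopped_sum a e n y + (if \<forall>j\<le>n. \<bar>coordinate_sum a j y\<bar> < e then a n * y (n + 1) else 0))"
    by (rule ext) simp
  ultimately show ?case by (simp only:)
qed

lemma stopped_sum_cases:
  "(if \<forall>j<n. \<bar>coordinate_sum a j y\<bar> < e then stopped_sum a e n y = coordinate_sum a n y else e \<le> \<bar>stopped_sum a e n y\<bar>)"
proof (induction n)
  case 0
  then show ?case by (simp add: coordinate_sum_def)
next
  case (Suc n)
  show ?case
  proof (cases "\<forall>j\<le>n. \<bar>coordinate_sum a j y\<bar> < e")
    case True
    then have "stopped_sum a e n y = coordinate_sum a n y"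
      using Suc by (auto split: if_splits)
    with True show ?thesis by (auto simp: less_Suc_eq_le coordinate_sum_def)
  next
    case False
    then have eq: "stopped_sum a e (Suc n) y = stopped_sum a e n y"
      unfolding stopped_sum.simps by (simp only: if_False add_0_right)
    have "e \<le> \<bar>stopped_sum a e n y\<bar>"
    proof (cases "\<forall>j<n. \<bar>coordinate_sum a j y\<bar> < e")
      case True
      then have "\<not> \<bar>coordinate_sum a n y\<bar> < e" using False by (metis le_less)
      with True Suc show ?thesis by simp
    qed (use Suc in simp)
    moreover have "(\<forall>j<Suc n. \<bar>coordinate_sum a j y\<bar> < e) = False"
      using False by (simp only: less_Suc_eq_le)
    ultimately show ?thesis by (simp only: eq if_False)
  qed
qed

context symmetric_bernoulli
begin

lemma partial_sum_eq_coordinate_sum: "partial_sum a n \<omega> = coordinate_sum a n (\<lambda>i. Y i \<omega>)"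
  by (simp add: partial_sum_def coordinate_sum_def)

lemma stopped_sum_random:
  "(\<lambda>\<omega>. stopped_sum a e n (\<lambda>i. Y i \<omega>)) \<in> borel_measurable M"
  "\<And>\<omega>. \<omega> \<in> space M \<Longrightarrow> \<bar>stopped_sum a e n (\<lambda>i. Y i \<omega>)\<bar> \<le> (\<Sum>m<n. \<bar>a m\<bar>)"
proof -
  have "(\<lambda>\<omega>. restrict (\<lambda>i. Y i \<omega>) {1..n}) \<in> measurable M (PiM {1..n} (\<lambda>_. borel))"
    by (intro measurable_restrict Y_measurable') auto
  from measurable_compose[OF this stopped_sum_measurable[OF order_refl]]
  show "(\<lambda>\<omega>. stopped_sum a e n (\<lambda>i. Y i \<omega>)) \<in> borel_measurable M"
    by (simp only: stopped_sum_restrict[OF order_refl])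
next
  fix \<omega> assume \<omega>: "\<omega> \<in> space M"
  show "\<bar>stopped_sum a e n (\<lambda>i. Y i \<omega>)\<bar> \<le> (\<Sum>m<n. \<bar>a m\<bar>)"
  proof (induction n)
    case (Suc n)
    have "\<bar>a n * Y (n + 1) \<omega>\<bar> \<le> \<bar>a n\<bar>"
      using vals[of "n + 1" \<omega>] \<omega> by auto
    with Suc show ?case by auto
  qed simp
qed

lemma integrable_stopped_sum_square: "integrable M (\<lambda>\<omega>. (stopped_sum a e n (\<lambda>i. Y i \<omega>))\<^sup>2)"
proof (rule integrable_const_bound[of _ "(\<Sum>m<n. \<bar>a m\<bar>)\<^sup>2"])
  show "AE \<omega> in M. norm ((stopped_sum a e n (\<lambda>i. Y i \<omega>))\<^sup>2) \<le> (\<Sum>m<n. \<bar>a m\<bar>)\<^sup>2"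
  proof (rule AE_I2)
    fix \<omega> assume "\<omega> \<in> space M"
    from power_mono[OF stopped_sum_random(2)[OF this], of a e n 2]
    show "norm ((stopped_sum a e n (\<lambda>i. Y i \<omega>))\<^sup>2) \<le> (\<Sum>m<n. \<bar>a m\<bar>)\<^sup>2" by simp
  qed
  show "(\<lambda>\<omega>. (stopped_sum a e n (\<lambda>i. Y i \<omega>))\<^sup>2) \<in> borel_measurable M"
    by (intro borel_measurable_power stopped_sum_random(1))
qed

text \<open>Orthogonality of martingale increments: the cross term is a function of the first
  \<open>n\<close> signs times the next one and has mean zero, while each step adds at most
  \<open>(a n) ^ 2\<close>, or nothing once stopped.\<close>

lemma expectation_stopped_sum_square:
  "expectation (\<lambda>\<omega>. (stopped_sum a e n (\<lambda>i. Y i \<omega>))\<^sup>2) \<le> (\<Sum>m<n. (a m)\<^sup>2)"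
proof (induction n)
  case 0
  then show ?case by simp
next
  case (Suc n)
  define T where "T \<omega> = stopped_sum a e n (\<lambda>i. Y i \<omega>)" for \<omega>
  define H where "H y = (if \<forall>j\<le>n. \<bar>coordinate_sum a j y\<bar> < e then 2 * a n * stopped_sum a e n y else 0)" for y
  define B where "B = 2 * \<bar>a n\<bar> * (\<Sum>m<n. \<bar>a m\<bar>)"
  have H_restrict: "H (restrict (\<lambda>i. Y i \<omega>) {1..n}) = H (\<lambda>i. Y i \<omega>)" for \<omega>
  proof -
    have "(\<forall>j\<le>n. \<bar>coordinate_sum a j (restrict (\<lambda>i. Y i \<omega>) {1..n})\<bar> < e) \<longleftrightarrow> (\<forall>j\<le>n. \<bar>coordinate_sum a j (\<lambda>i. Y i \<omega>)\<bar> < e)"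
      by (auto simp: coordinate_sum_restrict[unfolded One_nat_def])
    then show ?thesis by (simp only: H_def stopped_sum_restrict[OF order_refl])
  qed
  have Hm: "H \<in> borel_measurable (PiM {1..n} (\<lambda>_. borel))"
    unfolding H_def
    by (rule measurable_If[OF borel_measurable_times[OF borel_measurable_const stopped_sum_measurable[OF order_refl]]
          borel_measurable_const coordinate_sum_bounded_measurable[OF order_refl]])
  have HB: "\<bar>H (\<lambda>i. Y i \<omega>)\<bar> \<le> B" if "\<omega> \<in> space M" for \<omega>
  proof -
    have "\<bar>2 * a n * stopped_sum a e n (\<lambda>i. Y i \<omega>)\<bar> \<le> B"
      unfolding B_def abs_mult using stopped_sum_random(2)[OF that] by (intro mult_mono) auto
    moreover have "0 \<le> B" by (simp add: B_def sum_nonneg)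
    ultimately show ?thesis by (simp add: H_def)
  qed
  have H_random: "(\<lambda>\<omega>. H (\<lambda>i. Y i \<omega>)) \<in> borel_measurable M"
  proof -
    have "(\<lambda>\<omega>. restrict (\<lambda>i. Y i \<omega>) {1..n}) \<in> measurable M (PiM {1..n} (\<lambda>_. borel))"
      by (intro measurable_restrict Y_measurable') auto
    from measurable_compose[OF this Hm] show ?thesis by (simp only: H_restrict)
  qed
  have zero: "expectation (\<lambda>\<omega>. H (\<lambda>i. Y i \<omega>) * Y (Suc n) \<omega>) = 0"
  proof -
    have "expectation (\<lambda>\<omega>. H (restrict (\<lambda>i. Y i \<omega>) {1..n}) * Y (Suc n) \<omega>) = 0"
      by (rule expectation_times_later[OF _ _ _ Hm, where B=B]) (simp_all only: H_restrict HB, auto)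
    then show ?thesis by (simp only: H_restrict)
  qed
  have int1: "integrable M (\<lambda>\<omega>. (T \<omega>)\<^sup>2)"
    unfolding T_def by (rule integrable_stopped_sum_square)
  have int2: "integrable M (\<lambda>\<omega>. H (\<lambda>i. Y i \<omega>) * Y (Suc n) \<omega>)"
  proof (rule integrable_const_bound[of _ B])
    show "AE \<omega> in M. norm (H (\<lambda>i. Y i \<omega>) * Y (Suc n) \<omega>) \<le> B"
    proof (rule AE_I2)
      fix \<omega> assume \<omega>: "\<omega> \<in> space M"
      then have "\<bar>Y (Suc n) \<omega>\<bar> = 1" using vals[of "Suc n" \<omega>] by auto
      with HB[OF \<omega>] show "norm (H (\<lambda>i. Y i \<omega>) * Y (Suc n) \<omega>) \<le> B" by (simp add: abs_mult)
    qed
  qed (intro borel_measurable_times H_random Y_measurable)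
  have int3: "integrable M (\<lambda>\<omega>. (T \<omega>)\<^sup>2 + H (\<lambda>i. Y i \<omega>) * Y (Suc n) \<omega> + (a n)\<^sup>2)"
    using int1 int2 by simp
  have le: "(stopped_sum a e (Suc n) (\<lambda>i. Y i \<omega>))\<^sup>2 \<le> (T \<omega>)\<^sup>2 + H (\<lambda>i. Y i \<omega>) * Y (Suc n) \<omega> + (a n)\<^sup>2" if "\<omega> \<in> space M" for \<omega>
  proof -
    have "(Y (Suc n) \<omega>)\<^sup>2 = 1" using vals[of "Suc n" \<omega>] that by auto
    then have "(T \<omega> + a n * Y (Suc n) \<omega>)\<^sup>2 = (T \<omega>)\<^sup>2 + 2 * a n * T \<omega> * Y (Suc n) \<omega> + (a n)\<^sup>2"
      by (simp add: power2_sum power_mult_distrib mult_ac)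
    then show ?thesis
      by (cases "\<forall>j\<le>n. \<bar>coordinate_sum a j (\<lambda>i. Y i \<omega>)\<bar> < e")
        (simp_all only: H_def T_def stopped_sum.simps if_True if_False, simp_all)
  qed
  have "expectation (\<lambda>\<omega>. (stopped_sum a e (Suc n) (\<lambda>i. Y i \<omega>))\<^sup>2) \<le> expectation (\<lambda>\<omega>. (T \<omega>)\<^sup>2 + H (\<lambda>i. Y i \<omega>) * Y (Suc n) \<omega> + (a n)\<^sup>2)"
    by (rule integral_mono[OF integrable_stopped_sum_square int3]) (rule le)
  also have "\<dots> = expectation (\<lambda>\<omega>. (T \<omega>)\<^sup>2) + (a n)\<^sup>2"
    using int1 int2 zero by (simp add: prob_space)
  also have "\<dots> \<le> (\<Sum>m<Suc n. (a m)\<^sup>2)"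
    using Suc.IH by (simp add: T_def)
  finally show ?case .
qed

text \<open>If some partial sum reaches \<open>e\<close>, the stopped sum stays at or above
  \<open>e\<close> in modulus up to time \<open>n\<close>, so Markov's inequality for its square is
  enough.\<close>

lemma Kolmogorov_maximal_inequality:
  assumes e: "0 < e"
  shows "prob {\<omega> \<in> space M. \<exists>j<n. e \<le> \<bar>partial_sum a j \<omega>\<bar>} \<le> (\<Sum>m<n. (a m)\<^sup>2) / e\<^sup>2"
proof -
  define T where "T \<omega> = stopped_sum a e n (\<lambda>i. Y i \<omega>)" for \<omega>
  have [measurable]: "T \<in> borel_measurable M"
    unfolding T_def[abs_def] by (rule stopped_sum_random(1))
  have sub: "{\<omega> \<in> space M. \<exists>j<n. e \<le> \<bar>partial_sum a j \<omega>\<bar>} \<subseteq> {\<omega> \<in> space M. e\<^sup>2 \<le> (T \<omega>)\<^sup>2}"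
  proof clarify
    fix \<omega> j assume "j < n" "e \<le> \<bar>partial_sum a j \<omega>\<bar>"
    then have "e \<le> \<bar>T \<omega>\<bar>"
      using stopped_sum_cases[of n a "\<lambda>i. Y i \<omega>" e]
      by (auto simp: T_def partial_sum_eq_coordinate_sum not_less split: if_splits)
    with e show "e\<^sup>2 \<le> (T \<omega>)\<^sup>2"
      using power_mono[of e "\<bar>T \<omega>\<bar>" 2] by simp
  qed
  have int: "integrable M (\<lambda>\<omega>. (T \<omega>)\<^sup>2)"
    unfolding T_def by (rule integrable_stopped_sum_square)
  have "prob {\<omega> \<in> space M. \<exists>j<n. e \<le> \<bar>partial_sum a j \<omega>\<bar>} \<le> prob {\<omega> \<in> space M. e\<^sup>2 \<le> (T \<omega>)\<^sup>2}"
    by (rule finite_measure_mono[OF sub]) simp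
  also have "\<dots> \<le> expectation (\<lambda>\<omega>. (T \<omega>)\<^sup>2) / e\<^sup>2"
    using e by (intro integral_Markov_inequality_measure[OF int, where A="{}"]) auto
  also have "\<dots> \<le> (\<Sum>m<n. (a m)\<^sup>2) / e\<^sup>2"
    using expectation_stopped_sum_square[of a e n] by (intro divide_right_mono) (auto simp: T_def)
  finally show ?thesis .
qed

end

section \<open>Almost sure convergence, laws and first moments of Rademacher series\<close>

context symmetric_bernoulli
begin

text \<open>Kolmogorov's convergence theorem: the maximal inequality bounds the oscillation of the
  partial sums after N by the tail of the squares, which makes them almost surely Cauchy.\<close>

lemma AE_summable_of_square_summable:
  assumes a: "summable (\<lambda>m. (a m)\<^sup>2)"
  shows "AE \<omega> in M. summable (\<lambda>m. a m * Y (m + 1) \<omega>)"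
proof -
  \<comment> \<open>Deleting the first \<open>N\<close> coefficients makes the partial sums of
    \<open>b N\<close> equal to the increments of the original ones after \<open>N\<close>.\<close>
  define b where "b N m = (if m < N then 0 else a m)" for N m
  define tail where "tail N = (\<Sum>m. (a (m + N))\<^sup>2)" for N
  have tail: "tail \<longlonglongrightarrow> 0"
    unfolding tail_def by (rule suminf_exist_split2[OF a])
  have b_tail: "(\<Sum>m<n. (b N m)\<^sup>2) \<le> tail N" for n N
  proof -
    have "(\<Sum>m<n. (b N m)\<^sup>2) \<le> (\<Sum>m<n + N. (b N m)\<^sup>2)"
      by (intro sum_mono2) auto
    also have "\<dots> = (\<Sum>m\<in>{0 + N..<n + N}. (b N m)\<^sup>2)"
      by (intro sum.mono_neutral_right) (auto simp: b_def)
    also have "\<dots> = (\<Sum>m<n. (a (m + N))\<^sup>2)"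
      by (subst sum.shift_bounds_nat_ivl) (simp add: b_def lessThan_atLeast0)
    also have "\<dots> \<le> tail N"
      unfolding tail_def by (intro sum_le_suminf summable_ignore_initial_segment a) auto
    finally show ?thesis .
  qed
  have osc: "prob {\<omega> \<in> space M. \<exists>j. e \<le> \<bar>partial_sum (b N) j \<omega>\<bar>} \<le> tail N / e\<^sup>2" if e: "0 < e" for e N
  proof -
    define A where "A n = {\<omega> \<in> space M. \<exists>j<n. e \<le> \<bar>partial_sum (b N) j \<omega>\<bar>}" for n
    have "range A \<subseteq> events"
    proof (rule image_subsetI)
      fix n
      show "A n \<in> events"
        unfolding A_def by measurable
    qed
    moreover have "incseq A"
      unfolding incseq_def A_def by (blast intro: less_le_trans)
    ultimately have "(\<lambda>n. prob (A n)) \<longlonglongrightarrow> prob (\<Union>n. A n)"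
      by (rule finite_Lim_measure_incseq)
    moreover have "(\<Union>n. A n) = {\<omega> \<in> space M. \<exists>j. e \<le> \<bar>partial_sum (b N) j \<omega>\<bar>}"
      unfolding A_def by blast
    moreover have "prob (A n) \<le> tail N / e\<^sup>2" for n
      unfolding A_def
      by (rule order_trans[OF Kolmogorov_maximal_inequality[OF e]]) (intro divide_right_mono b_tail zero_le_power2)
    ultimately show ?thesis
      by (intro LIMSEQ_le_const2[of "\<lambda>n. prob (A n)"]) auto
  qed
  \<comment> \<open>The exceptional event lies in the oscillation event of every \<open>N\<close>,
    so its probability is below every \<open>tail N / e ^ 2\<close> and hence zero.\<close>
  have AE_small: "AE \<omega> in M. \<exists>N. \<forall>j. \<bar>partial_sum (b N) j \<omega>\<bar> < e" if e: "0 < e" for e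
  proof (rule AE_I)
    define D where "D = {\<omega> \<in> space M. \<forall>N. \<exists>j. e \<le> \<bar>partial_sum (b N) j \<omega>\<bar>}"
    show "{\<omega> \<in> space M. \<not> (\<exists>N. \<forall>j. \<bar>partial_sum (b N) j \<omega>\<bar> < e)} \<subseteq> D"
      by (auto simp: D_def not_less)
    show D: "D \<in> events"
      unfolding D_def by measurable
    have "prob D \<le> tail N / e\<^sup>2" for N
    proof (rule order_trans[OF finite_measure_mono osc[OF e]])
      show "D \<subseteq> {\<omega> \<in> space M. \<exists>j. e \<le> \<bar>partial_sum (b N) j \<omega>\<bar>}"
        unfolding D_def by blast
    qed measurable
    moreover have "(\<lambda>N. tail N / e\<^sup>2) \<longlonglongrightarrow> 0 / e\<^sup>2"
      using e by (intro tendsto_divide tail tendsto_const) simp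
    ultimately have "prob D \<le> 0"
      by (intro LIMSEQ_le_const[of "\<lambda>N. tail N / e\<^sup>2" 0]) auto
    then show "emeasure M D = 0"
      by (simp add: emeasure_eq_measure measure_le_0_iff)
  qed
  have "AE \<omega> in M. \<forall>k::nat. \<exists>N. \<forall>j. \<bar>partial_sum (b N) j \<omega>\<bar> < 1 / real (Suc k)"
    unfolding AE_all_countable by (intro allI AE_small) simp
  then show ?thesis
  proof eventually_elim
    case (elim \<omega>)
    show "summable (\<lambda>m. a m * Y (m + 1) \<omega>)"
      unfolding summable_Cauchy
    proof (intro allI impI)
      fix e :: real assume e: "0 < e"
      obtain k where k: "1 / real (Suc k) < e / 2"
        using reals_Archimedean[of "e / 2"] e by (auto simp: inverse_eq_divide)
      from elim obtain N where N: "\<And>j. \<bar>partial_sum (b N) j \<omega>\<bar> < 1 / real (Suc k)"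
        by blast
      have "norm (\<Sum>i\<in>{m..<n}. a i * Y (i + 1) \<omega>) < e" if "m \<ge> N" for m n
      proof (cases "m \<le> n")
        case True
        have "(\<Sum>i\<in>{m..<n}. a i * Y (i + 1) \<omega>) = (\<Sum>i\<in>{m..<n}. b N i * Y (i + 1) \<omega>)"
          using that by (intro sum.cong) (auto simp: b_def)
        also have "\<dots> = partial_sum (b N) n \<omega> - partial_sum (b N) m \<omega>"
          unfolding partial_sum_def lessThan_atLeast0
          using sum.atLeastLessThan_concat[of 0 m n "\<lambda>i. b N i * Y (i + 1) \<omega>"] True by simp
        finally show ?thesis
          using N[of n] N[of m] k unfolding real_norm_def by linarith
      qed (use e in simp)
      then show "\<exists>N. \<forall>m\<ge>N. \<forall>n. norm (\<Sum>i\<in>{m..<n}. a i * Y (i + 1) \<omega>) < e"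
        by blast
    qed
  qed
qed

lemma char_partial_sum:
  "char (distr M borel (partial_sum a n)) t = (\<Prod>m<n. complex_of_real (cos (t * a m)))"
proof -
  define X where "X i \<omega> = a (i - 1) * Y i \<omega>" for i \<omega>
  have ind: "indep_vars (\<lambda>_. borel) X {1..n}"
    unfolding X_def[abs_def]
    by (rule indep_vars_compose2[OF indep_vars_subset[OF indep]]) auto
  have eq: "partial_sum a n = (\<lambda>\<omega>. \<Sum>i\<in>{1..n}. X i \<omega>)"
  proof
    fix \<omega>
    show "partial_sum a n \<omega> = (\<Sum>i\<in>{1..n}. X i \<omega>)"
      using sum.atLeast1_atMost_eq[of "\<lambda>i. X i \<omega>" n] by (simp add: partial_sum_def X_def)
  qed
  have "char (distr M borel (X i)) t = complex_of_real (cos (t * a (i - 1)))" if i: "1 \<le> i" for i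
  proof -
    have [measurable]: "X i \<in> borel_measurable M"
      unfolding X_def[abs_def] using Y_measurable'[OF i] by simp
    have "char (distr M borel (X i)) t = expectation (\<lambda>\<omega>. iexp (t * (a (i - 1) * Y i \<omega>)))"
      unfolding char_def by (subst integral_distr) (simp_all add: X_def)
    also have "\<dots> = (1 / 2) *\<^sub>R (iexp (t * (a (i - 1) * 1)) + iexp (t * (a (i - 1) * (-1))))"
      by (rule expectation_even_odd[OF i])
    also have "\<dots> = complex_of_real (cos (t * a (i - 1)))"
      by (simp add: cos_exp_eq scaleR_conv_of_real exp_minus mult_ac flip: cos_of_real)
    finally show ?thesis .
  qed
  then have "char (distr M borel (partial_sum a n)) t = (\<Prod>i\<in>{1..n}. complex_of_real (cos (t * a (i - 1))))"
    unfolding eq char_distr_sum[OF ind] by (intro prod.cong) auto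
  also have "\<dots> = (\<Prod>m<n. complex_of_real (cos (t * a m)))"
    using prod.atLeast1_atMost_eq[of "\<lambda>i. complex_of_real (cos (t * a (i - 1)))" n] by simp
  finally show ?thesis .
qed

lemma series_measurable [measurable]:
  "(\<lambda>\<omega>. \<Sum>m. a m * Y (m + 1) \<omega>) \<in> borel_measurable M"
  by (intro borel_measurable_suminf) simp

lemma char_series:
  assumes conv: "AE \<omega> in M. summable (\<lambda>m. a m * Y (m + 1) \<omega>)"
  shows "(\<lambda>n. char (distr M borel (partial_sum a n)) t)
    \<longlonglongrightarrow> char (distr M borel (\<lambda>\<omega>. \<Sum>m. a m * Y (m + 1) \<omega>)) t"
proof -
  have "(\<lambda>n. expectation (\<lambda>\<omega>. iexp (t * partial_sum a n \<omega>))) \<longlonglongrightarrow> expectation (\<lambda>\<omega>. iexp (t * (\<Sum>m. a m * Y (m + 1) \<omega>)))"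
  proof (rule integral_dominated_convergence[where w="\<lambda>_. 1"])
    show "AE \<omega> in M. (\<lambda>n. iexp (t * partial_sum a n \<omega>)) \<longlonglongrightarrow> iexp (t * (\<Sum>m. a m * Y (m + 1) \<omega>))"
      using conv
    proof eventually_elim
      case (elim \<omega>)
      then have "(\<lambda>n. partial_sum a n \<omega>) \<longlonglongrightarrow> (\<Sum>m. a m * Y (m + 1) \<omega>)"
        unfolding partial_sum_def by (rule summable_LIMSEQ)
      then have "(\<lambda>n. t * partial_sum a n \<omega>) \<longlonglongrightarrow> t * (\<Sum>m. a m * Y (m + 1) \<omega>)"
        by (rule tendsto_mult_left)
      then show ?case
        by (rule isCont_tendsto_compose[OF isCont_iexp])
    qed
  qed auto
  then show ?thesis
    unfolding char_def by (subst (1 2) integral_distr) simp_all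
qed

text \<open>The tree averages are first absolute moments of the partial sums, whose second moments
  are bounded by the sum of squares. Convergence in law together with this bound allows passage to
  the limit in the first moment.\<close>

lemma first_moment_series:
  assumes S: "signed_tree a S" and a: "summable (\<lambda>m. (a m)\<^sup>2)"
  shows "integrable M (\<lambda>\<omega>. \<bar>\<Sum>m. a m * Y (m + 1) \<omega>\<bar>)"
    and "(\<lambda>n. (\<Sum>k<2 ^ n. \<bar>S n k\<bar>) / 2 ^ n) \<longlonglongrightarrow> expectation (\<lambda>\<omega>. \<bar>\<Sum>m. a m * Y (m + 1) \<omega>\<bar>)"
proof -
  define X where "X \<omega> = (\<Sum>m. a m * Y (m + 1) \<omega>)" for \<omega>
  have [measurable]: "X \<in> borel_measurable M"
    unfolding X_def[abs_def] by simp
  have conv: "AE \<omega> in M. summable (\<lambda>m. a m * Y (m + 1) \<omega>)"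
    by (rule AE_summable_of_square_summable[OF a])
  define C where "C = (\<Sum>m. (a m)\<^sup>2)"
  have second: "expectation (\<lambda>\<omega>. (partial_sum a n \<omega>)\<^sup>2) \<le> C" for n
  proof -
    have "expectation (\<lambda>\<omega>. (partial_sum a n \<omega>)\<^sup>2) = (\<Sum>k<2 ^ n. (S n k)\<^sup>2) / 2 ^ n"
      by (rule expectation_partial_sum_tree[OF _ S]) (intro continuous_intros)
    also have "\<dots> = (\<Sum>m<n. (a m)\<^sup>2)"
      by (simp add: signed_tree_sum_square[OF S])
    also have "\<dots> \<le> C"
      unfolding C_def by (intro sum_le_suminf a) auto
    finally show ?thesis .
  qed
  have int_sq: "integrable M (\<lambda>\<omega>. (partial_sum a n \<omega>)\<^sup>2)" for n
    by (rule integrable_partial_sum) (intro continuous_intros)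
  \<comment> \<open>Fatou's lemma along the almost surely convergent partial sums transfers their
    second moment bound to the limit.\<close>
  have intX: "integrable M (\<lambda>\<omega>. (X \<omega>)\<^sup>2)"
  proof (rule integrableI_nonneg)
    have "(\<integral>\<^sup>+\<omega>. ennreal ((X \<omega>)\<^sup>2) \<partial>M) = (\<integral>\<^sup>+\<omega>. liminf (\<lambda>n. ennreal ((partial_sum a n \<omega>)\<^sup>2)) \<partial>M)"
    proof (rule nn_integral_cong_AE)
      show "AE \<omega> in M. ennreal ((X \<omega>)\<^sup>2) = liminf (\<lambda>n. ennreal ((partial_sum a n \<omega>)\<^sup>2))"
        using conv
      proof eventually_elim
        case (elim \<omega>)
        then have "(\<lambda>n. partial_sum a n \<omega>) \<longlonglongrightarrow> X \<omega>"
          unfolding partial_sum_def X_def by (rule summable_LIMSEQ)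
        then have "(\<lambda>n. ennreal ((partial_sum a n \<omega>)\<^sup>2)) \<longlonglongrightarrow> ennreal ((X \<omega>)\<^sup>2)"
          by (intro tendsto_ennrealI tendsto_power)
        then show ?case
          by (rule lim_imp_Liminf[OF sequentially_bot, symmetric])
      qed
    qed
    also have "\<dots> \<le> liminf (\<lambda>n. \<integral>\<^sup>+\<omega>. ennreal ((partial_sum a n \<omega>)\<^sup>2) \<partial>M)"
      by (rule nn_integral_liminf) measurable
    also have "\<dots> \<le> liminf (\<lambda>n. ennreal C)"
      by (intro Liminf_mono always_eventually allI)
         (simp add: nn_integral_eq_integral[OF int_sq] ennreal_leI second)
    also have "\<dots> < \<infinity>"
      by (simp add: Liminf_const)
    finally show "(\<integral>\<^sup>+\<omega>. ennreal ((X \<omega>)\<^sup>2) \<partial>M) < \<infinity>" .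
  qed auto
  show "integrable M (\<lambda>\<omega>. \<bar>\<Sum>m. a m * Y (m + 1) \<omega>\<bar>)"
    unfolding X_def[symmetric]
  proof (rule Bochner_Integration.integrable_bound)
    show "integrable M (\<lambda>\<omega>. 1 + (X \<omega>)\<^sup>2)"
      using intX by simp
    show "AE \<omega> in M. norm \<bar>X \<omega>\<bar> \<le> norm (1 + (X \<omega>)\<^sup>2)"
    proof (rule AE_I2)
      fix \<omega>
      have "0 \<le> (\<bar>X \<omega>\<bar> - 1/2)\<^sup>2" by simp
      then have "\<bar>X \<omega>\<bar> \<le> 1 + (X \<omega>)\<^sup>2" by (simp add: power2_diff power_divide)
      then show "norm \<bar>X \<omega>\<bar> \<le> norm (1 + (X \<omega>)\<^sup>2)" by simp
    qed
  qed simp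
  have sq: "\<bar>x\<bar> powr (1 + 1) = x\<^sup>2" for x :: real
    by simp
  define \<mu> where "\<mu> n = distr M borel (partial_sum a n)" for n
  have \<mu>: "real_distribution (\<mu> n)" for n
    unfolding \<mu>_def by (rule real_distribution_distr) simp
  have lawX: "real_distribution (distr M borel X)"
    by (rule real_distribution_distr) simp
  have weak: "weak_conv_m \<mu> (distr M borel X)"
    by (rule levy_continuity[OF \<mu> lawX]) (use char_series[OF conv] in \<open>simp add: \<mu>_def X_def[abs_def]\<close>)
  have "(\<lambda>n. integral\<^sup>L (\<mu> n) (\<lambda>x. \<bar>x\<bar> powr 1)) \<longlonglongrightarrow> integral\<^sup>L (distr M borel X) (\<lambda>x. \<bar>x\<bar> powr 1)"
  proof (rule weak_conv_moment_tendsto[OF \<mu> lawX weak])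
    show "integrable (\<mu> n) (\<lambda>x. \<bar>x\<bar> powr (1 + 1))" for n
      unfolding \<mu>_def sq by (subst integrable_distr_eq) (simp_all add: int_sq)
    show "integral\<^sup>L (\<mu> n) (\<lambda>x. \<bar>x\<bar> powr (1 + 1)) \<le> C" for n
      unfolding \<mu>_def sq by (subst integral_distr) (simp_all add: second)
    show "integrable (distr M borel X) (\<lambda>x. \<bar>x\<bar> powr (1 + 1))"
      unfolding sq by (subst integrable_distr_eq) (simp_all add: intX)
  qed simp
  moreover have "integral\<^sup>L (\<mu> n) (\<lambda>x. \<bar>x\<bar> powr 1) = (\<Sum>k<2 ^ n. \<bar>S n k\<bar>) / 2 ^ n" for n
  proof -
    have "integral\<^sup>L (\<mu> n) (\<lambda>x. \<bar>x\<bar> powr 1) = expectation (\<lambda>\<omega>. \<bar>partial_sum a n \<omega>\<bar>)"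
      unfolding \<mu>_def by (subst integral_distr) simp_all
    also have "\<dots> = (\<Sum>k<2 ^ n. \<bar>S n k\<bar>) / 2 ^ n"
      by (rule expectation_partial_sum_tree[OF _ S]) (intro continuous_intros)
    finally show ?thesis .
  qed
  moreover have "integral\<^sup>L (distr M borel X) (\<lambda>x. \<bar>x\<bar> powr 1) = expectation (\<lambda>\<omega>. \<bar>X \<omega>\<bar>)"
    by (subst integral_distr) simp_all
  ultimately show "(\<lambda>n. (\<Sum>k<2 ^ n. \<bar>S n k\<bar>) / 2 ^ n) \<longlonglongrightarrow> expectation (\<lambda>\<omega>. \<bar>\<Sum>m. a m * Y (m + 1) \<omega>\<bar>)"
    by (simp add: X_def)
qed

lemma bounded_series:
  assumes c: "summable (\<lambda>m. \<bar>c m\<bar>)" and \<omega>: "\<omega> \<in> space M"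
  shows "summable (\<lambda>m. c m * Y (m + 1) \<omega>)"
    and "\<bar>\<Sum>m. c m * Y (m + 1) \<omega>\<bar> \<le> (\<Sum>m. \<bar>c m\<bar>)"
proof -
  have eq: "norm (c m * Y (m + 1) \<omega>) = \<bar>c m\<bar>" for m
    using vals[of "m + 1" \<omega>] \<omega> by auto
  show "summable (\<lambda>m. c m * Y (m + 1) \<omega>)"
    by (rule summable_norm_cancel) (simp only: eq c)
  show "\<bar>\<Sum>m. c m * Y (m + 1) \<omega>\<bar> \<le> (\<Sum>m. \<bar>c m\<bar>)"
    using summable_norm[of "\<lambda>m. c m * Y (m + 1) \<omega>"] c unfolding eq by simp
qed

end

section \<open>Variation sums\<close>

definition dyadic_prefix :: "real \<Rightarrow> nat \<Rightarrow> nat set" where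
  "dyadic_prefix t n = {..nat \<lfloor>t * 2 ^ n\<rfloor>} - {2 ^ n}"

lemma sum_dyadic_blocks:
  fixes h :: "nat \<Rightarrow> real"
  shows "(\<Sum>k<j * 2 ^ d. h k) = (\<Sum>i<j. \<Sum>k\<in>dyadic_block i d. h k)"
proof (induction j)
  case (Suc j)
  have "(\<Sum>k<Suc j * 2 ^ d. h k) = (\<Sum>k<j * 2 ^ d. h k) + (\<Sum>k\<in>{j * 2 ^ d..<Suc j * 2 ^ d}. h k)"
    unfolding lessThan_atLeast0 by (rule sum.atLeastLessThan_concat[symmetric]) auto
  with Suc show ?case by (simp add: dyadic_block_def)
qed simp

lemma finite_dyadic_prefix [simp]: "finite (dyadic_prefix t n)"
  by (simp add: dyadic_prefix_def)

lemma nat_floor_power2: "nat \<lfloor>(2::real) ^ n\<rfloor> = 2 ^ n"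
proof -
  have "(2::real) ^ n = of_int (2 ^ n)" by simp
  then have "\<lfloor>(2::real) ^ n\<rfloor> = 2 ^ n" by (simp only: floor_of_int)
  then show ?thesis by (simp add: nat_power_eq)
qed

lemma dyadic_prefix_one: "dyadic_prefix 1 n = {..<2 ^ n}"
  unfolding dyadic_prefix_def mult_1 nat_floor_power2 by auto

lemma nat_floor_less_power2:
  assumes "0 \<le> t" "t < 1" shows "nat \<lfloor>t * 2 ^ n\<rfloor> < 2 ^ n"
proof -
  have "t * 2 ^ n < of_int (2 ^ n)" using assms(2) by simp
  then have "\<lfloor>t * 2 ^ n\<rfloor> < 2 ^ n" by (simp only: floor_less_iff)
  then show ?thesis using zless_nat_eq_int_zless[of "nat \<lfloor>t * 2 ^ n\<rfloor>"] by (simp add: nat_less_iff assms(1))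
qed

lemma dyadic_prefix_subset:
  assumes "t \<in> {0..1}" shows "dyadic_prefix t n \<subseteq> {..<2 ^ n}"
proof (cases "t = 1")
  case False
  with assms have "nat \<lfloor>t * 2 ^ n\<rfloor> < 2 ^ n"
    by (intro nat_floor_less_power2) simp_all
  then show ?thesis
    unfolding dyadic_prefix_def by (blast intro: le_less_trans)
qed (simp add: dyadic_prefix_one)

text \<open>The last index of the prefix falls into block \<open>j\<close> for every finer level, so
  the prefix contains the j blocks before it and nothing beyond it.\<close>

lemma dyadic_prefix_between:
  fixes t :: real and l :: nat
  assumes t: "0 \<le> t" "t < 1"
  defines "j \<equiv> nat \<lfloor>t * 2 ^ l\<rfloor>"
  shows "{..<j * 2 ^ d} \<subseteq> dyadic_prefix t (l + d)" "dyadic_prefix t (l + d) \<subseteq> {..<(j + 1) * 2 ^ d}"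
proof -
  have j: "real j \<le> t * 2 ^ l" "t * 2 ^ l < real j + 1"
    unfolding j_def using t by simp_all
  have "real (j * 2 ^ d) \<le> t * 2 ^ l * 2 ^ d"
    using mult_right_mono[OF j(1), of "2 ^ d"] by simp
  then have "real (j * 2 ^ d) \<le> t * 2 ^ (l + d)"
    by (simp only: power_add mult.assoc)
  then have lo: "j * 2 ^ d \<le> nat \<lfloor>t * 2 ^ (l + d)\<rfloor>"
    by (rule le_nat_floor)
  have "t * 2 ^ l * 2 ^ d < (real j + 1) * 2 ^ d"
    using mult_strict_right_mono[OF j(2), of "2 ^ d"] by simp
  moreover have "of_int (int ((j + 1) * 2 ^ d)) = (real j + 1) * 2 ^ d"
    by (simp add: distrib_right)
  ultimately have "t * 2 ^ (l + d) < of_int (int ((j + 1) * 2 ^ d))"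
    by (simp only: power_add mult.assoc)
  then have "\<lfloor>t * 2 ^ (l + d)\<rfloor> < int ((j + 1) * 2 ^ d)"
    by (simp only: floor_less_iff)
  then have hi: "nat \<lfloor>t * 2 ^ (l + d)\<rfloor> < (j + 1) * 2 ^ d"
    using t by (simp add: nat_less_iff)
  show "{..<j * 2 ^ d} \<subseteq> dyadic_prefix t (l + d)"
  proof
    fix k assume "k \<in> {..<j * 2 ^ d}"
    then have "k < nat \<lfloor>t * 2 ^ (l + d)\<rfloor>" using lo by simp
    then show "k \<in> dyadic_prefix t (l + d)"
      using less_trans[OF _ nat_floor_less_power2[OF t, of "l + d"], of k]
      unfolding dyadic_prefix_def by (simp only: Diff_iff atMost_iff less_imp_le singleton_iff) simp
  qed
  show "dyadic_prefix t (l + d) \<subseteq> {..<(j + 1) * 2 ^ d}"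
    using hi unfolding dyadic_prefix_def by (blast intro: le_less_trans)
qed

text \<open>By nonnegativity the prefix sum is squeezed between j and j + 1 full blocks of level
  \<open>l\<close>. Their limits differ by one block, \<open>L / 2 ^ l\<close>, which is made small
  by choosing \<open>l\<close> first.\<close>

lemma prefix_sum_tendsto:
  fixes h :: "nat \<Rightarrow> nat \<Rightarrow> real"
  assumes nonneg: "\<And>n k. 0 \<le> h n k"
    and blocks: "\<And>l j. j < 2 ^ l \<Longrightarrow> (\<lambda>d. \<Sum>k\<in>dyadic_block j d. h (l + d) k) \<longlonglongrightarrow> L / 2 ^ l"
    and t: "t \<in> {0..1}"
  shows "(\<lambda>n. \<Sum>k\<in>dyadic_prefix t n. h n k) \<longlonglongrightarrow> L * t"
proof (cases "t = 1")
  case True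
  then show ?thesis
    using blocks[of 0 0] by (simp add: dyadic_prefix_one)
next
  case False
  with t have t01: "0 \<le> t" "t < 1" by auto
  have L: "0 \<le> L"
    using LIMSEQ_le_const[OF blocks[of 0 0], of 0] nonneg by (simp add: sum_nonneg)
  show ?thesis
  proof (rule tendstoI)
    fix e :: real assume e: "0 < e"
    have "(\<lambda>l. L * (1 / 2) ^ l) \<longlonglongrightarrow> L * 0"
      by (intro tendsto_mult tendsto_const LIMSEQ_realpow_zero) auto
    then have "eventually (\<lambda>l. L * (1 / 2) ^ l < e / 2) sequentially"
      by (rule order_tendstoD) (use e in simp)
    then obtain l where "L * (1 / 2) ^ l < e / 2"
      by (auto simp: eventually_sequentially)
    then have l: "L / 2 ^ l < e / 2"
      unfolding power_one_over by (simp only: times_divide_eq_right mult_1_right)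
    define j where "j = nat \<lfloor>t * 2 ^ l\<rfloor>"
    have j2: "j < 2 ^ l" unfolding j_def by (rule nat_floor_less_power2[OF t01])
    have j: "real j \<le> t * 2 ^ l" "t * 2 ^ l < real j + 1"
      unfolding j_def using t01 by simp_all
    have lim: "(\<lambda>d. \<Sum>k<i * 2 ^ d. h (l + d) k) \<longlonglongrightarrow> real i * (L / 2 ^ l)" if "i \<le> 2 ^ l" for i
    proof -
      have "(\<lambda>d. \<Sum>i'<i. \<Sum>k\<in>dyadic_block i' d. h (l + d) k) \<longlonglongrightarrow> (\<Sum>i'<i. L / 2 ^ l)"
        using that by (intro tendsto_sum blocks) auto
      then show ?thesis by (simp add: sum_dyadic_blocks)
    qed
    have tL: "L * t = t * 2 ^ l * (L / 2 ^ l)" by simp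
    have "real j * (L / 2 ^ l) + L / 2 ^ l = (real j + 1) * (L / 2 ^ l)" by (simp add: field_simps)
    moreover have "t * 2 ^ l * (L / 2 ^ l) \<le> (real j + 1) * (L / 2 ^ l)"
      using j L by (intro mult_right_mono) auto
    ultimately have "L * t - e / 2 < real j * (L / 2 ^ l)"
      using tL l by linarith
    then have lo: "eventually (\<lambda>d. L * t - e / 2 < (\<Sum>k<j * 2 ^ d. h (l + d) k)) sequentially"
      by (rule order_tendstoD(1)[OF lim[OF less_imp_le[OF j2]]])
    have "real (j + 1) * (L / 2 ^ l) = real j * (L / 2 ^ l) + L / 2 ^ l" by (simp add: field_simps)
    moreover have "real j * (L / 2 ^ l) \<le> t * 2 ^ l * (L / 2 ^ l)"
      using j L by (intro mult_right_mono) auto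
    ultimately have "real (j + 1) * (L / 2 ^ l) < L * t + e / 2"
      using tL l by linarith
    moreover have "j + 1 \<le> 2 ^ l" using j2 by simp
    ultimately have up: "eventually (\<lambda>d. (\<Sum>k<(j + 1) * 2 ^ d. h (l + d) k) < L * t + e / 2) sequentially"
      by (intro order_tendstoD(2)[OF lim])
    from lo up have "eventually (\<lambda>d. dist (\<Sum>k\<in>dyadic_prefix t (d + l). h (d + l) k) (L * t) < e) sequentially"
    proof eventually_elim
      case (elim d)
      have "(\<Sum>k<j * 2 ^ d. h (l + d) k) \<le> (\<Sum>k\<in>dyadic_prefix t (l + d). h (l + d) k)"
        using dyadic_prefix_between(1)[OF t01, of l d] nonneg by (intro sum_mono2) (auto simp: j_def)
      moreover have "(\<Sum>k\<in>dyadic_prefix t (l + d). h (l + d) k) \<le> (\<Sum>k<(j + 1) * 2 ^ d. h (l + d) k)"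
        using dyadic_prefix_between(2)[OF t01, of l d] nonneg by (intro sum_mono2) (auto simp: j_def)
      ultimately show ?case
        using elim e unfolding dist_real_def add.commute[of d l] by linarith
    qed
    then show "eventually (\<lambda>n. dist (\<Sum>k\<in>dyadic_prefix t n. h n k) (L * t) < e) sequentially"
      by (subst (asm) eventually_sequentially_seg[of "\<lambda>n. dist (\<Sum>k\<in>dyadic_prefix t n. h n k) (L * t) < e"])
  qed
qed

section \<open>Normalisation, growth factors and variation sums\<close>

locale regular_signed_tent_series = signed_tent_series +
  fixes s2 :: "nat \<Rightarrow> real" and q p \<rho> :: real and g :: "real \<Rightarrow> real"
  assumes s2_eq: "\<And>n. s2 n = (\<Sum>m<n. (\<alpha> m)\<^sup>2 * 4 ^ m)"
    and q: "0 \<le> q" "q < 1"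
    and g: "regularly_varying g \<rho>"
    and ratio: "(\<lambda>n. s2 n / (2 powr (2 * q * real n) * g (real n))) \<longlonglongrightarrow> 1"
    and p_eq: "p = 1 / (1 - q)"
begin

definition a :: "nat \<Rightarrow> real" where "a m = \<alpha> m * 2 ^ m"

definition s :: "nat \<Rightarrow> real" where "s n = sqrt (s2 n)"

abbreviation "S \<equiv> scaled_increment"

lemma tree: "signed_tree a S"
  using signed_tree_scaled_increment by (simp add: a_def[abs_def])

lemma s2_a: "s2 n = (\<Sum>m<n. (a m)\<^sup>2)"
proof -
  have "(4::real) ^ m = 2 ^ m * 2 ^ m" for m
    by (simp flip: power_mult_distrib)
  then have "(a m)\<^sup>2 = (\<alpha> m)\<^sup>2 * 4 ^ m" for m
    by (simp add: a_def power2_eq_square)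
  then show ?thesis by (simp add: s2_eq)
qed

lemma p: "1 \<le> p" "0 < p" "p * (1 - q) = 1"
  using q by (auto simp: p_eq)

lemma g_pos: "0 < g (real n)"
  using regularly_varying_pos[OF g] by simp

lemma s2_mono: "incseq s2"
  unfolding incseq_def s2_a by (auto intro: sum_mono2)

lemma s2_nonneg: "0 \<le> s2 n"
  by (simp add: s2_a sum_nonneg)

lemma s2_pos: "eventually (\<lambda>n. 0 < s2 n) sequentially"
proof -
  have "eventually (\<lambda>n. 0 < s2 n / (2 powr (2 * q * real n) * g (real n))) sequentially"
    using ratio by (rule order_tendstoD) simp
  then show ?thesis
  proof eventually_elim
    case (elim n)
    have "0 < 2 powr (2 * q * real n) * g (real n)" using g_pos[of n] by simp
    with elim show ?case by (simp add: zero_less_divide_iff)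
  qed
qed

lemma s_pos: "eventually (\<lambda>n. 0 < s n) sequentially"
  using s2_pos by eventually_elim (simp add: s_def)

lemma s2_Suc_ratio: "(\<lambda>n. s2 (Suc n) / s2 n) \<longlonglongrightarrow> 2 powr (2 * q)"
proof -
  define R where "R n = s2 n / (2 powr (2 * q * real n) * g (real n))" for n
  have R: "R \<longlonglongrightarrow> 1" using ratio by (simp add: R_def[abs_def])
  have "(\<lambda>n. R (Suc n) / R n * (2 powr (2 * q) * (g (real (Suc n)) / g (real n)))) \<longlonglongrightarrow> 1 / 1 * (2 powr (2 * q) * 1)"
    by (intro tendsto_intros regularly_varying_Suc_ratio[OF g] R LIMSEQ_Suc) simp
  moreover have "R (Suc n) / R n * (2 powr (2 * q) * (g (real (Suc n)) / g (real n))) = s2 (Suc n) / s2 n" for n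
  proof -
    have "2 powr (2 * q * real (Suc n)) = 2 powr (2 * q) * 2 powr (2 * q * real n)"
      by (simp add: algebra_simps flip: powr_add)
    then show ?thesis
      using g_pos[of n] g_pos[of "Suc n"] by (simp add: R_def field_simps)
  qed
  ultimately show ?thesis by simp
qed

lemma s2_at_top_of_pos: "0 < q \<Longrightarrow> filterlim s2 at_top sequentially"
proof -
  assume q0: "0 < q"
  have "filterlim (\<lambda>n. 2 powr (2 * q * real n) * g (real n) powr 1) at_top sequentially"
    by (rule regularly_varying_times_exp(1)[OF g]) (use q0 in simp)
  then have "filterlim (\<lambda>n. 2 powr (2 * q * real n) * g (real n)) at_top sequentially"
    using g_pos by (simp add: less_imp_le)
  then have "filterlim (\<lambda>n. s2 n / (2 powr (2 * q * real n) * g (real n)) * (2 powr (2 * q * real n) * g (real n))) at_top sequentially"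
    by (rule filterlim_tendsto_pos_mult_at_top[OF ratio zero_less_one])
  moreover have "s2 n / (2 powr (2 * q * real n) * g (real n)) * (2 powr (2 * q * real n) * g (real n)) = s2 n" for n
    using g_pos[of n] by simp
  ultimately show ?thesis by simp
qed

lemma s_at_top: "filterlim s2 at_top sequentially \<Longrightarrow> filterlim s at_top sequentially"
  unfolding s_def[abs_def] by (rule filterlim_compose[OF sqrt_at_top])

text \<open>The deterministic part of the r-th variation: once the increments are measured in units
  of 2^-n s_n, an average of r-th powers remains that stays between positive constants for
  \<open>r \<ge> 1\<close>.\<close>

definition W :: "real \<Rightarrow> nat \<Rightarrow> real" where
  "W r n = (s n / 2 ^ n) powr r * 2 ^ n"

text \<open>Apart from a factor tending to 1, the growth is 2^((1 - r (1 - q)) n) g(n)^(r/2). The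
  exponent changes sign at r = p, and there only g(n)^(p/2) survives.\<close>

lemma W_eq:
  "W r n = (s2 n / (2 powr (2 * q * real n) * g (real n))) powr (r / 2) *
    (2 powr ((1 - r * (1 - q)) * real n) * g (real n) powr (r / 2))"
proof -
  define R where "R = s2 n / (2 powr (2 * q * real n) * g (real n))"
  have R0: "0 \<le> R" using s2_nonneg[of n] g_pos[of n] by (simp add: R_def)
  have "s2 n = R * (2 powr (2 * q * real n) * g (real n))"
    using g_pos[of n] by (simp add: R_def)
  then have "s n powr r = (R * (2 powr (2 * q * real n) * g (real n))) powr (r / 2)"
    using s2_nonneg[of n] by (simp add: s_def powr_half_sqrt[symmetric] powr_powr)
  also have "\<dots> = R powr (r / 2) * (2 powr (q * real n * r) * g (real n) powr (r / 2))"
    using R0 g_pos[of n] by (simp add: powr_mult powr_powr mult_ac)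
  finally have sr: "s n powr r = R powr (r / 2) * (2 powr (q * real n * r) * g (real n) powr (r / 2))" .
  have "(s n / 2 ^ n) powr r * 2 ^ n = s n powr r * (2 powr (- real n * r) * 2 powr real n)"
    using s2_nonneg[of n] by (simp add: s_def powr_divide powr_minus_divide powr_powr flip: powr_realpow)
  also have "\<dots> = R powr (r / 2) * ((2 powr (q * real n * r) * (2 powr (- real n * r) * 2 powr real n)) * g (real n) powr (r / 2))"
    unfolding sr by (simp only: mult_ac)
  also have "2 powr (q * real n * r) * (2 powr (- real n * r) * 2 powr real n) = 2 powr ((1 - r * (1 - q)) * real n)"
    by (simp add: algebra_simps flip: powr_add)
  finally show ?thesis by (simp add: W_def R_def)
qed

lemma ratio_powr: "(\<lambda>n. (s2 n / (2 powr (2 * q * real n) * g (real n))) powr r) \<longlonglongrightarrow> 1"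
  using tendsto_powr[OF ratio tendsto_const, of r] by simp

lemma W_at_top: "r < p \<Longrightarrow> filterlim (W r) at_top sequentially"
proof -
  assume "r < p"
  then have "r * (1 - q) < p * (1 - q)" using q by (intro mult_strict_right_mono) auto
  then have "0 < 1 - r * (1 - q)" using p by simp
  from regularly_varying_times_exp(1)[OF g this]
  show ?thesis
    unfolding W_eq[abs_def] by (rule filterlim_tendsto_pos_mult_at_top[OF ratio_powr zero_less_one])
qed

lemma W_tendsto_0: "p < r \<Longrightarrow> W r \<longlonglongrightarrow> 0"
proof -
  assume "p < r"
  then have "p * (1 - q) < r * (1 - q)" using q by (intro mult_strict_right_mono) auto
  then have "1 - r * (1 - q) < 0" using p by simp
  from tendsto_mult[OF ratio_powr regularly_varying_times_exp(2)[OF g this]]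
  show ?thesis
    unfolding W_eq[abs_def] by simp
qed

lemma W_p_eq:
  "W p n = (s2 n / (2 powr (2 * q * real n) * g (real n))) powr (p / 2) * g (real n) powr (p / 2)"
  unfolding W_eq p(3) by simp

lemma W_p_at_top: "filterlim (\<lambda>n. g (real n)) at_top sequentially \<Longrightarrow> filterlim (W p) at_top sequentially"
proof -
  assume "filterlim (\<lambda>n. g (real n)) at_top sequentially"
  then have "filterlim (\<lambda>n. p / 2 * ln (g (real n))) at_top sequentially"
    using p by (intro filterlim_tendsto_pos_mult_at_top[OF tendsto_const] filterlim_compose[OF ln_at_top]) auto
  then have "filterlim (\<lambda>n. exp (p / 2 * ln (g (real n)))) at_top sequentially"
    by (rule filterlim_compose[OF exp_at_top])
  moreover have "exp (p / 2 * ln (g (real n))) = g (real n) powr (p / 2)" for n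
    using g_pos[of n] by (simp add: powr_def)
  ultimately have "filterlim (\<lambda>n. g (real n) powr (p / 2)) at_top sequentially"
    by (simp only:)
  then show ?thesis
    unfolding W_p_eq[abs_def] by (rule filterlim_tendsto_pos_mult_at_top[OF ratio_powr zero_less_one])
qed

lemma W_p_tendsto:
  assumes "(\<lambda>n. g (real n)) \<longlonglongrightarrow> c"
  shows "W p \<longlonglongrightarrow> c powr (p / 2)"
proof -
  have "(\<lambda>n. g (real n) powr (p / 2)) \<longlonglongrightarrow> c powr (p / 2)"
    \<comment> \<open>The limit \<open>c\<close> may be 0, where the power is continuous from the
      right because \<open>p / 2\<close> is positive.\<close>
    using p assms by (intro tendsto_powr' tendsto_const) (auto simp: g_pos less_imp_le)
  from tendsto_mult[OF ratio_powr this] show ?thesis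
    unfolding W_p_eq[abs_def] by simp
qed

lemma increment_powr:
  assumes "0 < s n"
  shows "(\<bar>S n k\<bar> / 2 ^ n) powr r = W r n * (\<bar>S n k / s n\<bar> powr r / 2 ^ n)"
proof -
  have "\<bar>S n k\<bar> / 2 ^ n = s n / 2 ^ n * \<bar>S n k / s n\<bar>"
    using assms by simp
  also have "\<dots> powr r = (s n / 2 ^ n) powr r * \<bar>S n k / s n\<bar> powr r"
    using assms by (intro powr_mult)
  finally show ?thesis
    by (simp add: W_def)
qed

lemma dyadic_V_W:
  assumes "0 < s n"
  shows "dyadic_V r f n = W r n * ((\<Sum>k<2 ^ n. \<bar>S n k / s n\<bar> powr r) / 2 ^ n)"
  unfolding dyadic_V_eq increment_powr[OF assms] by (simp add: sum_distrib_left sum_divide_distrib)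

lemma average_bounds:
  assumes "0 < s n" "1 \<le> r"
  shows "(13 / 128) powr r \<le> (\<Sum>k<2 ^ n. \<bar>S n k / s n\<bar> powr r) / 2 ^ n"
    and "(\<Sum>k<2 ^ n. \<bar>S n k / s n\<bar> powr r) / 2 ^ n \<le> 2 * (r + 1) powr r * exp (1/2)"
proof -
  have pos: "0 < (\<Sum>m<n. (a m)\<^sup>2)" using assms by (simp add: s_def s2_a)
  show "(13 / 128) powr r \<le> (\<Sum>k<2 ^ n. \<bar>S n k / s n\<bar> powr r) / 2 ^ n"
    using signed_tree_moment_lower[OF tree assms(2) pos] by (simp add: s_def s2_a field_simps)
  show "(\<Sum>k<2 ^ n. \<bar>S n k / s n\<bar> powr r) / 2 ^ n \<le> 2 * (r + 1) powr r * exp (1/2)"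
    using signed_tree_moment_bound[OF tree _ pos, of r] assms(2) by (simp add: s_def s2_a field_simps)
qed

text \<open>The uniform lower bound for the normalised average reduces divergence to that of
  \<open>W\<close>; a limit law is not involved, so bounded and unbounded \<open>s2\<close> are
  treated alike.\<close>

lemma infinite_variation_of_W:
  assumes "1 \<le> r" "filterlim (W r) at_top sequentially"
  shows "infinite_variation r f"
  unfolding infinite_variation_def
proof (rule filterlim_at_top_mono)
  show "filterlim (\<lambda>n. (13 / 128) powr r * W r n) at_top sequentially"
    by (rule filterlim_tendsto_pos_mult_at_top[OF tendsto_const _ assms(2)]) simp
  show "eventually (\<lambda>n. (13 / 128) powr r * W r n \<le> dyadic_V r f n) sequentially"
    using s_pos
  proof eventually_elim
    case (elim n)
    have "0 \<le> W r n" by (simp add: W_def)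
    then show ?case
      unfolding dyadic_V_W[OF elim] mult.commute[of _ "W r n"]
      by (intro mult_left_mono average_bounds(1)[OF elim assms(1)])
  qed
qed

lemma vanishing_variation_of_W:
  assumes "1 \<le> r" "W r \<longlonglongrightarrow> 0"
  shows "vanishing_variation r f"
  unfolding vanishing_variation_def
proof (rule Lim_null_comparison)
  show "(\<lambda>n. W r n * (2 * (r + 1) powr r * exp (1/2))) \<longlonglongrightarrow> 0"
    using assms(2) by (rule tendsto_mult_left_zero)
  show "eventually (\<lambda>n. norm (dyadic_V r f n) \<le> W r n * (2 * (r + 1) powr r * exp (1/2))) sequentially"
    using s_pos
  proof eventually_elim
    case (elim n)
    have "0 \<le> W r n" by (simp add: W_def)
    then have "dyadic_V r f n \<le> W r n * (2 * (r + 1) powr r * exp (1/2))"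
      unfolding dyadic_V_W[OF elim] by (intro mult_left_mono average_bounds(2)[OF elim assms(1)])
    moreover have "0 \<le> dyadic_V r f n"
      by (simp add: dyadic_V_def sum_nonneg)
    ultimately show ?case by simp
  qed
qed

text \<open>The p-th variation sum with the increments measured in units of 2^-n s_n. Both the
  \<Phi>-variation and the p-th variation are reduced to its limit.\<close>

definition D :: "real \<Rightarrow> nat \<Rightarrow> real" where
  "D t n = (\<Sum>k\<in>dyadic_prefix t n. \<bar>S n k / s n\<bar> powr p / 2 ^ n)"

lemma dyadic_sum_powr_eq:
  assumes "0 < s n"
  shows "dyadic_sum (\<lambda>x. x powr p) f t n = W p n * D t n"
  unfolding dyadic_sum_eq increment_powr[OF assms] D_def dyadic_prefix_def sum_distrib_left ..

text \<open>All increments of level n are below \<open>increment_bound n\<close>, hence eventually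
  in the range of \<open>Phi_rescaled_approx\<close>. Its error, averaged over the level, is
  absorbed by the uniform moment of order \<open>p + 1\<close>.\<close>

lemma dyadic_sum_Phi_approx:
  assumes t: "t \<in> {0..1}"
  shows "(\<lambda>n. dyadic_sum (Phi g q) f t n - D t n) \<longlonglongrightarrow> 0"
proof (rule LIMSEQ_I)
  fix e :: real assume e: "0 < e"
  define C where "C = 2 * (p + 1 + 1) powr (p + 1) * exp (1/2)"
  have C: "0 \<le> C" by (simp add: C_def)
  \<comment> \<open>\<open>C\<close> bounds the averaged moment of order \<open>p + 1\<close>, so
    the total error becomes \<open>e' * (1 + C) = e / 2\<close>.\<close>
  define e' where "e' = e / (2 * (1 + C))"
  have e': "0 < e'" "e' * (1 + C) = e / 2" using e C by (auto simp: e'_def field_simps)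
  have lim: "(\<lambda>n. (s n)\<^sup>2 / (2 powr (2 * q * real n) * g (real n))) \<longlonglongrightarrow> 1"
    using ratio s2_nonneg by (simp add: s_def)
  obtain d where d: "0 < d"
    "eventually (\<lambda>n. \<forall>x\<ge>0. s n * x / 2 ^ n \<le> d \<longrightarrow>
       \<bar>2 ^ n * Phi g q (s n * x / 2 ^ n) - x powr p\<bar> \<le> e' * (1 + x powr (p + 1))) sequentially"
    by (rule Phi_rescaled_approx[OF g q p_eq s_pos lim e'(1)])
  have "eventually (\<lambda>n. increment_bound n < d) sequentially"
    by (rule order_tendstoD(2)[OF increment_bound_tendsto_0 d(1)])
  with d(2) s_pos have "eventually (\<lambda>n. norm (dyadic_sum (Phi g q) f t n - D t n - 0) < e) sequentially"
  proof eventually_elim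
    case (elim n)
    define x where "x k = \<bar>S n k / s n\<bar>" for k
    have term_bound: "\<bar>Phi g q (\<bar>S n k\<bar> / 2 ^ n) - x k powr p / 2 ^ n\<bar> \<le> e' * (1 + x k powr (p + 1)) / 2 ^ n"
      if k: "k \<in> dyadic_prefix t n" for k
    proof -
      have k2: "k < 2 ^ n" using k dyadic_prefix_subset[OF t, of n] by auto
      have eq: "s n * x k / 2 ^ n = \<bar>S n k\<bar> / 2 ^ n"
        using elim(2) by (simp add: x_def)
      have "s n * x k / 2 ^ n \<le> d"
        unfolding eq using abs_scaled_increment_le[OF k2] elim(3) by linarith
      then have "\<bar>2 ^ n * Phi g q (s n * x k / 2 ^ n) - x k powr p\<bar> \<le> e' * (1 + x k powr (p + 1))"
        using elim(1) by (simp only: x_def abs_ge_zero)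
      then have "\<bar>2 ^ n * Phi g q (\<bar>S n k\<bar> / 2 ^ n) - x k powr p\<bar> / 2 ^ n \<le> e' * (1 + x k powr (p + 1)) / 2 ^ n"
        unfolding eq by (rule divide_right_mono) simp
      moreover have "Phi g q (\<bar>S n k\<bar> / 2 ^ n) - x k powr p / 2 ^ n = (2 ^ n * Phi g q (\<bar>S n k\<bar> / 2 ^ n) - x k powr p) / 2 ^ n"
        by (simp add: diff_divide_distrib)
      moreover have "\<bar>y / 2 ^ n\<bar> = \<bar>y\<bar> / 2 ^ n" for y :: real by simp
      ultimately show ?thesis by (simp only:)
    qed
    have "\<bar>dyadic_sum (Phi g q) f t n - D t n\<bar> = \<bar>\<Sum>k\<in>dyadic_prefix t n. Phi g q (\<bar>S n k\<bar> / 2 ^ n) - x k powr p / 2 ^ n\<bar>"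
      unfolding dyadic_sum_eq D_def dyadic_prefix_def x_def sum_subtractf ..
    also have "\<dots> \<le> (\<Sum>k\<in>dyadic_prefix t n. e' * (1 + x k powr (p + 1)) / 2 ^ n)"
      by (rule order_trans[OF sum_abs sum_mono]) (rule term_bound)
    also have "\<dots> \<le> (\<Sum>k<2 ^ n. e' * (1 + x k powr (p + 1)) / 2 ^ n)"
      using dyadic_prefix_subset[OF t, of n] e' by (intro sum_mono2) auto
    also have "\<dots> = e' * (1 + (\<Sum>k<2 ^ n. \<bar>S n k / s n\<bar> powr (p + 1)) / 2 ^ n)"
    proof -
      have "(\<Sum>k<2 ^ n. e' * (1 + x k powr (p + 1)) / 2 ^ n) = e' * ((\<Sum>k<2 ^ n. 1 + x k powr (p + 1)) / 2 ^ n)"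
        by (simp add: sum_divide_distrib sum_distrib_left)
      also have "(\<Sum>k<2 ^ n. 1 + x k powr (p + 1)) = 2 ^ n + (\<Sum>k<2 ^ n. x k powr (p + 1))"
        by (simp add: sum.distrib)
      finally show ?thesis
        unfolding x_def add_divide_distrib by simp
    qed
    also have "\<dots> \<le> e' * (1 + C)"
      using e' average_bounds(2)[OF elim(2), of "p + 1"] p unfolding C_def
      by (intro mult_left_mono add_left_mono) auto
    also have "\<dots> < e" using e' e by simp
    finally show ?case by simp
  qed
  then show "\<exists>no. \<forall>n\<ge>no. norm (dyadic_sum (Phi g q) f t n - D t n - 0) < e"
    by (simp add: eventually_sequentially)
qed

lemma has_Phi_variation_of_D:
  assumes "\<And>t. t \<in> {0..1} \<Longrightarrow> D t \<longlonglongrightarrow> V t"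
  shows "has_Phi_variation (Phi g q) f (\<lambda>t. ereal (V t))"
  unfolding has_Phi_variation_def
proof (intro ballI tendsto_ereal)
  fix t :: real assume t: "t \<in> {0..1}"
  from tendsto_add[OF dyadic_sum_Phi_approx[OF t] assms[OF t]]
  show "(\<lambda>n. dyadic_sum (Phi g q) f t n) \<longlonglongrightarrow> V t" by simp
qed

lemma dyadic_sum_powr_eventually:
  "eventually (\<lambda>n. W p n * D t n = dyadic_sum (\<lambda>x. x powr p) f t n) sequentially"
  using s_pos by eventually_elim (simp add: dyadic_sum_powr_eq)

text \<open>Products starting at every \<open>l\<close> are required because a block of level
  \<open>l\<close> has its first \<open>l\<close> signs fixed. One limit for all blocks gives equal
  shares and hence linearity in t.\<close>

lemma D_tendsto:
  assumes top: "filterlim s2 at_top sequentially"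
    and M: "real_distribution M" and int_M: "integrable M (\<lambda>x. \<bar>x\<bar> powr (p + 1))"
    and cos_prod: "\<And>t l. (\<lambda>n. \<Prod>m\<in>{l..<n}. complex_of_real (cos (t * a m / s n))) \<longlonglongrightarrow> char M t"
    and t: "t \<in> {0..1}"
  shows "D t \<longlonglongrightarrow> integral\<^sup>L M (\<lambda>x. \<bar>x\<bar> powr p) * t"
  unfolding D_def
proof (rule prefix_sum_tendsto[OF _ _ t])
  fix l j :: nat assume j: "j < 2 ^ l"
  have "(\<lambda>d. \<Prod>m\<in>{l..<l + d}. complex_of_real (cos (t * a m / s (l + d)))) \<longlonglongrightarrow> char M t" for t
    using LIMSEQ_ignore_initial_segment[OF cos_prod[where l=l], where k=l] by (simp only: add.commute)
  then have "(\<lambda>d. (\<Sum>k\<in>dyadic_block j d. \<bar>S (l + d) k / s (l + d)\<bar> powr p) / 2 ^ d) \<longlonglongrightarrow> integral\<^sup>L M (\<lambda>x. \<bar>x\<bar> powr p)"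
    by (intro block_moment_tendsto[OF tree j p(2) _ s_at_top[OF top] M int_M]) (simp_all add: s_def s2_a)
  then have "(\<lambda>d. (\<Sum>k\<in>dyadic_block j d. \<bar>S (l + d) k / s (l + d)\<bar> powr p) / 2 ^ d / 2 ^ l) \<longlonglongrightarrow> integral\<^sup>L M (\<lambda>x. \<bar>x\<bar> powr p) / 2 ^ l"
    by (intro tendsto_divide tendsto_const) simp_all
  then show "(\<lambda>d. \<Sum>k\<in>dyadic_block j d. \<bar>S (l + d) k / s (l + d)\<bar> powr p / 2 ^ (l + d)) \<longlonglongrightarrow> integral\<^sup>L M (\<lambda>x. \<bar>x\<bar> powr p) / 2 ^ l"
    by (simp add: sum_divide_distrib power_add mult.commute)
qed simp

text \<open>Needed when g(n) tends to infinity: the product of infinity and \<open>L * t\<close>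
  must be infinite for t > 0.\<close>

lemma moment_pos:
  assumes "D 1 \<longlonglongrightarrow> L" shows "0 < L"
proof -
  have "eventually (\<lambda>n. (13 / 128) powr p \<le> D 1 n) sequentially"
    using s_pos
  proof eventually_elim
    case (elim n)
    show ?case
      using average_bounds(1)[OF elim p(1)] by (simp add: D_def dyadic_prefix_one sum_divide_distrib)
  qed
  then have "(13 / 128) powr p \<le> L"
    by (rule tendsto_lowerbound[OF assms]) simp
  then show ?thesis
    by (rule less_le_trans[rotated]) simp
qed

lemma rth_variation_finite:
  assumes D: "\<And>t. t \<in> {0..1} \<Longrightarrow> D t \<longlonglongrightarrow> V t" and c: "(\<lambda>n. g (real n)) \<longlonglongrightarrow> c"
  shows "has_rth_variation p f (\<lambda>t. ereal_powr (ereal c) (p / 2) * ereal (V t))"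
  unfolding has_Phi_variation_def
proof
  fix t :: real assume t: "t \<in> {0..1}"
  have "(\<lambda>n. W p n * D t n) \<longlonglongrightarrow> c powr (p / 2) * V t"
    by (intro tendsto_mult W_p_tendsto c D t)
  from Lim_transform_eventually[OF this dyadic_sum_powr_eventually]
  show "(\<lambda>n. ereal (dyadic_sum (\<lambda>x. x powr p) f t n)) \<longlonglongrightarrow> ereal_powr (ereal c) (p / 2) * ereal (V t)"
    by (simp add: ereal_powr_def)
qed

lemma rth_variation_infinite:
  assumes D: "\<And>t. t \<in> {0..1} \<Longrightarrow> D t \<longlonglongrightarrow> L * t" and c: "filterlim (\<lambda>n. g (real n)) at_top sequentially"
  shows "has_rth_variation p f (\<lambda>t. ereal_powr \<infinity> (p / 2) * ereal (L * t))"
  unfolding has_Phi_variation_def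
proof
  fix t :: real assume t: "t \<in> {0..1}"
  have L: "0 < L" using moment_pos[of L] D[of 1] by simp
  show "(\<lambda>n. ereal (dyadic_sum (\<lambda>x. x powr p) f t n)) \<longlonglongrightarrow> ereal_powr \<infinity> (p / 2) * ereal (L * t)"
  proof (cases "t = 0")
    case True
    \<comment> \<open>At t = 0 the sum keeps the single index 0, and this one power vanishes in
      accordance with the convention that infinity times 0 is 0.\<close>
    have "(\<lambda>n. increment_bound n powr p) \<longlonglongrightarrow> 0 powr p"
    proof (rule tendsto_powr'[OF increment_bound_tendsto_0 tendsto_const])
      show "0 \<noteq> (0::real) \<or> 0 < p \<and> eventually (\<lambda>n. 0 \<le> increment_bound n) sequentially"
        using p by (simp add: increment_bound_def sum_nonneg)
    qed
    then have lim: "(\<lambda>n. increment_bound n powr p) \<longlonglongrightarrow> 0" by simp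
    have "dyadic_sum (\<lambda>x. x powr p) f t n = (\<bar>S n 0\<bar> / 2 ^ n) powr p" for n
    proof -
      have "{..nat \<lfloor>t * 2 ^ n\<rfloor>} - {2 ^ n} = {0}" using True by auto
      then show ?thesis unfolding dyadic_sum_eq by simp
    qed
    then have "norm (dyadic_sum (\<lambda>x. x powr p) f t n) \<le> increment_bound n powr p" for n
      using powr_mono2[OF less_imp_le[OF p(2)] _ abs_scaled_increment_le[of 0 n]] by simp
    then have "(\<lambda>n. dyadic_sum (\<lambda>x. x powr p) f t n) \<longlonglongrightarrow> 0"
      by (intro Lim_null_comparison[OF always_eventually lim] allI)
    then show ?thesis
      using True by (simp flip: zero_ereal_def) (simp add: zero_ereal_def)
  next
    case False
    with t have "0 < L * t" using L by simp
    from filterlim_tendsto_pos_mult_at_top[OF D[OF t] this W_p_at_top[OF c]]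
    have "filterlim (\<lambda>n. W p n * D t n) at_top sequentially"
      by (simp only: mult.commute)
    then have "filterlim (\<lambda>n. dyadic_sum (\<lambda>x. x powr p) f t n) at_top sequentially"
      by (rule filterlim_cong[THEN iffD1, OF refl refl dyadic_sum_powr_eventually])
    then have "(\<lambda>n. ereal (dyadic_sum (\<lambda>x. x powr p) f t n)) \<longlonglongrightarrow> \<infinity>"
      by (simp add: tendsto_PInfty_eq_at_top)
    moreover have "ereal_powr \<infinity> (p / 2) * ereal x = \<infinity>" if "0 < x" for x
      using that by (simp add: ereal_powr_def)
    from this[OF \<open>0 < L * t\<close>] have "ereal_powr \<infinity> (p / 2) * ereal (L * t) = \<infinity>" .
    ultimately show ?thesis by (simp only:)
  qed
qed

end

section \<open>Identification of the limits and the case of bounded \<open>s2\<close>\<close>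

context regular_signed_tent_series
begin

lemma D_tendsto_gaussian:
  assumes top: "filterlim s2 at_top sequentially" and q0: "q = 0" and t: "t \<in> {0..1}"
  shows "D t \<longlonglongrightarrow> sqrt (2 / pi) * t"
proof -
  have p1: "p = 1" by (simp add: p_eq q0)
  have ratio1: "(\<lambda>n. s2 (Suc n) / s2 n) \<longlonglongrightarrow> 1"
    using s2_Suc_ratio by (simp add: q0)
  have "(\<lambda>n. \<Prod>m\<in>{l..<n}. complex_of_real (cos (u * a m / s n))) \<longlonglongrightarrow> char std_normal_distribution u" for u l
    unfolding char_std_normal_distribution s_def of_real_prod[symmetric]
    using prod_cos_tendsto_gaussian[OF s2_a top ratio1, where l=l and t=u] by (intro tendsto_of_real) simp
  moreover have "integrable std_normal_distribution (\<lambda>x. \<bar>x\<bar> powr (p + 1))"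
    using integrable_std_normal_distribution_moment[of 2] by (simp add: p1)
  ultimately have "D t \<longlonglongrightarrow> integral\<^sup>L std_normal_distribution (\<lambda>x. \<bar>x\<bar> powr p) * t"
    by (intro D_tendsto[OF top real_dist_normal_dist _ _ t])
  moreover have "integral\<^sup>L std_normal_distribution (\<lambda>x. \<bar>x\<bar> powr p) = sqrt (2 / pi)"
    using std_normal_distribution_odd_moments_abs[of 0] by (simp add: p1)
  ultimately show ?thesis by simp
qed

text \<open>The weights \<open>c j\<close> of Z satisfy c_j^2 = (\<kappa> - 1) / \<kappa>^(j+1), the
  limiting weights of \<open>prod_cos_tendsto_geometric\<close>, so the cosine products converge to
  the characteristic function of Z. Absolute convergence makes Z bounded, so all moments
  exist.\<close>

lemma D_tendsto_Bernoulli: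
  assumes "symmetric_bernoulli M Y" and q0: "0 < q" and t: "t \<in> {0..1}"
    and Z: "\<And>\<omega>. Z \<omega> = sqrt (2 powr (2 * q) - 1) * (\<Sum>m. 2 powr (- q * real (m + 1)) * Y (m + 1) \<omega>)"
  shows "integrable M (\<lambda>\<omega>. \<bar>Z \<omega>\<bar> powr p)"
    and "D t \<longlonglongrightarrow> integral\<^sup>L M (\<lambda>\<omega>. \<bar>Z \<omega>\<bar> powr p) * t"
proof -
  interpret symmetric_bernoulli M Y by fact
  define \<kappa> where "\<kappa> = 2 powr (2 * q)"
  have \<kappa>: "1 < \<kappa>" using q0 by (simp add: \<kappa>_def)
  define c where "c m = sqrt (\<kappa> - 1) * 2 powr (- q * real (m + 1))" for m
  have geom: "2 powr (- q * real (m + 1)) = (2 powr (- q)) ^ (m + 1)" for m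
    by (subst powr_power) (simp_all add: mult.commute)
  have "summable (\<lambda>m. (2 powr (- q)) ^ m)"
    using q0 by (intro summable_geometric) (simp add: powr_less_one)
  then have sum2: "summable (\<lambda>m. 2 powr (- q * real (m + 1)))"
    unfolding geom by (simp add: summable_mult)
  then have sumc: "summable (\<lambda>m. \<bar>c m\<bar>)"
    using \<kappa> by (simp add: c_def abs_mult summable_mult)
  define X where "X \<omega> = (\<Sum>m. c m * Y (m + 1) \<omega>)" for \<omega>
  \<comment> \<open>Moving the square root into the series uses summability, available on the sample
    space where the signs are \<plusminus>1.\<close>
  have ZX: "Z \<omega> = X \<omega>" if "\<omega> \<in> space M" for \<omega>
  proof -
    have "summable (\<lambda>m. 2 powr (- q * real (m + 1)) * Y (m + 1) \<omega>)"
      using sum2 by (intro bounded_series(1)[OF _ that]) simp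
    from suminf_mult[OF this, of "sqrt (\<kappa> - 1)"] show ?thesis
      unfolding Z X_def c_def \<kappa>_def by (simp only: mult.assoc)
  qed
  have [measurable]: "X \<in> borel_measurable M"
    unfolding X_def[abs_def] by simp
  define B where "B = (\<Sum>m. \<bar>c m\<bar>)"
  have XB: "\<bar>X \<omega>\<bar> \<le> B" if "\<omega> \<in> space M" for \<omega>
    unfolding X_def B_def by (rule bounded_series(2)[OF sumc that])
  have intX: "integrable M (\<lambda>\<omega>. \<bar>X \<omega>\<bar> powr r)" if "0 < r" for r
    using XB that by (intro integrable_const_bound[of _ "B powr r"] AE_I2) (simp_all add: powr_mono2)
  then have "integrable M (\<lambda>\<omega>. \<bar>X \<omega>\<bar> powr p)"
    using p by blast
  then show "integrable M (\<lambda>\<omega>. \<bar>Z \<omega>\<bar> powr p)"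
    by (rule Bochner_Integration.integrable_cong[THEN iffD1, OF refl, rotated]) (simp add: ZX)
  have top: "filterlim s2 at_top sequentially"
    by (rule s2_at_top_of_pos[OF q0])
  have law: "real_distribution (distr M borel X)"
    by (rule real_distribution_distr) simp
  have "AE \<omega> in M. summable (\<lambda>m. c m * Y (m + 1) \<omega>)"
    by (rule AE_I2) (rule bounded_series(1)[OF sumc])
  from char_series[OF this]
  have char_lim: "(\<lambda>n. complex_of_real (\<Prod>m<n. cos (u * c m))) \<longlonglongrightarrow> char (distr M borel X) u" for u
    unfolding char_partial_sum X_def[abs_def] by simp
  have cos_prod: "(\<lambda>n. \<Prod>m\<in>{l..<n}. complex_of_real (cos (u * a m / s n))) \<longlonglongrightarrow> char (distr M borel X) u" for u l
  proof -
    \<comment> \<open>The geometric product lemma is real-valued; the characteristic function of X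
      is real as a limit of real products.\<close>
    have re: "(\<lambda>n. \<Prod>m<n. cos (u * c m)) \<longlonglongrightarrow> Re (char (distr M borel X) u)"
      using tendsto_Re[OF char_lim[of u]] by (simp only: Re_complex_of_real)
    have "complex_of_real (Re (char (distr M borel X) u)) = char (distr M borel X) u"
      by (rule LIMSEQ_unique[OF tendsto_of_real[OF re] char_lim])
    moreover have "(\<lambda>n. \<Prod>m\<in>{l..<n}. cos (u * a m / sqrt (s2 n))) \<longlonglongrightarrow> Re (char (distr M borel X) u)"
    proof (rule prod_cos_tendsto_geometric[OF s2_a s2_pos _ \<kappa> _ _ re])
      show "(\<lambda>n. s2 (Suc n) / s2 n) \<longlonglongrightarrow> \<kappa>"
        using s2_Suc_ratio by (simp add: \<kappa>_def)
      show "0 \<le> c j" for j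
        using \<kappa> by (simp add: c_def)
      show "(c j)\<^sup>2 = (\<kappa> - 1) / \<kappa> ^ Suc j" for j
      proof -
        have "(2 powr (- q * real (j + 1)))\<^sup>2 = 1 / \<kappa> ^ Suc j"
        proof -
          have "(2 powr (- q * real (j + 1)))\<^sup>2 = 2 powr (- (2 * q * real (j + 1)))"
            by (simp add: power2_eq_square mult.assoc flip: powr_add)
          also have "\<dots> = 1 / 2 powr (2 * q * real (j + 1))"
            by (rule powr_minus_divide)
          also have "2 powr (2 * q * real (j + 1)) = \<kappa> ^ Suc j"
            unfolding \<kappa>_def by (subst powr_power) (simp_all add: mult.commute)
          finally show ?thesis .
        qed
        then show ?thesis
          using \<kappa> unfolding c_def power_mult_distrib by simp
      qed
    qed
    ultimately show ?thesis
      using tendsto_of_real unfolding s_def of_real_prod[symmetric] by metis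
  qed
  have "integrable (distr M borel X) (\<lambda>x. \<bar>x\<bar> powr (p + 1))"
    using intX[of "p + 1"] p by (subst integrable_distr_eq) simp_all
  then have "D t \<longlonglongrightarrow> integral\<^sup>L (distr M borel X) (\<lambda>x. \<bar>x\<bar> powr p) * t"
    by (rule D_tendsto[OF top law _ cos_prod t])
  also have "integral\<^sup>L (distr M borel X) (\<lambda>x. \<bar>x\<bar> powr p) = integral\<^sup>L M (\<lambda>\<omega>. \<bar>X \<omega>\<bar> powr p)"
    by (subst integral_distr) simp_all
  also have "\<dots> = integral\<^sup>L M (\<lambda>\<omega>. \<bar>Z \<omega>\<bar> powr p)"
    by (intro Bochner_Integration.integral_cong) (simp_all add: ZX)
  finally show "D t \<longlonglongrightarrow> integral\<^sup>L M (\<lambda>\<omega>. \<bar>Z \<omega>\<bar> powr p) * t" .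
qed

lemma dyadic_V_one: "dyadic_V 1 f n = (\<Sum>k<2 ^ n. \<bar>S n k\<bar>) / 2 ^ n"
  unfolding dyadic_V_eq by (simp add: sum_divide_distrib)

text \<open>The crude |x| \<le> 1 + x^2 suffices, as only boundedness in terms of \<open>s2\<close>
  is at stake.\<close>

lemma dyadic_V_one_le: "dyadic_V 1 f n \<le> 1 + s2 n"
proof -
  have "(\<Sum>k<2 ^ n. \<bar>S n k\<bar>) \<le> (\<Sum>k<2 ^ n. 1 + (S n k)\<^sup>2)"
  proof (rule sum_mono)
    fix k
    have "0 \<le> (\<bar>S n k\<bar> - 1/2)\<^sup>2" by simp
    then show "\<bar>S n k\<bar> \<le> 1 + (S n k)\<^sup>2" by (simp add: power2_diff power_divide)
  qed
  also have "\<dots> = 2 ^ n * (1 + s2 n)"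
    by (simp add: sum.distrib signed_tree_sum_square[OF tree] s2_a algebra_simps)
  finally show ?thesis
    by (simp add: dyadic_V_one field_simps)
qed

lemma dyadic_V_one_ge: "s n * (13 / 64) \<le> dyadic_V 1 f n"
  using signed_tree_first_moment_lower[OF tree, of n] by (simp add: dyadic_V_one s_def s2_a field_simps)

lemma dyadic_V_one_incseq: "incseq (\<lambda>n. ereal (dyadic_V 1 f n))"
  by (intro incseq_SucI) (simp add: dyadic_V_mono)

text \<open>By monotonicity \<open>s2\<close> always has a limit in the extended reals, namely its
  supremum, so \<open>lim\<close> denotes a true limit.\<close>

lemma finite_lim_s2_iff: "lim (\<lambda>n. ereal (s2 n)) < \<infinity> \<longleftrightarrow> (\<exists>K. \<forall>n. s2 n \<le> K)"
proof -
  have "incseq (\<lambda>n. ereal (s2 n))"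
    using s2_mono by (simp add: incseq_def)
  then have lim: "lim (\<lambda>n. ereal (s2 n)) = (SUP n. ereal (s2 n))"
    by (intro limI LIMSEQ_SUP)
  show ?thesis
  proof
    assume "lim (\<lambda>n. ereal (s2 n)) < \<infinity>"
    then obtain K where "(SUP n. ereal (s2 n)) \<le> ereal K"
      unfolding lim by (cases "SUP n. ereal (s2 n)") auto
    then have "s2 n \<le> K" for n
      by (meson SUP_le_iff UNIV_I ereal_less_eq(3))
    then show "\<exists>K. \<forall>n. s2 n \<le> K" by blast
  next
    assume "\<exists>K. \<forall>n. s2 n \<le> K"
    then obtain K where "\<And>n. s2 n \<le> K" by blast
    then have "(SUP n. ereal (s2 n)) \<le> ereal K"
      by (intro SUP_least) simp
    then show "lim (\<lambda>n. ereal (s2 n)) < \<infinity>"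
      unfolding lim by (rule le_less_trans) simp
  qed
qed

text \<open>Total variation is the supremum of the dyadic sums, each between a constant multiple of
  \<open>s n\<close> and \<open>1 + s2 n\<close>.\<close>

lemma finite_total_variation_iff: "total_variation f 0 1 < \<infinity> \<longleftrightarrow> (\<exists>K. \<forall>n. s2 n \<le> K)"
proof
  assume "total_variation f 0 1 < \<infinity>"
  moreover have "ereal (dyadic_V 1 f 0) \<le> total_variation f 0 1"
    unfolding total_variation_eq by (rule SUP_upper) simp
  ultimately obtain K where "total_variation f 0 1 = ereal K"
    by (cases "total_variation f 0 1") auto
  then have K: "dyadic_V 1 f n \<le> K" for n
    using SUP_upper[of n UNIV "\<lambda>n. ereal (dyadic_V 1 f n)"] by (simp add: total_variation_eq)
  have "s2 n \<le> (64 / 13 * K)\<^sup>2" for n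
  proof -
    have "s n \<le> 64 / 13 * K"
      using dyadic_V_one_ge[of n] K[of n] by simp
    then have "(s n)\<^sup>2 \<le> (64 / 13 * K)\<^sup>2"
      by (rule power_mono) (simp add: s_def s2_nonneg)
    then show ?thesis by (simp add: s_def s2_nonneg)
  qed
  then show "\<exists>K. \<forall>n. s2 n \<le> K" by blast
next
  assume "\<exists>K. \<forall>n. s2 n \<le> K"
  then obtain K where "\<And>n. s2 n \<le> K" by blast
  then have "dyadic_V 1 f n \<le> 1 + K" for n
    using dyadic_V_one_le[of n] by (meson add_left_mono order_trans)
  then have "total_variation f 0 1 \<le> ereal (1 + K)"
    unfolding total_variation_eq by (intro SUP_least) simp
  then show "total_variation f 0 1 < \<infinity>"
    by (rule le_less_trans) simp
qed

lemma total_variation_expectation: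
  assumes "symmetric_bernoulli M Y" and K: "\<And>n. s2 n \<le> K"
    and Zt: "\<And>\<omega>. Zt \<omega> = (\<Sum>m. \<alpha> m * 2 ^ m * Y (m + 1) \<omega>)"
  shows "AE \<omega> in M. summable (\<lambda>m. \<alpha> m * 2 ^ m * Y (m + 1) \<omega>)"
    and "integrable M (\<lambda>\<omega>. \<bar>Zt \<omega>\<bar>)"
    and "total_variation f 0 1 = ereal (integral\<^sup>L M (\<lambda>\<omega>. \<bar>Zt \<omega>\<bar>))"
proof -
  interpret symmetric_bernoulli M Y by fact
  have sq: "summable (\<lambda>m. (a m)\<^sup>2)"
    using K by (intro summableI_nonneg_bounded[of _ K]) (simp_all add: s2_a)
  have Zt_a: "Zt \<omega> = (\<Sum>m. a m * Y (m + 1) \<omega>)" for \<omega>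
    by (simp add: Zt a_def)
  show "AE \<omega> in M. summable (\<lambda>m. \<alpha> m * 2 ^ m * Y (m + 1) \<omega>)"
    using AE_summable_of_square_summable[OF sq] by (simp add: a_def)
  show "integrable M (\<lambda>\<omega>. \<bar>Zt \<omega>\<bar>)"
    unfolding Zt_a by (rule first_moment_series(1)[OF tree sq])
  have "(\<lambda>n. ereal (dyadic_V 1 f n)) \<longlonglongrightarrow> ereal (integral\<^sup>L M (\<lambda>\<omega>. \<bar>Zt \<omega>\<bar>))"
    unfolding Zt_a dyadic_V_one by (intro tendsto_ereal first_moment_series(2)[OF tree sq])
  moreover have "(\<lambda>n. ereal (dyadic_V 1 f n)) \<longlonglongrightarrow> total_variation f 0 1"
    unfolding total_variation_eq by (rule LIMSEQ_SUP[OF dyadic_V_one_incseq])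
  ultimately show "total_variation f 0 1 = ereal (integral\<^sup>L M (\<lambda>\<omega>. \<bar>Zt \<omega>\<bar>))"
    by (rule LIMSEQ_unique[rotated])
qed

text \<open>Dropping the last increment of the prefix sum makes the sums increasing in \<open>n\<close>.\<close>

lemma dyadic_sum_abs_convergent:
  assumes K: "\<And>n. s2 n \<le> K" and t: "t \<in> {0..1}"
  shows "convergent (\<lambda>n. \<Sum>k\<in>dyadic_prefix t n. \<bar>S n k\<bar> / 2 ^ n)"
proof -
  define j where "j n = nat \<lfloor>t * 2 ^ n\<rfloor>" for n
  define x where "x n k = \<bar>S n k\<bar> / 2 ^ n" for n k
  define U where "U n = (\<Sum>k<j n. x n k)" for n
  have x0: "0 \<le> x n k" for n k by (simp add: x_def)
  have x_inc: "x n k = \<bar>dyadic_increment f n k\<bar>" for n k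
    by (simp add: x_def scaled_increment_def abs_mult)
  have j_le: "j n \<le> 2 ^ n" for n
  proof -
    have "t * 2 ^ n \<le> 1 * 2 ^ n" using t by (intro mult_right_mono) auto
    then have "j n \<le> nat \<lfloor>(2::real) ^ n\<rfloor>" unfolding j_def by (intro nat_mono floor_mono) simp
    then show ?thesis by (simp only: nat_floor_power2)
  qed
  have U_mono: "U n \<le> U (Suc n)" for n
  proof -
    have "U n \<le> (\<Sum>k\<in>{0..<j n}. x (Suc n) (2 * k) + x (Suc n) (2 * k + 1))"
      unfolding U_def lessThan_atLeast0 x_inc dyadic_increment_split[of f n]
      by (intro sum_mono abs_triangle_ineq)
    also have "\<dots> = (\<Sum>k\<in>{2 * 0..<2 * j n}. x (Suc n) k)"
      by (rule sum_dyadic_double[symmetric])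
    also have "\<dots> \<le> U (Suc n)"
      unfolding U_def
    proof (rule sum_mono2)
      have "real (2 * j n) \<le> t * 2 ^ Suc n"
        using t by (simp add: j_def)
      then have "2 * j n \<le> j (Suc n)"
        unfolding j_def[of "Suc n"] by (rule le_nat_floor)
      then show "{2 * 0..<2 * j n} \<subseteq> {..<j (Suc n)}" by auto
    qed (simp_all add: x0)
    finally show ?thesis .
  qed
  have U_bound: "U n \<le> 1 + K" for n
  proof -
    have "U n \<le> (\<Sum>k<2 ^ n. x n k)"
      unfolding U_def using j_le[of n] x0 by (intro sum_mono2) auto
    also have "\<dots> = dyadic_V 1 f n"
      by (simp add: dyadic_V_one x_def sum_divide_distrib)
    also have "\<dots> \<le> 1 + K"
      using dyadic_V_one_le[of n] K[of n] by simp
    finally show ?thesis .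
  qed
  have "incseq U" by (rule incseq_SucI) (rule U_mono)
  then obtain T where T: "U \<longlonglongrightarrow> T"
    using incseq_convergent[of U "1 + K"] U_bound by metis
  \<comment> \<open>The dropped increment is at most \<open>increment_bound n\<close>; at t = 1 the
    prefix already omits it and nothing is lost.\<close>
  have diff: "norm ((\<Sum>k\<in>dyadic_prefix t n. x n k) - U n) \<le> increment_bound n" for n
  proof (cases "j n = 2 ^ n")
    case True
    then have "dyadic_prefix t n = {..<j n}"
      unfolding dyadic_prefix_def j_def[symmetric] by auto
    then show ?thesis by (simp add: U_def increment_bound_def sum_nonneg)
  next
    case False
    then have jl: "j n < 2 ^ n" using j_le[of n] by simp
    then have "dyadic_prefix t n = insert (j n) {..<j n}"
      unfolding dyadic_prefix_def j_def[symmetric] by auto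
    then have "(\<Sum>k\<in>dyadic_prefix t n. x n k) - U n = x n (j n)"
      by (simp add: U_def)
    then show ?thesis
      using abs_scaled_increment_le[OF jl] x0[of n "j n"] by (simp add: x_def)
  qed
  have "(\<lambda>n. (\<Sum>k\<in>dyadic_prefix t n. x n k) - U n) \<longlonglongrightarrow> 0"
    by (rule Lim_null_comparison[OF always_eventually increment_bound_tendsto_0]) (rule allI, rule diff)
  from tendsto_add[OF this T] have "(\<lambda>n. \<Sum>k\<in>dyadic_prefix t n. x n k) \<longlonglongrightarrow> T" by simp
  then show ?thesis unfolding x_def by (rule convergentI)
qed

text \<open>Bounded \<open>s2\<close> forces q = 0, and the hypothesis then reads g(n) -> lim
  \<open>s2\<close>, which is positive. The first signs remain visible here, so a limit of
  \<open>D t\<close> is obtained from monotone sums without a claim of linearity in t.\<close>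

lemma bounded_s2_limits:
  assumes K: "\<And>n. s2 n \<le> K"
  obtains c V where "0 < c" "(\<lambda>n. g (real n)) \<longlonglongrightarrow> c" "\<And>t. t \<in> {0..1} \<Longrightarrow> D t \<longlonglongrightarrow> V t"
proof -
  have q0: "q = 0"
  proof (rule ccontr)
    assume "q \<noteq> 0"
    then have "filterlim s2 at_top sequentially" using q by (intro s2_at_top_of_pos) simp
    then have "eventually (\<lambda>n. K < s2 n) sequentially" by (simp add: filterlim_at_top_dense)
    then obtain n where "K < s2 n" by (auto simp: eventually_sequentially)
    with K[of n] show False by simp
  qed
  then have p1: "p = 1" by (simp add: p_eq)
  obtain c where c: "s2 \<longlonglongrightarrow> c" "\<And>n. s2 n \<le> c"
    using incseq_convergent[OF s2_mono, of K] K by metis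
  obtain n where "0 < s2 n"
    using s2_pos by (auto simp: eventually_sequentially)
  with c(2)[of n] have c0: "0 < c" by simp
  have "(\<lambda>n. s2 n / (s2 n / (2 powr (2 * q * real n) * g (real n)))) \<longlonglongrightarrow> c / 1"
    by (intro tendsto_divide c(1) ratio) simp
  moreover have "eventually (\<lambda>n. s2 n / (s2 n / (2 powr (2 * q * real n) * g (real n))) = g (real n)) sequentially"
    using s2_pos by eventually_elim (simp add: q0)
  ultimately have gc: "(\<lambda>n. g (real n)) \<longlonglongrightarrow> c"
    using Lim_transform_eventually by fastforce
  have "\<exists>V. D t \<longlonglongrightarrow> V" if t: "t \<in> {0..1}" for t
  proof -
    from dyadic_sum_abs_convergent[OF K t] obtain T where
      T: "(\<lambda>n. \<Sum>k\<in>dyadic_prefix t n. \<bar>S n k\<bar> / 2 ^ n) \<longlonglongrightarrow> T"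
      by (auto simp: convergent_def)
    have "(\<lambda>n. (\<Sum>k\<in>dyadic_prefix t n. \<bar>S n k\<bar> / 2 ^ n) / s n) \<longlonglongrightarrow> T / sqrt c"
      unfolding s_def using c0 by (intro tendsto_divide T tendsto_real_sqrt c(1)) simp
    moreover have "eventually (\<lambda>n. (\<Sum>k\<in>dyadic_prefix t n. \<bar>S n k\<bar> / 2 ^ n) / s n = D t n) sequentially"
      using s_pos
    proof eventually_elim
      case (elim n)
      then show ?case
        unfolding D_def sum_divide_distrib unfolding p1 by (simp add: mult.commute)
    qed
    ultimately have "D t \<longlonglongrightarrow> T / sqrt c"
      by (rule Lim_transform_eventually)
    then show ?thesis by blast
  qed
  then obtain V where "\<And>t. t \<in> {0..1} \<Longrightarrow> D t \<longlonglongrightarrow> V t"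
    by metis
  with c0 gc show ?thesis by (rule that)
qed

lemma s2_bounded_or_at_top:
  obtains K where "\<And>n. s2 n \<le> K" | "filterlim s2 at_top sequentially"
proof (cases "\<exists>K. \<forall>n. s2 n \<le> K")
  case True
  then show ?thesis using that(1) by blast
next
  case False
  have "filterlim s2 at_top sequentially"
    unfolding filterlim_at_top
  proof
    fix Z
    from False obtain N where "Z \<le> s2 N" by (meson linear)
    then show "eventually (\<lambda>n. Z \<le> s2 n) sequentially"
      using s2_mono by (auto simp: eventually_sequentially incseq_def intro: order_trans)
  qed
  then show ?thesis by (rule that(2))
qed

text \<open>If \<open>s2\<close> is bounded, uniqueness of limits makes \<open>c\<close> finite and
  positive. Otherwise \<open>D t\<close> tends to a multiple of t, and \<open>c\<close> may be any
  value from 0 to infinity.\<close>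

lemma p_variation:
  assumes c: "0 \<le> c" "(\<lambda>n. ereal (g (real n))) \<longlonglongrightarrow> c"
    and D: "filterlim s2 at_top sequentially \<Longrightarrow> \<exists>L. \<forall>t\<in>{0..1}. D t \<longlonglongrightarrow> L * t"
  shows "\<exists>V :: real \<Rightarrow> real. has_Phi_variation (Phi g q) f (\<lambda>t. ereal (V t)) \<and>
    has_rth_variation p f (\<lambda>t. ereal_powr c (p / 2) * ereal (V t))"
proof (rule s2_bounded_or_at_top)
  fix K assume K: "\<And>n. s2 n \<le> K"
  obtain c' V where c': "0 < c'" "(\<lambda>n. g (real n)) \<longlonglongrightarrow> c'" "\<And>t. t \<in> {0..1} \<Longrightarrow> D t \<longlonglongrightarrow> V t"
    using bounded_s2_limits[OF K] by blast
  have "c = ereal c'"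
    by (rule LIMSEQ_unique[OF c(2) tendsto_ereal[OF c'(2)]])
  then show ?thesis
    using has_Phi_variation_of_D[OF c'(3)] rth_variation_finite[OF c'(3,2)] by blast
next
  assume "filterlim s2 at_top sequentially"
  from D[OF this] obtain L where L: "\<And>t. t \<in> {0..1} \<Longrightarrow> D t \<longlonglongrightarrow> L * t"
    by blast
  show ?thesis
  proof (cases c)
    case (real c')
    then have "(\<lambda>n. g (real n)) \<longlonglongrightarrow> c'"
      using c(2) by simp
    then show ?thesis
      using has_Phi_variation_of_D[OF L] rth_variation_finite[OF L] real by blast
  next
    case PInf
    then have "filterlim (\<lambda>n. g (real n)) at_top sequentially"
      using c(2) by (simp add: tendsto_PInfty_eq_at_top)
    then show ?thesis
      using has_Phi_variation_of_D[OF L] rth_variation_infinite[OF L] PInf by blast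
  qed (use c(1) in simp)
qed

end

theorem corollary3p8:
  fixes \<alpha> :: "nat \<Rightarrow> real" and \<sigma> :: "nat \<Rightarrow> real \<Rightarrow> real" and f :: "real \<Rightarrow> real"
    and s2 :: "nat \<Rightarrow> real" and q p \<rho> :: real and g :: "real \<Rightarrow> real"
    and M :: "'w measure" and Y :: "nat \<Rightarrow> 'w \<Rightarrow> real" and Z Zt :: "'w \<Rightarrow> real"
  assumes "summable (\<lambda>m. \<bar>\<alpha> m\<bar>)"
    and "\<And>m t. t \<in> {0..1} \<Longrightarrow> \<sigma> m t \<in> {-1, 1}"
    and "\<And>m k. k \<in> {1..2 ^ m} \<Longrightarrow> \<sigma> m constant_on {(real k - 1) / 2 ^ m ..< real k / 2 ^ m}"
    and "\<And>t. t \<in> {0..1} \<Longrightarrow> f t = (\<Sum>m. \<alpha> m * \<sigma> m t * tent_map (2 ^ m * t))"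
    and "\<And>n. s2 n = (\<Sum>m<n. (\<alpha> m)\<^sup>2 * 4 ^ m)"
    and "0 \<le> q" and "q < 1"
    and "regularly_varying g \<rho>"
    and "(\<lambda>n. s2 n / (2 powr (2 * q * real n) * g (real n))) \<longlonglongrightarrow> 1"
    and "p = 1 / (1 - q)"
    and "iid_symmetric_bernoulli M Y"
    and "\<And>\<omega>. Zt \<omega> = (\<Sum>m. \<alpha> m * 2 ^ m * Y (m + 1) \<omega>)"
    and "\<And>\<omega>. Z \<omega> = sqrt (2 powr (2 * q) - 1) * (\<Sum>m. 2 powr (- q * real (m + 1)) * Y (m + 1) \<omega>)"
  shows
    "(total_variation f 0 1 < \<infinity> \<longleftrightarrow> lim (\<lambda>n. ereal (s2 n)) < \<infinity>) \<and>
     (total_variation f 0 1 < \<infinity> \<longrightarrow>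
        (AE \<omega> in M. summable (\<lambda>m. \<alpha> m * 2 ^ m * Y (m + 1) \<omega>)) \<and>
        integrable M (\<lambda>\<omega>. \<bar>Zt \<omega>\<bar>) \<and>
        total_variation f 0 1 = ereal (prob_space.expectation M (\<lambda>\<omega>. \<bar>Zt \<omega>\<bar>))) \<and>
     (filterlim s2 at_top sequentially \<and> q = 0 \<longrightarrow>
        has_Phi_variation (Phi g 0) f (\<lambda>t. ereal (sqrt (2 / pi) * t))) \<and>
     (q > 0 \<longrightarrow>
        integrable M (\<lambda>\<omega>. \<bar>Z \<omega>\<bar> powr (1 / (1 - q))) \<and>
        has_Phi_variation (Phi g q) f
          (\<lambda>t. ereal (prob_space.expectation M (\<lambda>\<omega>. \<bar>Z \<omega>\<bar> powr (1 / (1 - q))) * t))) \<and>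
     ((\<forall>r. 1 \<le> r \<and> r < p \<longrightarrow> infinite_variation r f) \<and>
      (\<forall>r. r > p \<longrightarrow> vanishing_variation r f)) \<and>
     (\<forall>c::ereal. 0 \<le> c \<and> (\<lambda>n. ereal (g (real n))) \<longlonglongrightarrow> c \<longrightarrow>
        (\<exists>V :: real \<Rightarrow> real.
           has_Phi_variation (Phi g q) f (\<lambda>t. ereal (V t)) \<and>
           has_rth_variation p f (\<lambda>t. ereal_powr c (p / 2) * ereal (V t)))) \<and>
     (\<rho> < 0 \<longrightarrow> vanishing_variation p f) \<and>
     (\<rho> > 0 \<longrightarrow> infinite_variation p f)"
proof -
  interpret regular_signed_tent_series \<alpha> \<sigma> f s2 q p \<rho> g
    by unfold_locales (fact assms)+
  have B: "symmetric_bernoulli M Y"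
    by (rule iid_symmetric_bernoulli_locale) fact
  note Zt = assms(12) and Z = assms(13)
  have tv: "total_variation f 0 1 < \<infinity> \<longleftrightarrow> lim (\<lambda>n. ereal (s2 n)) < \<infinity>"
    by (simp only: finite_total_variation_iff finite_lim_s2_iff)
  have expectation: "(AE \<omega> in M. summable (\<lambda>m. \<alpha> m * 2 ^ m * Y (m + 1) \<omega>)) \<and>
      integrable M (\<lambda>\<omega>. \<bar>Zt \<omega>\<bar>) \<and>
      total_variation f 0 1 = ereal (prob_space.expectation M (\<lambda>\<omega>. \<bar>Zt \<omega>\<bar>))"
    if fin: "total_variation f 0 1 < \<infinity>"
  proof -
    obtain K where K: "\<And>n. s2 n \<le> K"
      using fin finite_total_variation_iff by blast
    show ?thesis
      using total_variation_expectation[OF B K Zt] by blast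
  qed
  have gaussian: "has_Phi_variation (Phi g 0) f (\<lambda>t. ereal (sqrt (2 / pi) * t))"
    if "filterlim s2 at_top sequentially" "q = 0"
    using has_Phi_variation_of_D[OF D_tendsto_gaussian[OF that]] that(2) by simp
  have bernoulli: "integrable M (\<lambda>\<omega>. \<bar>Z \<omega>\<bar> powr (1 / (1 - q))) \<and>
      has_Phi_variation (Phi g q) f
        (\<lambda>t. ereal (prob_space.expectation M (\<lambda>\<omega>. \<bar>Z \<omega>\<bar> powr (1 / (1 - q))) * t))"
    if "q > 0"
    \<comment> \<open>The integrability claim inherits the assumption on t from its lemma; t = 0
      serves as an arbitrary admissible value.\<close>
    using D_tendsto_Bernoulli(1)[OF B that, of 0, OF _ Z]
      has_Phi_variation_of_D[OF D_tendsto_Bernoulli(2)[OF B that _ Z]]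
    unfolding p_eq by simp
  have infinite: "infinite_variation r f" if "1 \<le> r" "r < p" for r
    by (rule infinite_variation_of_W[OF that(1) W_at_top[OF that(2)]])
  have vanishing: "vanishing_variation r f" if "p < r" for r
    by (rule vanishing_variation_of_W[OF _ W_tendsto_0[OF that]]) (use that p(1) in linarith)
  have linear: "\<exists>L. \<forall>t\<in>{0..1}. D t \<longlonglongrightarrow> L * t" if "filterlim s2 at_top sequentially"
  proof (cases "q = 0")
    case True
    then show ?thesis using D_tendsto_gaussian[OF that] by blast
  next
    case False
    then have "q > 0" using q by simp
    then show ?thesis using D_tendsto_Bernoulli(2)[OF B _ _ Z] by blast
  qed
  have negative: "vanishing_variation p f" if "\<rho> < 0"
  proof (rule vanishing_variation_of_W[OF p(1)])
    show "W p \<longlonglongrightarrow> 0"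
      using W_p_tendsto[OF regularly_varying_limit(2)[OF g that]] by simp
  qed
  have positive: "infinite_variation p f" if "\<rho> > 0"
    by (rule infinite_variation_of_W[OF p(1) W_p_at_top[OF regularly_varying_limit(1)[OF g that]]])
  show ?thesis
    using tv expectation gaussian bernoulli infinite vanishing p_variation[OF _ _ linear] negative positive by blast
qed

end
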